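(* Let $G$ be a Lie group with Lie algebra $\mathfrak g$ and consider the symplectic manifold ${}^{1}T^*T^*G=(G\circledS\mathfrak g_1^* )\circledS(\mathfrak g_2^*\times\mathfrak g_3)\ni(g,\mu,\nu,\xi)$, with the symplectic action of the Abelian group $\mathfrak g^*$ given by $$(\lambda;(g,\mu,\nu,\xi))\mapsto(g,\lambda+\mu,\nu-ad^*_\xi\lambda,\xi).$$ (1) The Poisson reduction of ${}^{1}T^*T^*G$ with this action of $\mathfrak g^*$ results in $G\circledS(\mathfrak g_2^*\times\mathfrak g_3)\ni(g,\nu,\xi)$ endowed with the bracket $$\{H,K\}(g,\nu,\xi)=\Big\langle T_e^*R_g\frac{\delta K}{\delta g},\frac{\delta H}{\delta\nu}\Big\rangle-\Big\langle T_e^*R_g\frac{\delta H}{\delta g},\frac{\delta K}{\delta\nu}\Big\rangle+\Big\langle\Big[\frac{\delta K}{\delta\nu},\xi\Big],\frac{\delta H}{\delta\xi}\Big\rangle-\Big\langle\Big[\frac{\delta H}{\delta\nu},\xi\Big],\frac{\delta K}{\delta\xi}\Big\rangle+\Big\langle\nu,\Big[\frac{\delta H}{\delta\nu},\frac{\delta K}{\delta\nu}\Big]\Big\rangle.$$ (2) The application of Marsden–Weinstein symplectic reduction with this action of $\mathfrak g^*$ on ${}^{1}T^*T^*G$, having the momentum mapping $$\mathbf J:{}^{1}T^*T^*G\to\mathfrak g,\qquad (g,\mu,\nu,\xi)\mapsto\xi,$$ results in the reduced symplectic space $\mathbf J^{-1}(\xi)/\mathfrak g^*$ isomorphic to $G\circledS\mathfrak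 g^*$ with the canonical symplectic two-form $\Omega_{G\circledS\mathfrak g^*}$.
   Context: Conventions. $G$ is a Lie group with identity $e$, $\mathfrak g=T_eG$, $\mathfrak g^*$ its dual. $R_g$ is right translation and $T_e^*R_g:T_g^*G\to\mathfrak g^*$ is the dual of $T_eR_g$. $Ad_g$ is the tangent map at $e$ of $h\mapsto g^{-1}hg$; the Lie bracket is $[\xi,\eta]=ad_\xi\eta$, the derivative of $Ad_g\eta$ at $g=e$ in the direction $\xi$ (the bracket of right invariant vector fields). $\langle ad^*_\xi\mu,\eta\rangle=\langle\mu,[\xi,\eta]\rangle$. Partial derivatives: $\delta H/\delta g\in T_g^*G$, $\delta H/\delta\nu\in\mathfrak g$, $\delta H/\delta\xi\in\mathfrak g^*$. ${}^{1}T^*T^*G$ is the trivialization of the cotangent bundle of the group $G\circledS\mathfrak g^*\simeq T^*G$; as a manifold it is $G\times\mathfrak g^*\times\mathfrak g^*\times\mathfrak g$ (subscripts on copies are only labels). For $(\eta,\lambda_1,\lambda_2,\zeta)\in\mathfrak g\times\mathfrak g^*\times\mathfrak g^*\times\mathfrak g$ let $$X_{(\eta,\lambda_1,\lambda_2,\zeta)}(g,\mu,\nu,\xi)=(T_eR_g\eta,\ \lambda_1+ad^*_\eta\mu,\ \lambda_2+ad^*_\eta\nu-ad^*_\xi\lambda_1,\ \zeta+[\xi,\eta]).$$ The symplectic form is determined by $$\Omega(X_{(\eta,\lambda_1,\lambda_2,\zeta)},X_{(\bar\eta,\bar\lambda_1,\bar\lambda_2,\bar\zeta)})=\langle\lambda_2,\bar\eta\rangle+\langle\zeta-[\eta,\xi],\bar\lambda_1\rangle-\langle\bar\lambda_2,\eta\rangle+\langle[\bar\eta,\xi]-\bar\zeta,\lambda_1\rangle+\langle\nu,[\eta,\bar\eta]\rangle.$$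 Hamiltonian vector fields satisfy $i_{X_H}\Omega=-dH$, and the sign convention for Poisson brackets is $\{H,K\}=-\langle dH,X_K\rangle$. $G\circledS(\mathfrak g_2^*\times\mathfrak g_3)$ is $G\times\mathfrak g^*\times\mathfrak g$ as a manifold. $G\circledS\mathfrak g^*$ is $G\times\mathfrak g^*$ as a manifold; with $X_{(\xi,\nu)}(g,\mu)=(T_eR_g\xi,\nu+ad^*_\xi\mu)$, its canonical symplectic form is determined by $$\Omega_{G\circledS\mathfrak g^*}(X_{(\xi,\nu)},X_{(\eta,\lambda)})(g,\mu)=\langle\nu,\eta\rangle-\langle\lambda,\xi\rangle+\langle\mu,[\xi,\eta]\rangle.$$
   Formalization: In (1) the reduced space is identified with G x g* x g by an isomorphism keeping g and ν of the orbit of (g,0,ν,ξ) but possibly changing ξ: keeping ξ is impossible when [ , ] is nonzero, since J=ξ commutes with all invariant functions. G has positive finite dimension. *)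

theory Defs
  imports "HOL-Analysis.Analysis" "HOL-Algebra.Group"
begin

section \<open>Smooth manifolds modelled on a normed vector space\<close>

text \<open>
  \<open>C_on n S f\<close> says that all iterated directional derivatives of \<open>f\<close> up to order \<open>n\<close> exist
  and are continuous on the open set \<open>S\<close>.  On the finite-dimensional spaces used
  below this is \<open>f\<close> being of class \<open>C\<^sup>n\<close>.
\<close>

primrec C_on :: "nat \<Rightarrow> 'a::real_normed_vector set \<Rightarrow> ('a \<Rightarrow> 'b::real_normed_vector) \<Rightarrow> bool" where
  "C_on 0 S f \<longleftrightarrow> continuous_on S f"
| "C_on (Suc n) S f \<longleftrightarrow> (\<forall>x\<in>S. f differentiable (at x)) \<and>
     (\<forall>v. C_on n S (\<lambda>x. frechet_derivative f (at x) v))"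

definition smooth_on :: "'a::real_normed_vector set \<Rightarrow> ('a \<Rightarrow> 'b::real_normed_vector) \<Rightarrow> bool" where
  "smooth_on S f \<longleftrightarrow> (\<forall>n. C_on n S f)"

text \<open>
  An atlas is given as a family that assigns to every point \<open>p\<close> a chart around \<open>p\<close>,
  that is, a domain and a coordinate map.  The tangent space at \<open>p\<close> is the model space,
  read in the chart assigned to \<open>p\<close>.
\<close>

type_synonym ('m, 'e) charts = "'m \<Rightarrow> 'm set \<times> ('m \<Rightarrow> 'e)"

definition cdom :: "('m, 'e) charts \<Rightarrow> 'm \<Rightarrow> 'm set" where
  "cdom C p = fst (C p)"

definition cmap :: "('m, 'e) charts \<Rightarrow> 'm \<Rightarrow> 'm \<Rightarrow> 'e" where
  "cmap C p = snd (C p)"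

definition cinv :: "('m, 'e) charts \<Rightarrow> 'm \<Rightarrow> 'e \<Rightarrow> 'm" where
  "cinv C p = inv_into (cdom C p) (cmap C p)"

definition smooth_manifold ::
    "('m::{t2_space,second_countable_topology}, 'e::real_normed_vector) charts \<Rightarrow> bool" where
  "smooth_manifold C \<longleftrightarrow>
     (\<forall>p. p \<in> cdom C p \<and> open (cdom C p) \<and> open (cmap C p ` cdom C p) \<and>
          homeomorphism (cdom C p) (cmap C p ` cdom C p) (cmap C p) (cinv C p)) \<and>
     (\<forall>p q. smooth_on (cmap C p ` (cdom C p \<inter> cdom C q)) (cmap C q \<circ> cinv C p))"

definition vec_charts :: "('a, 'a) charts" where
  "vec_charts = (\<lambda>_. (UNIV, \<lambda>x. x))"

definition prod_charts :: "('m, 'a) charts \<Rightarrow> ('n, 'b) charts \<Rightarrow> ('m \<times> 'n, 'a \<times> 'b) charts" where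
  "prod_charts C D = (\<lambda>(p, q). (cdom C p \<times> cdom D q, \<lambda>(x, y). (cmap C p x, cmap D q y)))"

text \<open>Smoothness of \<open>f\<close> on an open subset \<open>U\<close>.\<close>

definition smooth_map_on ::
    "('m::topological_space, 'a::real_normed_vector) charts \<Rightarrow>
     ('n::topological_space, 'b::real_normed_vector) charts \<Rightarrow> 'm set \<Rightarrow> ('m \<Rightarrow> 'n) \<Rightarrow> bool" where
  "smooth_map_on C D U f \<longleftrightarrow> continuous_on U f \<and>
     (\<forall>p q. smooth_on (cmap C p ` (cdom C p \<inter> U \<inter> f -` cdom D q)) (cmap D q \<circ> f \<circ> cinv C p))"

abbreviation smooth_map where
  "smooth_map C D f \<equiv> smooth_map_on C D UNIV f"

text \<open>The tangent map \<open>T\<^sub>p f\<close> from the tangent space at \<open>p\<close> to the one at \<open>f p\<close>.\<close>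

definition tangent_map ::
    "('m, 'a::real_normed_vector) charts \<Rightarrow> ('n, 'b::real_normed_vector) charts \<Rightarrow>
     ('m \<Rightarrow> 'n) \<Rightarrow> 'm \<Rightarrow> 'a \<Rightarrow> 'b" where
  "tangent_map C D f p = frechet_derivative (cmap D (f p) \<circ> f \<circ> cinv C p) (at (cmap C p p))"

definition smooth_submersion ::
    "('m::topological_space, 'a::real_normed_vector) charts \<Rightarrow>
     ('n::topological_space, 'b::real_normed_vector) charts \<Rightarrow> ('m \<Rightarrow> 'n) \<Rightarrow> bool" where
  "smooth_submersion C D f \<longleftrightarrow> smooth_map C D f \<and> (\<forall>p. surj (tangent_map C D f p))"

abbreviation differential :: "('m, 'a::real_normed_vector) charts \<Rightarrow> ('m \<Rightarrow> real) \<Rightarrow> 'm \<Rightarrow> 'a \<Rightarrow> real" where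
  "differential C H p \<equiv> tangent_map C vec_charts H p"


section \<open>Symplectic forms, Poisson brackets, actions and reduction\<close>

type_synonym ('m, 'e) two_form = "'m \<Rightarrow> 'e \<Rightarrow> 'e \<Rightarrow> real"

text \<open>The two-form at the point with coordinates \<open>x\<close> in the chart around \<open>p\<close>, as a form on the model
  space in the coordinates of that chart.\<close>

definition local_form ::
    "('m, 'e::real_normed_vector) charts \<Rightarrow> ('m, 'e) two_form \<Rightarrow> 'm \<Rightarrow> 'e \<Rightarrow> 'e \<Rightarrow> 'e \<Rightarrow> real" where
  "local_form C \<omega> p x u v =
     (let q = cinv C p x; T = frechet_derivative (cmap C q \<circ> cinv C p) (at x) in \<omega> q (T u) (T v))"

definition symplectic_form ::
    "('m, 'e::real_normed_vector) charts \<Rightarrow> ('m, 'e) two_form \<Rightarrow> bool" where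
  "symplectic_form C \<omega> \<longleftrightarrow>
     (\<forall>p. bilinear (\<omega> p)) \<and>
     (\<forall>p u. \<omega> p u u = 0) \<and>
     (\<forall>p u. (\<forall>v. \<omega> p u v = 0) \<longrightarrow> u = 0) \<and>
     (\<forall>p u v. smooth_on (cmap C p ` cdom C p) (\<lambda>x. local_form C \<omega> p x u v)) \<and>
     (\<forall>p. \<forall>x \<in> cmap C p ` cdom C p. \<forall>u v w.
        frechet_derivative (\<lambda>x. local_form C \<omega> p x v w) (at x) u
      + frechet_derivative (\<lambda>x. local_form C \<omega> p x w u) (at x) v
      + frechet_derivative (\<lambda>x. local_form C \<omega> p x u v) (at x) w = 0)"

text \<open>Sign conventions: \<open>i\<^sub>X \<omega> = - dH\<close> for \<open>X = hamiltonian_vf C \<omega> H\<close>, and \<open>{H, K} = - dH (X\<^sub>K)\<close>.\<close>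

definition hamiltonian_vf ::
    "('m, 'e::real_normed_vector) charts \<Rightarrow> ('m, 'e) two_form \<Rightarrow> ('m \<Rightarrow> real) \<Rightarrow> 'm \<Rightarrow> 'e" where
  "hamiltonian_vf C \<omega> H p = (THE X. \<forall>v. \<omega> p X v = - differential C H p v)"

definition poisson_bracket ::
    "('m, 'e::real_normed_vector) charts \<Rightarrow> ('m, 'e) two_form \<Rightarrow>
     ('m \<Rightarrow> real) \<Rightarrow> ('m \<Rightarrow> real) \<Rightarrow> 'm \<Rightarrow> real" where
  "poisson_bracket C \<omega> H K p = - differential C H p (hamiltonian_vf C \<omega> K p)"

text \<open>Actions of the additive group of a vector space \<open>'a\<close>.\<close>

definition symplectic_action ::
    "('m::topological_space, 'e::real_normed_vector) charts \<Rightarrow> ('m, 'e) two_form \<Rightarrow>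
     ('a::real_normed_vector \<Rightarrow> 'm \<Rightarrow> 'm) \<Rightarrow> bool" where
  "symplectic_action C \<omega> act \<longleftrightarrow>
     (\<forall>p. act 0 p = p) \<and> (\<forall>a b p. act (a + b) p = act a (act b p)) \<and>
     smooth_map (prod_charts vec_charts C) C (\<lambda>(a, p). act a p) \<and>
     (\<forall>a p u v. \<omega> (act a p) (tangent_map C C (act a) p u) (tangent_map C C (act a) p v) = \<omega> p u v)"

definition orbit :: "('a \<Rightarrow> 'm \<Rightarrow> 'm) \<Rightarrow> 'm \<Rightarrow> 'm set" where
  "orbit act p = range (\<lambda>a. act a p)"

text \<open>
  \<open>\<Phi>\<close> identifies the orbit space with the manifold \<open>D\<close>: it is a bijection for
  which the canonical projection becomes a smooth submersion, which determines the smooth structure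
  of the quotient manifold.  The reduced bracket of two functions is the bracket of their (invariant) pullbacks, and \<open>\<Phi>\<close>
  carries it to the bracket \<open>br\<close>.
\<close>

definition poisson_reduction_iso ::
    "('m::topological_space, 'e::real_normed_vector) charts \<Rightarrow> ('m, 'e) two_form \<Rightarrow>
     ('a \<Rightarrow> 'm \<Rightarrow> 'm) \<Rightarrow> ('n::topological_space, 'b::real_normed_vector) charts \<Rightarrow>
     (('n \<Rightarrow> real) \<Rightarrow> ('n \<Rightarrow> real) \<Rightarrow> 'n \<Rightarrow> real) \<Rightarrow> ('m set \<Rightarrow> 'n) \<Rightarrow> bool" where
  "poisson_reduction_iso C \<omega> act D br \<Phi> \<longleftrightarrow>
     bij_betw \<Phi> (range (orbit act)) UNIV \<and>
     smooth_submersion C D (\<Phi> \<circ> orbit act) \<and>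
     (\<forall>H K p. smooth_map D vec_charts H \<longrightarrow> smooth_map D vec_charts K \<longrightarrow>
        poisson_bracket C \<omega> (H \<circ> \<Phi> \<circ> orbit act) (K \<circ> \<Phi> \<circ> orbit act) p
          = br H K (\<Phi> (orbit act p)))"

text \<open>
  Momentum map for an action of the vector group \<open>\<gg>\<^sup>*\<close>; its Lie algebra is \<open>\<gg>\<^sup>*\<close> and the dual of that
  is identified with \<open>\<gg>\<close>.  The infinitesimal generator of \<open>l\<close> is the Hamiltonian vector field
  of \<open>\<langle>l, J\<rangle>\<close>.  The group being Abelian, equivariance is invariance of \<open>J\<close>.
\<close>

type_synonym 'e dual = "'e \<Rightarrow>\<^sub>L real"

abbreviation pairing :: "'e::real_normed_vector dual \<Rightarrow> 'e \<Rightarrow> real" (\<open>\<langle>_,/ _\<rangle>\<close>) where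
  "\<langle>\<mu>, \<eta>\<rangle> \<equiv> blinfun_apply \<mu> \<eta>"

definition momentum_map ::
    "('m::topological_space, 'b::real_normed_vector) charts \<Rightarrow> ('m, 'b) two_form \<Rightarrow>
     ('e::real_normed_vector dual \<Rightarrow> 'm \<Rightarrow> 'm) \<Rightarrow> ('m \<Rightarrow> 'e) \<Rightarrow> bool" where
  "momentum_map C \<omega> act J \<longleftrightarrow>
     smooth_map C vec_charts J \<and>
     (\<forall>l p v. \<omega> p (tangent_map vec_charts C (\<lambda>k. act k p) 0 l) v
                = - differential C (\<lambda>q. \<langle>l, J q\<rangle>) p v) \<and>
     (\<forall>l p. J (act l p) = J p)"

text \<open>
  Marsden--Weinstein reduction at \<open>\<xi>\<close> for such an action (the isotropy group is the whole group):
  \<open>\<xi>\<close> is a regular value, and the bijection \<open>\<Phi>\<close> from the orbit space of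
  \<open>J\<^sup>-\<^sup>1(\<xi>)\<close> onto the manifold \<open>D\<close> turns the projection into a smooth submersion on the
  submanifold \<open>J\<^sup>-\<^sup>1(\<xi>)\<close>, whose tangent space at \<open>q\<close> is \<open>ker T\<^sub>q J\<close>, along which
  \<open>\<sigma>\<close> pulls back to the restriction of \<open>\<omega>\<close>.  Smoothness on the submanifold
  is expressed by the local extensions \<open>F\<close>.
\<close>

definition symplectic_reduction_iso ::
    "('m::topological_space, 'b::real_normed_vector) charts \<Rightarrow> ('m, 'b) two_form \<Rightarrow>
     ('a \<Rightarrow> 'm \<Rightarrow> 'm) \<Rightarrow> ('m \<Rightarrow> 'e::real_normed_vector) \<Rightarrow> 'e \<Rightarrow>
     ('n::topological_space, 'c::real_normed_vector) charts \<Rightarrow> ('n, 'c) two_form \<Rightarrow>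
     ('m set \<Rightarrow> 'n) \<Rightarrow> bool" where
  "symplectic_reduction_iso C \<omega> act J \<xi> D \<sigma> \<Phi> \<longleftrightarrow>
     (\<forall>p \<in> J -` {\<xi>}. surj (tangent_map C vec_charts J p)) \<and>
     bij_betw \<Phi> (orbit act ` (J -` {\<xi>})) UNIV \<and>
     (\<forall>p \<in> J -` {\<xi>}. \<exists>U F. open U \<and> p \<in> U \<and> smooth_map_on C D U F \<and>
        (\<forall>q \<in> U \<inter> J -` {\<xi>}.
           F q = \<Phi> (orbit act q) \<and>
           tangent_map C D F q ` {u. tangent_map C vec_charts J q u = 0} = UNIV \<and>
           (\<forall>u v. tangent_map C vec_charts J q u = 0 \<longrightarrow> tangent_map C vec_charts J q v = 0 \<longrightarrow>
              \<sigma> (F q) (tangent_map C D F q u) (tangent_map C D F q v) = \<omega> q u v)))"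


section \<open>Lie groups\<close>

record ('g, 'e) lie_struct = "'g monoid" +
  chart :: "('g, 'e) charts"

definition lie_group ::
    "('g::{t2_space,second_countable_topology}, 'e::euclidean_space) lie_struct \<Rightarrow> bool" where
  "lie_group G \<longleftrightarrow> group G \<and> carrier G = UNIV \<and> smooth_manifold (chart G) \<and>
     smooth_map (prod_charts (chart G) (chart G)) (chart G) (\<lambda>(g, h). g \<otimes>\<^bsub>G\<^esub> h) \<and>
     smooth_map (chart G) (chart G) (\<lambda>g. inv\<^bsub>G\<^esub> g)"

text \<open>
  The Lie algebra is the tangent space at the identity, so its elements are vectors of the model
  space \<open>'e\<close> and those of its dual have type \<open>'e dual\<close>.  With \<open>Ad\<^sub>g\<close> the tangent map of \<open>h \<mapsto> g\<^sup>-\<^sup>1 h g\<close>, the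
  bracket below is that of right invariant vector fields.
\<close>

definition TR :: "('g, 'e::real_normed_vector) lie_struct \<Rightarrow> 'g \<Rightarrow> 'e \<Rightarrow> 'e" where
  "TR G g = tangent_map (chart G) (chart G) (\<lambda>h. h \<otimes>\<^bsub>G\<^esub> g) \<one>\<^bsub>G\<^esub>"

definition TR_dual :: "('g, 'e::real_normed_vector) lie_struct \<Rightarrow> 'g \<Rightarrow> 'e dual \<Rightarrow> 'e dual" where
  "TR_dual G g \<alpha> = Blinfun (\<lambda>\<eta>. \<langle>\<alpha>, TR G g \<eta>\<rangle>)"

definition Ad :: "('g, 'e::real_normed_vector) lie_struct \<Rightarrow> 'g \<Rightarrow> 'e \<Rightarrow> 'e" where
  "Ad G g = tangent_map (chart G) (chart G) (\<lambda>h. inv\<^bsub>G\<^esub> g \<otimes>\<^bsub>G\<^esub> h \<otimes>\<^bsub>G\<^esub> g) \<one>\<^bsub>G\<^esub>"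

definition lie_bracket :: "('g, 'e::real_normed_vector) lie_struct \<Rightarrow> 'e \<Rightarrow> 'e \<Rightarrow> 'e" where
  "lie_bracket G \<xi> \<eta> = tangent_map (chart G) vec_charts (\<lambda>g. Ad G g \<eta>) \<one>\<^bsub>G\<^esub> \<xi>"

definition coad :: "('g, 'e::real_normed_vector) lie_struct \<Rightarrow> 'e \<Rightarrow> 'e dual \<Rightarrow> 'e dual" where
  "coad G \<xi> \<mu> = Blinfun (\<lambda>\<eta>. \<langle>\<mu>, lie_bracket G \<xi> \<eta>\<rangle>)"


section \<open>The canonical symplectic form on the trivialized cotangent bundle of G\<close>

text \<open>
  \<open>form_of_frame X B\<close> is the two-form \<open>\<omega>\<close> determined by
  \<open>\<omega> p (X a p) (X b p) = B a b p\<close>, where \<open>a \<mapsto> X a p\<close> is a bijection onto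
  the tangent space at every \<open>p\<close>.
\<close>

definition form_of_frame ::
    "('a \<Rightarrow> 'm \<Rightarrow> 'e) \<Rightarrow> ('a \<Rightarrow> 'a \<Rightarrow> 'm \<Rightarrow> real) \<Rightarrow> ('m, 'e) two_form" where
  "form_of_frame X B p u v = B (THE a. X a p = u) (THE b. X b p = v) p"

definition cot_charts ::
    "('g, 'e::real_normed_vector) lie_struct \<Rightarrow> ('g \<times> 'e dual, 'e \<times> 'e dual) charts" where
  "cot_charts G = prod_charts (chart G) vec_charts"

definition cot_frame ::
    "('g, 'e::real_normed_vector) lie_struct \<Rightarrow> 'e \<times> 'e dual \<Rightarrow> 'g \<times> 'e dual \<Rightarrow> 'e \<times> 'e dual" where
  "cot_frame G = (\<lambda>(\<xi>, \<nu>) (g, \<mu>). (TR G g \<xi>, \<nu> + coad G \<xi> \<mu>))"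

definition cot_form ::
    "('g, 'e::real_normed_vector) lie_struct \<Rightarrow> ('g \<times> 'e dual, 'e \<times> 'e dual) two_form" where
  "cot_form G = form_of_frame (cot_frame G)
     (\<lambda>(\<xi>, \<nu>) (\<eta>, l) (g, \<mu>). \<langle>\<nu>, \<eta>\<rangle> - \<langle>l, \<xi>\<rangle> + \<langle>\<mu>, lie_bracket G \<xi> \<eta>\<rangle>)"


section \<open>The trivialized iterated cotangent bundle\<close>

type_synonym ('g, 'e) tt = "'g \<times> 'e dual \<times> 'e dual \<times> 'e"

definition tt_charts ::
    "('g, 'e::real_normed_vector) lie_struct \<Rightarrow>
     (('g, 'e) tt, 'e \<times> 'e dual \<times> 'e dual \<times> 'e) charts" where
  "tt_charts G = prod_charts (chart G) (prod_charts vec_charts (prod_charts vec_charts vec_charts))"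

definition tt_frame ::
    "('g, 'e::real_normed_vector) lie_struct \<Rightarrow> 'e \<times> 'e dual \<times> 'e dual \<times> 'e \<Rightarrow>
     ('g, 'e) tt \<Rightarrow> 'e \<times> 'e dual \<times> 'e dual \<times> 'e" where
  "tt_frame G = (\<lambda>(\<eta>, l1, l2, \<zeta>) (g, \<mu>, \<nu>, \<xi>).
     (TR G g \<eta>, l1 + coad G \<eta> \<mu>, l2 + coad G \<eta> \<nu> - coad G \<xi> l1, \<zeta> + lie_bracket G \<xi> \<eta>))"

definition tt_form ::
    "('g, 'e::real_normed_vector) lie_struct \<Rightarrow>
     (('g, 'e) tt, 'e \<times> 'e dual \<times> 'e dual \<times> 'e) two_form" where
  "tt_form G = form_of_frame (tt_frame G)
     (\<lambda>(\<eta>, l1, l2, \<zeta>) (\<eta>', l1', l2', \<zeta>') (g, \<mu>, \<nu>, \<xi>).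
        \<langle>l2, \<eta>'\<rangle> + \<langle>l1', \<zeta> - lie_bracket G \<eta> \<xi>\<rangle> - \<langle>l2', \<eta>\<rangle> + \<langle>l1, lie_bracket G \<eta>' \<xi> - \<zeta>'\<rangle>
        + \<langle>\<nu>, lie_bracket G \<eta> \<eta>'\<rangle>)"

definition tt_action ::
    "('g, 'e::real_normed_vector) lie_struct \<Rightarrow> 'e dual \<Rightarrow> ('g, 'e) tt \<Rightarrow> ('g, 'e) tt" where
  "tt_action G l = (\<lambda>(g, \<mu>, \<nu>, \<xi>). (g, l + \<mu>, \<nu> - coad G \<xi> l, \<xi>))"

definition tt_momentum :: "('g, 'e::real_normed_vector) tt \<Rightarrow> 'e" where
  "tt_momentum = (\<lambda>(g, \<mu>, \<nu>, \<xi>). \<xi>)"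


section \<open>The bracket on the Poisson reduced space\<close>

text \<open>
  Every orbit of \<open>tt_action\<close> contains exactly one point \<open>(g, 0, \<nu>, \<xi>)\<close>.  Under an isomorphism of the
  Poisson reduced space with the bracket below, \<open>\<xi>\<close> itself cannot be the last
  coordinate of the orbit unless the bracket of the Lie algebra vanishes: it is the momentum, hence Poisson commutes with all invariant
  functions.  The last coordinate is \<open>\<xi>\<close> transported by \<open>Ad\<close> of \<open>g\<^sup>-\<^sup>1\<close>.
\<close>

definition red_charts ::
    "('g, 'e::real_normed_vector) lie_struct \<Rightarrow>
     ('g \<times> 'e dual \<times> 'e, 'e \<times> 'e dual \<times> 'e) charts" where
  "red_charts G = prod_charts (chart G) (prod_charts vec_charts vec_charts)"

definition delta_g ::
    "('g, 'e::real_normed_vector) lie_struct \<Rightarrow> ('g \<times> 'e dual \<times> 'e \<Rightarrow> real) \<Rightarrow>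
     'g \<times> 'e dual \<times> 'e \<Rightarrow> 'e dual" where
  "delta_g G H = (\<lambda>(g, \<nu>, \<xi>). Blinfun (differential (chart G) (\<lambda>h. H (h, \<nu>, \<xi>)) g))"

text \<open>\<open>\<delta>H/\<delta>\<nu>\<close> lies in the bidual of the Lie algebra, identified with the Lie algebra.\<close>

definition delta_nu ::
    "('g \<times> 'e::real_normed_vector dual \<times> 'e \<Rightarrow> real) \<Rightarrow> 'g \<times> 'e dual \<times> 'e \<Rightarrow> 'e" where
  "delta_nu H = (\<lambda>(g, \<nu>, \<xi>).
     THE \<eta>. \<forall>l. frechet_derivative (\<lambda>\<nu>'. H (g, \<nu>', \<xi>)) (at \<nu>) l = \<langle>l, \<eta>\<rangle>)"

definition delta_xi ::
    "('g \<times> 'e::real_normed_vector dual \<times> 'e \<Rightarrow> real) \<Rightarrow> 'g \<times> 'e dual \<times> 'e \<Rightarrow> 'e dual" where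
  "delta_xi H = (\<lambda>(g, \<nu>, \<xi>). Blinfun (frechet_derivative (\<lambda>\<xi>'. H (g, \<nu>, \<xi>')) (at \<xi>)))"

definition red_bracket ::
    "('g, 'e::real_normed_vector) lie_struct \<Rightarrow> ('g \<times> 'e dual \<times> 'e \<Rightarrow> real) \<Rightarrow>
     ('g \<times> 'e dual \<times> 'e \<Rightarrow> real) \<Rightarrow> 'g \<times> 'e dual \<times> 'e \<Rightarrow> real" where
  "red_bracket G H K = (\<lambda>(g, \<nu>, \<xi>). let p = (g, \<nu>, \<xi>) in
       \<langle>TR_dual G g (delta_g G K p), delta_nu H p\<rangle>
     - \<langle>TR_dual G g (delta_g G H p), delta_nu K p\<rangle>
     + \<langle>delta_xi H p, lie_bracket G (delta_nu K p) \<xi>\<rangle>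
     - \<langle>delta_xi K p, lie_bracket G (delta_nu H p) \<xi>\<rangle>
     + \<langle>\<nu>, lie_bracket G (delta_nu H p) (delta_nu K p)\<rangle>)"

end

theory Submission
  imports Defs
begin

text \<open>
  Let \<open>\<rho>\<close> be the right Maurer--Cartan form.  Both forms are exact on every chart domain: they are the exterior
  derivatives of \<open>\<langle>\<mu>, \<rho>\<rangle>\<close> on the trivialized cotangent bundle and of \<open>\<langle>\<nu>, \<rho>\<rangle> + \<langle>\<mu>, [\<xi>, \<rho>] - d\<xi>\<rangle>\<close>
  on the iterated one.  This is read off from the Maurer--Cartan equation \<open>d\<rho> = - [\<rho>, \<rho>]\<close>, which follows from
  the second order Taylor expansion of the multiplication at the identity and, upon differentiation, yields
  the Jacobi identity.
  The orbits of the action are the fibres of \<open>(g, \<mu>, \<nu>, \<xi>) \<mapsto> (g, \<nu> + ad\<^sup>*\<^sub>\<xi> \<mu>, Ad (g\<^sup>-\<^sup>1) \<xi>)\<close>, and on a level set of the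
  momentum map of \<open>(g, \<mu>, \<nu>, \<xi>) \<mapsto> (g, \<nu> + ad\<^sup>*\<^sub>\<xi> \<mu>)\<close>; in terms of \<open>\<rho>\<close> both reductions become identities in the
  Lie algebra.
\<close>

section \<open>Calculus of smooth functions on finite-dimensional spaces\<close>

text \<open>The coordinate \<open>Ad G (ginv g) \<xi>\<close> answers to the shape of the bracket.
  The Hamiltonian field of an invariant function keeps the momentum \<xi> fixed, while the terms of
  \<open>red_bracket\<close> with \<open>delta_xi\<close> demand that the last coordinate move by a
  bracket with the velocity of g. The transported element does this: its derivative in a direction a
  is the bracket of \<open>Ad G (ginv g) \<xi>\<close> with \<rho> a.

  The frames that define the two forms are not made of coordinate fields. Both forms are therefore
  rewritten for tangent vectors given by \<rho> of the group component and the plain derivatives of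
  the other coordinates. Constant vectors of a chart can then be inserted into the primitive, and
  closedness becomes symmetry of second derivatives. For the iterated bundle this rewriting costs
  the Jacobi identity.

  A further obstacle is that \<open>C_on\<close> speaks of derivatives in fixed directions, whereas
  the chain rule and \<rho> produce directions that vary with the point. Expansion in coordinates
  bridges the gap, and \<open>finite_dim\<close> supplies coordinates uniformly for Euclidean
  spaces, their duals and products of these.\<close>

class finite_dim = real_normed_vector +
  assumes finite_dim_axiom: "\<exists>B c. finite B \<and>
    (\<forall>b\<in>B. (\<forall>x y. c b (x + y) = c b x + c b y) \<and> (\<forall>r x. c b (r *\<^sub>R x) = (r::real) * c b x) \<and>
      (\<exists>K. \<forall>x. \<bar>c b x\<bar> \<le> norm x * K)) \<and>
    (\<forall>x. x = (\<Sum>b\<in>B. c b x *\<^sub>R b))"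

lemma bounded_linear_real_iff:
  fixes f :: "'a::real_normed_vector \<Rightarrow> real"
  shows "bounded_linear f \<longleftrightarrow>
    (\<forall>x y. f (x + y) = f x + f y) \<and> (\<forall>r x. f (r *\<^sub>R x) = r * f x) \<and> (\<exists>K. \<forall>x. \<bar>f x\<bar> \<le> norm x * K)"
  by (simp add: bounded_linear_def bounded_linear_axioms_def linear_iff)

lemma finite_dim_coords:
  "\<exists>(B::'a::finite_dim set) c. finite B \<and> (\<forall>b\<in>B. bounded_linear (c b)) \<and> (\<forall>x. x = (\<Sum>b\<in>B. c b x *\<^sub>R b))"
  unfolding bounded_linear_real_iff by (rule finite_dim_axiom)

lemma finite_dim_intro:
  assumes "\<exists>(B::'a::real_normed_vector set) c. finite B \<and> (\<forall>b\<in>B. bounded_linear (c b)) \<and> (\<forall>x. x = (\<Sum>b\<in>B. c b x *\<^sub>R b))"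
  shows "OFCLASS('a, finite_dim_class)"
  using assms unfolding bounded_linear_real_iff by intro_classes

instance euclidean_space \<subseteq> finite_dim
  by (rule finite_dim_intro, rule exI[of _ Basis], rule exI[of _ "\<lambda>b x. x \<bullet> b"])
    (auto simp: bounded_linear_inner_left euclidean_representation)

instance prod :: (finite_dim, finite_dim) finite_dim
proof (rule finite_dim_intro)
  obtain B and c :: "'a \<Rightarrow> 'a \<Rightarrow> real" where B: "finite B" "\<And>b. b \<in> B \<Longrightarrow> bounded_linear (c b)"
    "\<And>x. x = (\<Sum>b\<in>B. c b x *\<^sub>R b)" using finite_dim_coords[where 'a='a] by metis
  obtain B' and c' :: "'b \<Rightarrow> 'b \<Rightarrow> real" where B': "finite B'" "\<And>b. b \<in> B' \<Longrightarrow> bounded_linear (c' b)"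
    "\<And>x. x = (\<Sum>b\<in>B'. c' b x *\<^sub>R b)" using finite_dim_coords[where 'a='b] by metis
  \<comment> \<open>Nothing excludes 0 from B or B', and it would then give (0, 0) in both families.
    Without it the two images are disjoint, and the test \<open>snd b = 0\<close> in d tells which
    family b comes from.\<close>
  define I where "I = ((\<lambda>b. (b, 0::'b)) ` (B - {0}) \<union> (\<lambda>b. (0::'a, b)) ` (B' - {0}))"
  define d where "d = (\<lambda>b x. if snd b = 0 then c (fst b) (fst x) else c' (snd b) (snd x) :: real)"
  have disj: "(\<lambda>b. (b, 0::'b)) ` (B - {0}) \<inter> (\<lambda>b. (0::'a, b)) ` (B' - {0}) = {}" by auto
  have "x = (\<Sum>b\<in>I. d b x *\<^sub>R b)" for x :: "'a \<times> 'b"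
  proof -
    have "(\<Sum>b\<in>I. d b x *\<^sub>R b) = (\<Sum>b\<in>B - {0}. (c b (fst x) *\<^sub>R b, 0)) + (\<Sum>b\<in>B' - {0}. (0, c' b (snd x) *\<^sub>R b))"
      unfolding I_def using B(1) B'(1) disj
      by (subst sum.union_disjoint) (auto simp: sum.reindex inj_on_def d_def intro!: arg_cong2[where f="(+)"] sum.cong)
    also have "\<dots> = (\<Sum>b\<in>B. (c b (fst x) *\<^sub>R b, 0)) + (\<Sum>b\<in>B'. (0, c' b (snd x) *\<^sub>R b))"
      using B(1) B'(1) by (intro arg_cong2[where f="(+)"] sum.mono_neutral_left) (auto simp: zero_prod_def)
    also have "\<dots> = (\<Sum>b\<in>B. c b (fst x) *\<^sub>R b, \<Sum>b\<in>B'. c' b (snd x) *\<^sub>R b)"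
      by (simp add: sum_prod)
    also have "\<dots> = x" using B(3)[of "fst x"] B'(3)[of "snd x"] by (metis prod.collapse)
    finally show ?thesis by simp
  qed
  moreover have "bounded_linear (d b)" if "b \<in> I" for b
  proof (cases "snd b = 0")
    case True
    then have "fst b \<in> B" using that by (auto simp: I_def)
    then show ?thesis using True B(2) bounded_linear_compose[OF _ bounded_linear_fst] by (auto simp: d_def)
  next
    case False
    then have "snd b \<in> B'" using that by (auto simp: I_def)
    then show ?thesis using False B'(2) bounded_linear_compose[OF _ bounded_linear_snd] by (auto simp: d_def)
  qed
  moreover have "finite I" using B(1) B'(1) by (auto simp: I_def)
  ultimately show "\<exists>B c. finite B \<and> (\<forall>b\<in>B. bounded_linear (c b)) \<and> (\<forall>x::'a \<times> 'b. x = (\<Sum>b\<in>B. c b x *\<^sub>R b))"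
    by blast
qed

lemma bounded_linear_eq_sum_Basis:
  fixes F :: "'a::euclidean_space \<Rightarrow>\<^sub>L 'b::euclidean_space"
  shows "F = (\<Sum>(b, c)\<in>Basis \<times> Basis. (blinfun_apply F b \<bullet> c) *\<^sub>R Blinfun (\<lambda>x. (x \<bullet> b) *\<^sub>R c))"
proof (rule blinfun_euclidean_eqI)
  fix i :: 'a assume i: "i \<in> Basis"
  have bl: "bounded_linear (\<lambda>x. (x \<bullet> b) *\<^sub>R c)" for b :: 'a and c :: 'b
    by (intro bounded_linear_intros)
  have "blinfun_apply (\<Sum>(b, c)\<in>Basis \<times> Basis. (blinfun_apply F b \<bullet> c) *\<^sub>R Blinfun (\<lambda>x. (x \<bullet> b) *\<^sub>R c)) i
    = (\<Sum>b\<in>Basis. \<Sum>c\<in>Basis. (blinfun_apply F b \<bullet> c) *\<^sub>R (i \<bullet> b) *\<^sub>R c)"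
    by (simp add: blinfun.sum_left sum.cartesian_product case_prod_unfold blinfun.scaleR_left bounded_linear_Blinfun_apply[OF bl])
  also have "\<dots> = (\<Sum>b\<in>Basis. (i \<bullet> b) *\<^sub>R blinfun_apply F b)"
  proof (rule sum.cong[OF refl])
    fix b :: 'a
    have "(\<Sum>c\<in>Basis. (blinfun_apply F b \<bullet> c) *\<^sub>R (i \<bullet> b) *\<^sub>R c)
      = (i \<bullet> b) *\<^sub>R (\<Sum>c\<in>Basis. (blinfun_apply F b \<bullet> c) *\<^sub>R c)"
      by (simp add: scaleR_sum_right mult.commute)
    then show "(\<Sum>c\<in>Basis. (blinfun_apply F b \<bullet> c) *\<^sub>R (i \<bullet> b) *\<^sub>R c) = (i \<bullet> b) *\<^sub>R blinfun_apply F b"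
      by (simp add: euclidean_representation)
  qed
  also have "\<dots> = (\<Sum>b\<in>Basis. if b = i then blinfun_apply F b else 0)"
    using i by (intro sum.cong) (auto simp: inner_Basis)
  also have "\<dots> = blinfun_apply F i" using i by simp
  finally show "blinfun_apply F i = blinfun_apply (\<Sum>(b, c)\<in>Basis \<times> Basis. (blinfun_apply F b \<bullet> c) *\<^sub>R Blinfun (\<lambda>x. (x \<bullet> b) *\<^sub>R c)) i" ..
qed

text \<open>Covers the dual spaces in which \<mu> and \<nu> live. The basis consists of the rank one
  operators built from \<open>Basis\<close>, and the coordinate functionals are matrix
  entries.\<close>

instance blinfun :: (euclidean_space, euclidean_space) finite_dim
proof (rule finite_dim_intro)
  define e where "e = (\<lambda>(b::'a, c::'b). Blinfun (\<lambda>x. (x \<bullet> b) *\<^sub>R c))"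
  have bl: "bounded_linear (\<lambda>x. (x \<bullet> b) *\<^sub>R c)" for b :: 'a and c :: 'b
    by (intro bounded_linear_intros)
  \<comment> \<open>The class indexes the coordinates by the basis vectors themselves, so different
    pairs (b, c) must give different operators.\<close>
  have inj: "inj_on e (Basis \<times> Basis)"
  proof (rule inj_onI, clarify)
    fix b b' :: 'a and c c' :: 'b
    assume *: "b \<in> Basis" "b' \<in> Basis" "c \<in> Basis" "c' \<in> Basis" "e (b, c) = e (b', c')"
    have "blinfun_apply (e (b, c)) b = c" "blinfun_apply (e (b', c')) b = (b \<bullet> b') *\<^sub>R c'"
      using *(1) by (simp_all add: e_def bounded_linear_Blinfun_apply[OF bl])
    with *(5) have "c = (b \<bullet> b') *\<^sub>R c'" by simp
    with *(1-4) show "b = b' \<and> c = c'" by (cases "b = b'") (auto simp: inner_Basis)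
  qed
  define d where "d = (\<lambda>E (F::'a \<Rightarrow>\<^sub>L 'b). let p = the_inv_into (Basis \<times> Basis) e E in blinfun_apply F (fst p) \<bullet> snd p)"
  have "F = (\<Sum>E\<in>e ` (Basis \<times> Basis). d E F *\<^sub>R E)" for F
  proof -
    have "(\<Sum>E\<in>e ` (Basis \<times> Basis). d E F *\<^sub>R E)
      = (\<Sum>p\<in>Basis \<times> Basis. (blinfun_apply F (fst p) \<bullet> snd p) *\<^sub>R e p)"
      by (subst sum.reindex[OF inj]) (auto simp: d_def the_inv_into_f_f[OF inj] intro!: sum.cong)
    then show ?thesis using bounded_linear_eq_sum_Basis[of F] by (simp only: e_def case_prod_unfold)
  qed
  moreover have "bounded_linear (d E)" for E
    unfolding d_def Let_def
    by (rule bounded_linear_compose[OF bounded_linear_inner_left blinfun.bounded_linear_left])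
  ultimately show "\<exists>B c. finite B \<and> (\<forall>b\<in>B. bounded_linear (c b)) \<and> (\<forall>x::'a \<Rightarrow>\<^sub>L 'b. x = (\<Sum>b\<in>B. c b x *\<^sub>R b))"
    by (intro exI[of _ "e ` (Basis \<times> Basis)"] exI[of _ d]) auto
qed

section \<open>Closure properties of functions of class C^n and of smooth functions\<close>

lemma frechet_derivative_eqI: "(f has_derivative f') (at x) \<Longrightarrow> frechet_derivative f (at x) = f'"
  by (rule frechet_derivative_at[symmetric])

text \<open>Openness matters because a derivative \<open>at x\<close> sees a whole neighbourhood of
  x; agreement on S controls it only at interior points.\<close>

lemma C_on_cong:
  assumes "open S" "\<And>x. x \<in> S \<Longrightarrow> f x = g x" "C_on n S f"
  shows "C_on n S g"
  using assms(2,3)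
proof (induction n arbitrary: f g)
  case 0
  then show ?case using continuous_on_cong[of S S f g] by simp
next
  case (Suc n)
  have D: "(g has_derivative frechet_derivative f (at x)) (at x)" if "x \<in> S" for x
  proof (rule has_derivative_transform_within_open[OF _ assms(1) that Suc.prems(1)])
    show "(f has_derivative frechet_derivative f (at x)) (at x)"
      using Suc.prems(2) that by (simp add: frechet_derivative_works[symmetric])
  qed
  have "C_on n S (\<lambda>x. frechet_derivative g (at x) v)" for v
  proof (rule Suc.IH)
    show "C_on n S (\<lambda>x. frechet_derivative f (at x) v)" using Suc.prems(2) by simp
    show "frechet_derivative f (at x) v = frechet_derivative g (at x) v" if "x \<in> S" for x
      unfolding frechet_derivative_eqI[OF D[OF that]] ..
  qed
  then show ?case using D by (auto simp: differentiable_def)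
qed

lemma C_on_imp_continuous_on: "C_on n S f \<Longrightarrow> continuous_on S f"
  by (cases n) (auto intro!: continuous_at_imp_continuous_on differentiable_imp_continuous_within)

lemma C_on_SucD: "C_on (Suc n) S f \<Longrightarrow> C_on n S f"
proof (induction n arbitrary: f)
  case 0
  then show ?case using C_on_imp_continuous_on[of "Suc 0"] by simp
next
  case (Suc n)
  then show ?case by (metis C_on.simps(2))
qed

text \<open>The derivatives are taken \<open>at x\<close> in the whole space and not within S, so
  they do not change when S shrinks.\<close>

lemma C_on_subset: "C_on n S f \<Longrightarrow> T \<subseteq> S \<Longrightarrow> C_on n T f"
  by (induction n arbitrary: f) (auto intro: continuous_on_subset)

text \<open>Working form of the recursion: the derivative may be given by any formula, and
  uniqueness identifies it with \<open>frechet_derivative\<close>.\<close>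

lemma C_on_SucI:
  assumes "open S" "\<And>x. x \<in> S \<Longrightarrow> (f has_derivative f' x) (at x)" "\<And>v. C_on n S (\<lambda>x. f' x v)"
  shows "C_on (Suc n) S f"
proof -
  have "frechet_derivative f (at x) = f' x" if "x \<in> S" for x
    using frechet_derivative_at[OF assms(2)[OF that]] by simp
  then show ?thesis
    using assms by (auto simp: differentiable_def intro: C_on_cong[OF assms(1) _ assms(3)])
qed

lemma C_on_const: "open S \<Longrightarrow> C_on n S (\<lambda>x. c)"
  by (induction n arbitrary: c) auto

lemma C_on_bounded_linear: "open S \<Longrightarrow> bounded_linear f \<Longrightarrow> C_on n S f"
  by (cases n) (auto simp del: C_on.simps(2) intro!: C_on_SucI[where f'="\<lambda>_. f"] C_on_const linear_continuous_on
    bounded_linear_imp_has_derivative)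

lemma C_on_bounded_linear_compose:
  assumes "open S" "bounded_linear h" "C_on n S f"
  shows "C_on n S (\<lambda>x. h (f x))"
  using assms(3)
proof (induction n arbitrary: f)
  case 0
  then show ?case using bounded_linear.continuous_on[OF assms(2)] by simp
next
  case (Suc n)
  show ?case
    by (rule C_on_SucI[where f'="\<lambda>x v. h (frechet_derivative f (at x) v)", OF assms(1)])
      (use Suc in \<open>auto intro!: bounded_linear.has_derivative[OF assms(2)] simp: frechet_derivative_works[symmetric]\<close>)
qed

lemma C_on_add:
  assumes "open S" "C_on n S f" "C_on n S g"
  shows "C_on n S (\<lambda>x. f x + g x)"
  using assms(2,3)
proof (induction n arbitrary: f g)
  case 0
  then show ?case by (auto intro: continuous_on_add)
next
  case (Suc n)
  show ?case
    by (rule C_on_SucI[where f'="\<lambda>x v. frechet_derivative f (at x) v + frechet_derivative g (at x) v", OF assms(1)])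
      (use Suc in \<open>auto intro!: has_derivative_add simp: frechet_derivative_works[symmetric]\<close>)
qed

lemma C_on_sum:
  assumes "open S" "\<And>i. i \<in> I \<Longrightarrow> C_on n S (f i)"
  shows "C_on n S (\<lambda>x. \<Sum>i\<in>I. f i x)"
proof (cases "finite I")
  case True
  then show ?thesis using assms(2)
    by (induction I) (auto intro!: C_on_const C_on_add assms(1))
qed (simp add: C_on_const assms(1))

lemma C_on_Pair:
  assumes "open S" "C_on n S f" "C_on n S g"
  shows "C_on n S (\<lambda>x. (f x, g x))"
  using assms(2,3)
proof (induction n arbitrary: f g)
  case 0
  then show ?case by (auto intro: continuous_on_Pair)
next
  case (Suc n)
  show ?case
    by (rule C_on_SucI[where f'="\<lambda>x v. (frechet_derivative f (at x) v, frechet_derivative g (at x) v)", OF assms(1)])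
      (use Suc in \<open>auto intro!: has_derivative_Pair simp: frechet_derivative_works[symmetric]\<close>)
qed

lemma C_on_bounded_bilinear:
  assumes "bounded_bilinear h" "open S" "C_on n S f" "C_on n S g"
  shows "C_on n S (\<lambda>x. h (f x) (g x))"
  using assms(3,4)
proof (induction n arbitrary: f g)
  case 0
  then show ?case using bounded_bilinear.continuous_on[OF assms(1)] by simp
next
  case (Suc n)
  have "C_on n S f" "C_on n S g" using Suc.prems C_on_SucD by blast+
  then show ?case
    by (intro C_on_SucI[where f'="\<lambda>x v. h (f x) (frechet_derivative g (at x) v) + h (frechet_derivative f (at x) v) (g x)", OF assms(2)])
      (use Suc in \<open>auto intro!: bounded_bilinear.FDERIV[OF assms(1)] C_on_add assms(2) simp: frechet_derivative_works[symmetric]\<close>)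
qed

lemma linear_coords:
  assumes "finite B" "\<And>x. x = (\<Sum>b\<in>B. c b x *\<^sub>R b)" "linear D"
  shows "D x = (\<Sum>b\<in>B. c b x *\<^sub>R D b)"
  by (subst assms(2)) (simp add: linear_sum[OF assms(3)] linear_scale[OF assms(3)])

text \<open>In the chain rule the derivative of g is applied to the direction Df(x) v, which varies
  with x, while the induction hypothesis concerns fixed directions only. Expanding this direction in
  coordinates gives a finite sum of products of fixed-direction derivatives, which is why the middle
  space is finite-dimensional.\<close>

lemma C_on_compose:
  fixes g :: "'b::finite_dim \<Rightarrow> 'c::real_normed_vector"
  assumes "open S" "open T" "f ` S \<subseteq> T" "C_on n S f" "C_on n T g"
  shows "C_on n S (\<lambda>x. g (f x))"
  using assms(4,5)
proof (induction n arbitrary: g)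
  case 0
  then show ?case using continuous_on_compose2 assms(3) by auto
next
  case (Suc n)
  obtain B and c :: "'b \<Rightarrow> 'b \<Rightarrow> real" where B: "finite B" "\<And>b. b \<in> B \<Longrightarrow> bounded_linear (c b)"
    "\<And>x. x = (\<Sum>b\<in>B. c b x *\<^sub>R b)" using finite_dim_coords[where 'a='b] by metis
  let ?f' = "\<lambda>x v. \<Sum>b\<in>B. c b (frechet_derivative f (at x) v) *\<^sub>R frechet_derivative g (at (f x)) b"
  show ?case
  proof (rule C_on_SucI[where f'="?f'", OF assms(1)])
    fix x assume x: "x \<in> S"
    have g: "(g has_derivative frechet_derivative g (at (f x))) (at (f x))"
      using Suc.prems x assms(3) by (auto simp: frechet_derivative_works[symmetric])
    have "(f has_derivative frechet_derivative f (at x)) (at x)"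
      using Suc.prems x by (auto simp: frechet_derivative_works[symmetric])
    from has_derivative_compose[OF this g]
    show "((\<lambda>x. g (f x)) has_derivative ?f' x) (at x)"
      unfolding linear_coords[OF B(1,3) has_derivative_linear[OF g], symmetric] .
  next
    fix v
    have "C_on n S f" using Suc.prems(1) C_on_SucD by blast
    then have "C_on n S (\<lambda>x. frechet_derivative g (at (f x)) b)" for b
      using Suc.IH[of "\<lambda>y. frechet_derivative g (at y) b"] Suc.prems(2) by simp
    moreover have "C_on n S (\<lambda>x. frechet_derivative f (at x) v)" using Suc.prems(1) by simp
    ultimately show "C_on n S (\<lambda>x. ?f' x v)"
      by (intro C_on_sum C_on_bounded_bilinear[OF bounded_bilinear_scaleR] C_on_bounded_linear_compose[where h="c _"] assms(1) B(2))
  qed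
qed

lemma smooth_on_cong:
  "open S \<Longrightarrow> (\<And>x. x \<in> S \<Longrightarrow> f x = g x) \<Longrightarrow> smooth_on S f \<Longrightarrow> smooth_on S g"
  unfolding smooth_on_def using C_on_cong by blast

lemma smooth_on_subset: "smooth_on S f \<Longrightarrow> T \<subseteq> S \<Longrightarrow> smooth_on T f"
  unfolding smooth_on_def using C_on_subset by blast

lemma smooth_on_imp_continuous_on: "smooth_on S f \<Longrightarrow> continuous_on S f"
  unfolding smooth_on_def using C_on_imp_continuous_on by blast

lemma smooth_on_imp_differentiable: "smooth_on S f \<Longrightarrow> x \<in> S \<Longrightarrow> f differentiable (at x)"
  unfolding smooth_on_def by (metis C_on.simps(2))

lemma smooth_on_has_derivative:
  "smooth_on S f \<Longrightarrow> x \<in> S \<Longrightarrow> (f has_derivative frechet_derivative f (at x)) (at x)"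
  using smooth_on_imp_differentiable frechet_derivative_works by blast

lemma smooth_on_frechet_derivative: "smooth_on S f \<Longrightarrow> smooth_on S (\<lambda>x. frechet_derivative f (at x) v)"
  unfolding smooth_on_def by (metis C_on.simps(2))

lemma smooth_on_local:
  assumes "\<And>x. x \<in> S \<Longrightarrow> \<exists>U. x \<in> U \<and> open U \<and> smooth_on U f"
  shows "smooth_on S f"
  unfolding smooth_on_def
proof
  fix n
  have *: "\<forall>x\<in>S. \<exists>U. x \<in> U \<and> open U \<and> C_on n U f"
    using assms by (auto simp: smooth_on_def)
  then show "C_on n S f"
  proof (induction n arbitrary: f)
    case 0
    then show ?case
      unfolding C_on.simps by (metis continuous_at_imp_continuous_on continuous_on_eq_continuous_at)
  next
    case (Suc n)
    have "\<forall>x\<in>S. \<exists>U. x \<in> U \<and> open U \<and> C_on n U (\<lambda>x. frechet_derivative f (at x) v)" for v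
      using Suc.prems by fastforce
    then have "C_on n S (\<lambda>x. frechet_derivative f (at x) v)" for v by (rule Suc.IH)
    then show ?case using Suc.prems by auto
  qed
qed

lemma smooth_on_const: "open S \<Longrightarrow> smooth_on S (\<lambda>x. c)"
  by (simp add: smooth_on_def C_on_const)

lemma smooth_on_bounded_linear: "open S \<Longrightarrow> bounded_linear f \<Longrightarrow> smooth_on S f"
  by (simp add: smooth_on_def C_on_bounded_linear)

lemma smooth_on_bounded_linear_compose:
  "bounded_linear h \<Longrightarrow> open S \<Longrightarrow> smooth_on S f \<Longrightarrow> smooth_on S (\<lambda>x. h (f x))"
  by (simp add: smooth_on_def C_on_bounded_linear_compose)

lemma smooth_on_add: "open S \<Longrightarrow> smooth_on S f \<Longrightarrow> smooth_on S g \<Longrightarrow> smooth_on S (\<lambda>x. f x + g x)"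
  by (simp add: smooth_on_def C_on_add)

lemma smooth_on_minus: "open S \<Longrightarrow> smooth_on S f \<Longrightarrow> smooth_on S (\<lambda>x. - f x)"
  by (rule smooth_on_bounded_linear_compose[OF bounded_linear_minus[OF bounded_linear_ident]])

lemma smooth_on_diff: "open S \<Longrightarrow> smooth_on S f \<Longrightarrow> smooth_on S g \<Longrightarrow> smooth_on S (\<lambda>x. f x - g x)"
  using smooth_on_add[of S f "\<lambda>x. - g x"] smooth_on_minus[of S g] by simp

lemma smooth_on_sum:
  "open S \<Longrightarrow> (\<And>i. i \<in> I \<Longrightarrow> smooth_on S (f i)) \<Longrightarrow> smooth_on S (\<lambda>x. \<Sum>i\<in>I. f i x)"
  by (simp add: smooth_on_def C_on_sum)

lemma smooth_on_Pair: "open S \<Longrightarrow> smooth_on S f \<Longrightarrow> smooth_on S g \<Longrightarrow> smooth_on S (\<lambda>x. (f x, g x))"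
  by (simp add: smooth_on_def C_on_Pair)

lemma smooth_on_bounded_bilinear:
  "bounded_bilinear h \<Longrightarrow> open S \<Longrightarrow> smooth_on S f \<Longrightarrow> smooth_on S g \<Longrightarrow> smooth_on S (\<lambda>x. h (f x) (g x))"
  by (simp add: smooth_on_def C_on_bounded_bilinear)

lemma smooth_on_compose:
  fixes g :: "'b::finite_dim \<Rightarrow> 'c::real_normed_vector"
  shows "smooth_on T g \<Longrightarrow> open T \<Longrightarrow> smooth_on S f \<Longrightarrow> open S \<Longrightarrow> f ` S \<subseteq> T \<Longrightarrow> smooth_on S (\<lambda>x. g (f x))"
  unfolding smooth_on_def using C_on_compose by blast

text \<open>Again the moving direction w x is expanded in coordinates. This is the tool for the
  smoothness of \<open>rho\<close> and \<open>Ad\<close>, both of which are partial derivatives of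
  group operations.\<close>

lemma smooth_on_derivative_along:
  fixes g :: "'b::finite_dim \<Rightarrow> 'c::real_normed_vector"
  assumes "smooth_on T g" "open T" "smooth_on S f" "open S" "f ` S \<subseteq> T" "smooth_on S w"
  shows "smooth_on S (\<lambda>x. frechet_derivative g (at (f x)) (w x))"
proof -
  obtain B and c :: "'b \<Rightarrow> 'b \<Rightarrow> real" where B: "finite B" "\<And>b. b \<in> B \<Longrightarrow> bounded_linear (c b)"
    "\<And>x. x = (\<Sum>b\<in>B. c b x *\<^sub>R b)" using finite_dim_coords[where 'a='b] by metis
  have "smooth_on S (\<lambda>x. \<Sum>b\<in>B. c b (w x) *\<^sub>R frechet_derivative g (at (f x)) b)"
    by (intro smooth_on_sum smooth_on_bounded_bilinear[OF bounded_bilinear_scaleR]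
        smooth_on_bounded_linear_compose[where h="c _"]
        smooth_on_compose[OF smooth_on_frechet_derivative[OF assms(1)]] B(2) assms(2-6))
  then show ?thesis
  proof (rule smooth_on_cong[OF assms(4), rotated])
    fix x assume "x \<in> S"
    then have "g differentiable (at (f x))" using smooth_on_imp_differentiable[OF assms(1)] assms(5) by auto
    then show "(\<Sum>b\<in>B. c b (w x) *\<^sub>R frechet_derivative g (at (f x)) b) = frechet_derivative g (at (f x)) (w x)"
      by (rule linear_coords[OF B(1,3) linear_frechet_derivative, symmetric])
  qed
qed

lemma has_derivative_derivative_along:
  fixes g :: "'b::finite_dim \<Rightarrow> 'c::real_normed_vector"
  assumes "smooth_on T g" "open T" "(f has_derivative f') (at x)" "f x \<in> T" "(w has_derivative w') (at x)"
  shows "((\<lambda>x. frechet_derivative g (at (f x)) (w x)) has_derivative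
    (\<lambda>v. frechet_derivative (\<lambda>y. frechet_derivative g (at y) (w x)) (at (f x)) (f' v)
       + frechet_derivative g (at (f x)) (w' v))) (at x)"
proof -
  obtain B and c :: "'b \<Rightarrow> 'b \<Rightarrow> real" where B: "finite B" "\<And>b. b \<in> B \<Longrightarrow> bounded_linear (c b)"
    "\<And>x. x = (\<Sum>b\<in>B. c b x *\<^sub>R b)" using finite_dim_coords[where 'a='b] by metis
  let ?D = "\<lambda>y. frechet_derivative g (at y)"
  have lin: "?D y v = (\<Sum>b\<in>B. c b v *\<^sub>R ?D y b)" if "y \<in> T" for y v
    by (rule linear_coords[OF B(1,3) linear_frechet_derivative[OF smooth_on_imp_differentiable[OF assms(1) that]]])
  have D: "((\<lambda>y. ?D y b) has_derivative frechet_derivative (\<lambda>y. ?D y b) (at (f x))) (at (f x))" for b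
    by (rule smooth_on_has_derivative[OF smooth_on_frechet_derivative[OF assms(1)] assms(4)])
  \<comment> \<open>Linearity of the second derivative in its inner direction u; it allows the
    coordinate sum to be reassembled at u = w x.\<close>
  have D2: "frechet_derivative (\<lambda>y. ?D y u) (at (f x)) v = (\<Sum>b\<in>B. c b u *\<^sub>R frechet_derivative (\<lambda>y. ?D y b) (at (f x)) v)" for u v
  proof -
    have "((\<lambda>y. \<Sum>b\<in>B. c b u *\<^sub>R ?D y b) has_derivative
      (\<lambda>v. \<Sum>b\<in>B. c b u *\<^sub>R frechet_derivative (\<lambda>y. ?D y b) (at (f x)) v)) (at (f x))"
      by (intro has_derivative_sum has_derivative_scaleR_right D)
    then have "((\<lambda>y. ?D y u) has_derivative
      (\<lambda>v. \<Sum>b\<in>B. c b u *\<^sub>R frechet_derivative (\<lambda>y. ?D y b) (at (f x)) v)) (at (f x))"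
      by (rule has_derivative_transform_within_open[OF _ assms(2,4)]) (rule lin[symmetric])
    then show ?thesis by (rule fun_cong[OF frechet_derivative_eqI])
  qed
  obtain U where U: "open U" "x \<in> U" "\<And>y. y \<in> U \<Longrightarrow> f y \<in> T"
    using has_derivative_continuous[OF assms(3)] assms(2,4) by (metis continuous_at_open)
  have "((\<lambda>x. \<Sum>b\<in>B. c b (w x) *\<^sub>R ?D (f x) b) has_derivative
    (\<lambda>v. \<Sum>b\<in>B. c b (w x) *\<^sub>R frechet_derivative (\<lambda>y. ?D y b) (at (f x)) (f' v) + c b (w' v) *\<^sub>R ?D (f x) b)) (at x)"
    using B(2) by (intro has_derivative_sum has_derivative_scaleR has_derivative_compose[OF assms(3) D]
      bounded_linear.has_derivative[OF B(2)] assms(5))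
  then have "((\<lambda>x. \<Sum>b\<in>B. c b (w x) *\<^sub>R ?D (f x) b) has_derivative
    (\<lambda>v. frechet_derivative (\<lambda>y. ?D y (w x)) (at (f x)) (f' v) + ?D (f x) (w' v))) (at x)"
    by (simp only: sum.distrib D2[symmetric] lin[OF assms(4), symmetric])
  then show ?thesis
    by (rule has_derivative_transform_within_open[OF _ U(1,2)]) (rule lin[OF U(3), symmetric])
qed

section \<open>Symmetry of second derivatives\<close>

lemma second_difference_mean_value:
  fixes f :: "'a::real_normed_vector \<Rightarrow> real"
  assumes "C_on (Suc (Suc n)) S f" "0 < t"
    and S: "\<And>s r. 0 \<le> s \<Longrightarrow> s \<le> t \<Longrightarrow> 0 \<le> r \<Longrightarrow> r \<le> t \<Longrightarrow> x + s *\<^sub>R u + r *\<^sub>R v \<in> S"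
  shows "\<exists>s r. 0 < s \<and> s < t \<and> 0 < r \<and> r < t \<and>
    f (x + t *\<^sub>R u + t *\<^sub>R v) - f (x + t *\<^sub>R u) - f (x + t *\<^sub>R v) + f x
      = t * t * frechet_derivative (\<lambda>y. frechet_derivative f (at y) u) (at (x + s *\<^sub>R u + r *\<^sub>R v)) v"
proof -
  let ?D = "\<lambda>y. frechet_derivative f (at y)"
  have lin: "D (h *\<^sub>R w) = h * D w" if "(k has_derivative D) F" for D :: "'a \<Rightarrow> real" and h w k F
    using linear_scale[OF has_derivative_linear[OF that]] by simp
  have d1: "((\<lambda>s. f (x + s *\<^sub>R u + r *\<^sub>R v)) has_real_derivative ?D (x + s *\<^sub>R u + r *\<^sub>R v) u) (at s)"
    if "0 \<le> s" "s \<le> t" "0 \<le> r" "r \<le> t" for s r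
  proof -
    have f: "(f has_derivative ?D (x + s *\<^sub>R u + r *\<^sub>R v)) (at (x + s *\<^sub>R u + r *\<^sub>R v))"
      using assms(1) S[OF that] by (simp add: frechet_derivative_works[symmetric])
    have "((\<lambda>s. f (x + s *\<^sub>R u + r *\<^sub>R v)) has_derivative (\<lambda>h. ?D (x + s *\<^sub>R u + r *\<^sub>R v) (h *\<^sub>R u))) (at s)"
      by (rule has_derivative_compose[where f="\<lambda>s. x + s *\<^sub>R u + r *\<^sub>R v" and g=f, OF _ f])
        (auto intro!: derivative_eq_intros)
    then show ?thesis by (simp add: has_field_derivative_def lin[OF f] mult.commute[of _ "?D _ _"])
  qed
  have d2: "((\<lambda>r. ?D (x + s *\<^sub>R u + r *\<^sub>R v) u) has_real_derivative
      frechet_derivative (\<lambda>y. ?D y u) (at (x + s *\<^sub>R u + r *\<^sub>R v)) v) (at r)"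
    if "0 \<le> s" "s \<le> t" "0 \<le> r" "r \<le> t" for s r
  proof -
    have f: "((\<lambda>y. ?D y u) has_derivative frechet_derivative (\<lambda>y. ?D y u) (at (x + s *\<^sub>R u + r *\<^sub>R v))) (at (x + s *\<^sub>R u + r *\<^sub>R v))"
      using assms(1) S[OF that] by (simp add: frechet_derivative_works[symmetric])
    have "((\<lambda>r. ?D (x + s *\<^sub>R u + r *\<^sub>R v) u) has_derivative
        (\<lambda>h. frechet_derivative (\<lambda>y. ?D y u) (at (x + s *\<^sub>R u + r *\<^sub>R v)) (h *\<^sub>R v))) (at r)"
      by (rule has_derivative_compose[where f="\<lambda>r. x + s *\<^sub>R u + r *\<^sub>R v" and g="\<lambda>y. ?D y u", OF _ f])
        (auto intro!: derivative_eq_intros)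
    then show ?thesis by (simp add: has_field_derivative_def lin[OF f] mult.commute[of _ "frechet_derivative _ _ _"])
  qed
  have d1': "((\<lambda>s. f (x + s *\<^sub>R u + t *\<^sub>R v) - f (x + s *\<^sub>R u + 0 *\<^sub>R v)) has_real_derivative
      ?D (x + s *\<^sub>R u + t *\<^sub>R v) u - ?D (x + s *\<^sub>R u + 0 *\<^sub>R v) u) (at s)" if "0 \<le> s" "s \<le> t" for s
    by (intro DERIV_diff d1 that) (use assms(2) in auto)
  \<comment> \<open>The mean value theorem is used twice: in s it turns the second difference into
    an increment of the derivative along u, and in r it is applied to that increment.\<close>
  obtain s where s: "0 < s" "s < t" "(f (x + t *\<^sub>R u + t *\<^sub>R v) - f (x + t *\<^sub>R u + 0 *\<^sub>R v)) - (f (x + 0 *\<^sub>R u + t *\<^sub>R v) - f (x + 0 *\<^sub>R u + 0 *\<^sub>R v))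
      = (t - 0) * (?D (x + s *\<^sub>R u + t *\<^sub>R v) u - ?D (x + s *\<^sub>R u + 0 *\<^sub>R v) u)"
    using MVT2[OF assms(2), where f="\<lambda>s. f (x + s *\<^sub>R u + t *\<^sub>R v) - f (x + s *\<^sub>R u + 0 *\<^sub>R v)"
      and f'="\<lambda>s. ?D (x + s *\<^sub>R u + t *\<^sub>R v) u - ?D (x + s *\<^sub>R u + 0 *\<^sub>R v) u", OF d1'] by blast
  obtain r where r: "0 < r" "r < t" "?D (x + s *\<^sub>R u + t *\<^sub>R v) u - ?D (x + s *\<^sub>R u + 0 *\<^sub>R v) u
      = (t - 0) * frechet_derivative (\<lambda>y. ?D y u) (at (x + s *\<^sub>R u + r *\<^sub>R v)) v"
    using MVT2[OF assms(2), where f="\<lambda>r. ?D (x + s *\<^sub>R u + r *\<^sub>R v) u"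
      and f'="\<lambda>r. frechet_derivative (\<lambda>y. ?D y u) (at (x + s *\<^sub>R u + r *\<^sub>R v)) v"] d2 s(1,2) by auto
  show ?thesis using s r by (intro exI[of _ s] exI[of _ r]) (auto simp: algebra_simps)
qed

text \<open>The second difference does not change when u and v are exchanged. Its two mean value
  forms thus give equal values of the two mixed derivatives at points of an arbitrarily small
  parallelogram, and continuity carries the equality to x.\<close>

lemma second_derivative_symmetric_real:
  fixes f :: "'a::real_normed_vector \<Rightarrow> real"
  assumes "smooth_on S f" "open S" "x \<in> S"
  shows "frechet_derivative (\<lambda>y. frechet_derivative f (at y) u) (at x) v
    = frechet_derivative (\<lambda>y. frechet_derivative f (at y) v) (at x) u" (is "?A u v x = ?A v u x")
proof (rule ccontr)
  assume ne: "?A u v x \<noteq> ?A v u x"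
  \<comment> \<open>Half the gap: two errors below e cannot bridge it.\<close>
  define e where "e = \<bar>?A u v x - ?A v u x\<bar> / 2"
  have e: "e > 0" using ne by (simp add: e_def)
  have "isCont (\<lambda>y. ?A u v y) x" "isCont (\<lambda>y. ?A v u y) x"
    using smooth_on_imp_continuous_on[OF smooth_on_frechet_derivative[OF smooth_on_frechet_derivative[OF assms(1)]]] assms(2,3)
    by (auto simp: continuous_on_eq_continuous_at)
  then obtain d1 d2 where d: "d1 > 0" "\<And>y. dist y x < d1 \<Longrightarrow> \<bar>?A u v y - ?A u v x\<bar> < e"
    "d2 > 0" "\<And>y. dist y x < d2 \<Longrightarrow> \<bar>?A v u y - ?A v u x\<bar> < e"
    unfolding continuous_at_eps_delta dist_real_def using e by metis
  obtain d3 where d3: "d3 > 0" "ball x d3 \<subseteq> S" using assms(2,3) openE by blast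
  define \<delta> where "\<delta> = min d1 (min d2 d3)"
  \<comment> \<open>The summand 1 keeps N positive when u and v are both 0. With t = \<delta> / (2
    N) every point of the parallelogram lies within \<delta> of x.\<close>
  define N where "N = norm u + norm v + 1"
  define t where "t = \<delta> / N / 2"
  have \<delta>: "\<delta> > 0" using d d3 by (simp add: \<delta>_def)
  have np: "N > 0" unfolding N_def by (smt (verit) norm_ge_zero)
  have t: "t > 0" using \<delta> np by (simp add: t_def)
  have near: "dist (x + s *\<^sub>R u + r *\<^sub>R v) x < \<delta>" if "0 \<le> s" "s \<le> t" "0 \<le> r" "r \<le> t" for s r
  proof -
    have "dist (x + s *\<^sub>R u + r *\<^sub>R v) x \<le> s * norm u + r * norm v"
      using norm_triangle_ineq[of "s *\<^sub>R u" "r *\<^sub>R v"] that by (simp add: dist_norm)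
    also have "\<dots> \<le> t * norm u + t * norm v" using that by (intro add_mono mult_right_mono) auto
    also have "\<dots> < 2 * t * (norm u + norm v + 1)" using t
      by (simp add: algebra_simps) (smt (verit) mult_nonneg_nonneg norm_ge_zero)
    also have "\<dots> = \<delta>" using np unfolding t_def N_def[symmetric] by simp
    finally show ?thesis .
  qed
  have C: "C_on (Suc (Suc 0)) S f" using assms(1) by (simp only: smooth_on_def)
  have inS: "x + s *\<^sub>R u + r *\<^sub>R v \<in> S" if "0 \<le> s" "s \<le> t" "0 \<le> r" "r \<le> t" for s r
    using near[OF that] subsetD[OF d3(2)] by (simp add: \<delta>_def dist_commute)
  have inS': "x + s *\<^sub>R v + r *\<^sub>R u \<in> S" if "0 \<le> s" "s \<le> t" "0 \<le> r" "r \<le> t" for s r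
    using inS[OF that(3,4,1,2)] by (simp add: add.commute add.left_commute)
  have "\<exists>s r. 0 < s \<and> s < t \<and> 0 < r \<and> r < t \<and>
    f (x + t *\<^sub>R u + t *\<^sub>R v) - f (x + t *\<^sub>R u) - f (x + t *\<^sub>R v) + f x = t * t * ?A u v (x + s *\<^sub>R u + r *\<^sub>R v)"
    by (rule second_difference_mean_value[OF C t]) (rule inS)
  then obtain s r where sr: "0 < s \<and> s < t \<and> 0 < r \<and> r < t \<and>
    f (x + t *\<^sub>R u + t *\<^sub>R v) - f (x + t *\<^sub>R u) - f (x + t *\<^sub>R v) + f x = t * t * ?A u v (x + s *\<^sub>R u + r *\<^sub>R v)"
    by (elim exE)
  have "\<exists>s r. 0 < s \<and> s < t \<and> 0 < r \<and> r < t \<and>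
    f (x + t *\<^sub>R v + t *\<^sub>R u) - f (x + t *\<^sub>R v) - f (x + t *\<^sub>R u) + f x = t * t * ?A v u (x + s *\<^sub>R v + r *\<^sub>R u)"
    by (rule second_difference_mean_value[OF C t]) (rule inS')
  then obtain s' r' where sr': "0 < s' \<and> s' < t \<and> 0 < r' \<and> r' < t \<and>
    f (x + t *\<^sub>R v + t *\<^sub>R u) - f (x + t *\<^sub>R v) - f (x + t *\<^sub>R u) + f x = t * t * ?A v u (x + s' *\<^sub>R v + r' *\<^sub>R u)"
    by (elim exE)
  have sw: "x + t *\<^sub>R v + t *\<^sub>R u = x + t *\<^sub>R u + t *\<^sub>R v" "x + s' *\<^sub>R v + r' *\<^sub>R u = x + r' *\<^sub>R u + s' *\<^sub>R v"
    by (simp_all add: algebra_simps)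
  have "t * t * ?A u v (x + s *\<^sub>R u + r *\<^sub>R v) = t * t * ?A v u (x + r' *\<^sub>R u + s' *\<^sub>R v)"
    using sr sr' unfolding sw by linarith
  then have "?A u v (x + s *\<^sub>R u + r *\<^sub>R v) = ?A v u (x + r' *\<^sub>R u + s' *\<^sub>R v)" using t by simp
  moreover have "\<bar>?A u v (x + s *\<^sub>R u + r *\<^sub>R v) - ?A u v x\<bar> < e"
    using near[of s r] sr by (intro d(2)) (auto simp: \<delta>_def)
  moreover have "\<bar>?A v u (x + r' *\<^sub>R u + s' *\<^sub>R v) - ?A v u x\<bar> < e"
    using near[of r' s'] sr' by (intro d(4)) (auto simp: \<delta>_def)
  ultimately have "\<bar>?A u v x - ?A v u x\<bar> < e + e" by linarith
  moreover have "e + e = \<bar>?A u v x - ?A v u x\<bar>" by (simp add: e_def)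
  ultimately show False by (simp only: less_irrefl)
qed

text \<open>The inner product with a basis vector commutes with both differentiations, so the real
  case applies to each component.\<close>

lemma second_derivative_symmetric:
  fixes f :: "'a::real_normed_vector \<Rightarrow> 'b::euclidean_space"
  assumes "smooth_on S f" "open S" "x \<in> S"
  shows "frechet_derivative (\<lambda>y. frechet_derivative f (at y) u) (at x) v
    = frechet_derivative (\<lambda>y. frechet_derivative f (at y) v) (at x) u"
proof (rule euclidean_eqI)
  fix b :: 'b assume "b \<in> Basis"
  have sm: "smooth_on S (\<lambda>y. f y \<bullet> b)"
    by (rule smooth_on_bounded_linear_compose[OF bounded_linear_inner_left assms(2,1)])
  have D: "frechet_derivative (\<lambda>y. h y \<bullet> b) (at y) w = frechet_derivative h (at y) w \<bullet> b"
    if "smooth_on S h" "y \<in> S" for y w and h :: "'a \<Rightarrow> 'b"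
    by (rule fun_cong[OF frechet_derivative_eqI[OF has_derivative_inner_left[OF smooth_on_has_derivative[OF that]]]])
  have comp: "frechet_derivative (\<lambda>y. frechet_derivative f (at y) u) (at x) v \<bullet> b
    = frechet_derivative (\<lambda>y. frechet_derivative (\<lambda>y. f y \<bullet> b) (at y) u) (at x) v" for u v
  proof -
    have "frechet_derivative (\<lambda>y. frechet_derivative (\<lambda>y. f y \<bullet> b) (at y) u) (at x) v
      = frechet_derivative (\<lambda>y. frechet_derivative f (at y) u \<bullet> b) (at x) v"
      by (rule fun_cong[OF frechet_derivative_transform_within_open[of _ _ S]])
        (simp_all only: D[OF assms(1)] smooth_on_imp_differentiable[OF smooth_on_frechet_derivative[OF sm]] assms)
    also have "\<dots> = frechet_derivative (\<lambda>y. frechet_derivative f (at y) u) (at x) v \<bullet> b"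
      by (rule D[OF smooth_on_frechet_derivative[OF assms(1)] assms(3)])
    finally show ?thesis ..
  qed
  show "frechet_derivative (\<lambda>y. frechet_derivative f (at y) u) (at x) v \<bullet> b
    = frechet_derivative (\<lambda>y. frechet_derivative f (at y) v) (at x) u \<bullet> b"
    unfolding comp by (rule second_derivative_symmetric_real[OF sm assms(2,3)])
qed

section \<open>Smooth maps between manifolds in charts\<close>

text \<open>The axioms of \<^const>\<open>smooth_manifold\<close> without separation and countability, so that vector spaces
  and products qualify without further class instances.\<close>

definition atlas :: "('m::topological_space, 'a::real_normed_vector) charts \<Rightarrow> bool" where
  "atlas C \<longleftrightarrow>
     (\<forall>p. p \<in> cdom C p \<and> open (cdom C p) \<and> open (cmap C p ` cdom C p) \<and>
          homeomorphism (cdom C p) (cmap C p ` cdom C p) (cmap C p) (cinv C p)) \<and>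
     (\<forall>p q. smooth_on (cmap C p ` (cdom C p \<inter> cdom C q)) (cmap C q \<circ> cinv C p))"

lemma smooth_manifold_imp_atlas: "smooth_manifold C \<Longrightarrow> atlas C"
  by (simp add: smooth_manifold_def atlas_def)

lemma atlasD:
  assumes "atlas C"
  shows "p \<in> cdom C p" "open (cdom C p)" "open (cmap C p ` cdom C p)"
    "continuous_on (cdom C p) (cmap C p)" "continuous_on (cmap C p ` cdom C p) (cinv C p)"
    "m \<in> cdom C p \<Longrightarrow> cinv C p (cmap C p m) = m"
    "x \<in> cmap C p ` cdom C p \<Longrightarrow> cmap C p (cinv C p x) = x"
    "x \<in> cmap C p ` cdom C p \<Longrightarrow> cinv C p x \<in> cdom C p"
    "smooth_on (cmap C p ` (cdom C p \<inter> cdom C q)) (\<lambda>x. cmap C q (cinv C p x))"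
  using assms unfolding atlas_def homeomorphism_def by (auto simp: comp_def)

lemma open_cmap_image:
  assumes "atlas C" "open W" "W \<subseteq> cdom C p"
  shows "open (cmap C p ` W)"
proof -
  have "cmap C p ` W = cmap C p ` cdom C p \<inter> cinv C p -` W"
    using assms(3) atlasD(6,7)[OF assms(1)] by force
  then show ?thesis
    using continuous_open_preimage[OF atlasD(5,3)[OF assms(1)] assms(2)] by metis
qed

lemma smooth_map_onD:
  assumes "smooth_map_on C D U F" "W \<subseteq> U" "W \<subseteq> cdom C p" "F ` W \<subseteq> cdom D q"
  shows "smooth_on (cmap C p ` W) (\<lambda>x. cmap D q (F (cinv C p x)))"
proof -
  have "smooth_on (cmap C p ` (cdom C p \<inter> U \<inter> F -` cdom D q)) (cmap D q \<circ> F \<circ> cinv C p)"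
    using assms(1) unfolding smooth_map_on_def by blast
  then show ?thesis unfolding comp_def by (rule smooth_on_subset) (use assms(2-4) in \<open>auto intro!: imageI\<close>)
qed

lemma smooth_map_on_imp_continuous_on: "smooth_map_on C D U F \<Longrightarrow> continuous_on U F"
  by (simp add: smooth_map_on_def)

lemma smooth_map_on_cong:
  assumes C: "atlas C" and D: "atlas D" and "open U" and F: "smooth_map_on C D U F"
    and eq: "\<And>m. m \<in> U \<Longrightarrow> F m = F' m"
  shows "smooth_map_on C D U F'"
  unfolding smooth_map_on_def
proof (intro conjI allI)
  show cont: "continuous_on U F'"
    using smooth_map_on_imp_continuous_on[OF F] eq by (rule continuous_on_eq)
  fix p q
  have W: "open (U \<inter> F' -` cdom D q \<inter> cdom C p)"
    by (intro open_Int continuous_open_preimage[OF cont assms(3)] atlasD(2)[OF C] atlasD(2)[OF D])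
  have "smooth_on (cmap C p ` (U \<inter> F' -` cdom D q \<inter> cdom C p)) (cmap D q \<circ> F' \<circ> cinv C p)"
  proof (rule smooth_on_cong[OF open_cmap_image[OF C W]])
    show "smooth_on (cmap C p ` (U \<inter> F' -` cdom D q \<inter> cdom C p)) (\<lambda>x. cmap D q (F (cinv C p x)))"
      by (rule smooth_map_onD[OF F]) (auto simp: eq)
  qed (auto simp: atlasD(6)[OF C] eq)
  then show "smooth_on (cmap C p ` (cdom C p \<inter> U \<inter> F' -` cdom D q)) (cmap D q \<circ> F' \<circ> cinv C p)"
    by (simp add: Int_ac)
qed

text \<open>The definition asks for all pairs of charts, the hypothesis offers one pair around each
  point. Continuity has to come before the change of charts, since it makes the preimages of chart
  domains open; the remaining pairs are reached by transition maps.\<close>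

lemma smooth_map_onI:
  fixes C :: "('m::topological_space, 'a::finite_dim) charts"
    and D :: "('n::topological_space, 'b::finite_dim) charts"
  assumes C: "atlas C" and D: "atlas D" and "open U"
    and loc: "\<And>m. m \<in> U \<Longrightarrow> \<exists>W p q. open W \<and> m \<in> W \<and> W \<subseteq> cdom C p \<and> F ` W \<subseteq> cdom D q \<and>
      smooth_on (cmap C p ` W) (\<lambda>x. cmap D q (F (cinv C p x)))"
  shows "smooth_map_on C D U F"
proof -
  have "\<exists>W. open W \<and> m \<in> W \<and> continuous_on W F" if mU: "m \<in> U" for m
  proof -
    obtain W p q where W: "open W" "m \<in> W" "W \<subseteq> cdom C p" "F ` W \<subseteq> cdom D q"
      "smooth_on (cmap C p ` W) (\<lambda>x. cmap D q (F (cinv C p x)))" using loc[OF mU] by blast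
    have "continuous_on W (\<lambda>m. cmap D q (F (cinv C p (cmap C p m))))"
      by (rule continuous_on_compose2[OF smooth_on_imp_continuous_on[OF W(5)] continuous_on_subset[OF atlasD(4)[OF C] W(3)]]) simp
    moreover have "cmap D q (F (cinv C p (cmap C p m))) = cmap D q (F m)" if "m \<in> W" for m
      using that W(3) by (simp add: atlasD(6)[OF C] subset_iff)
    ultimately have "continuous_on W (\<lambda>m. cmap D q (F m))" by simp
    then have "continuous_on W (\<lambda>m. cinv D q (cmap D q (F m)))"
      by (rule continuous_on_compose2[OF atlasD(5)[OF D]]) (use W(4) in auto)
    moreover have "cinv D q (cmap D q (F m)) = F m" if "m \<in> W" for m
      using that W(4) by (auto intro!: atlasD(6)[OF D])
    ultimately have "continuous_on W F" by simp
    then show ?thesis using W(1,2) by blast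
  qed
  then obtain W where W: "\<And>m. m \<in> U \<Longrightarrow> open (W m) \<and> m \<in> W m \<and> continuous_on (W m) F" by metis
  then have "continuous_on (\<Union>m\<in>U. W m) F" by (intro continuous_on_open_UN) auto
  then have cont: "continuous_on U F" by (rule continuous_on_subset) (use W in auto)
  have "smooth_on (cmap C p' ` (cdom C p' \<inter> U \<inter> F -` cdom D q')) (cmap D q' \<circ> F \<circ> cinv C p')" for p' q'
  proof (rule smooth_on_local)
    fix x assume "x \<in> cmap C p' ` (cdom C p' \<inter> U \<inter> F -` cdom D q')"
    then obtain m where m: "m \<in> cdom C p'" "m \<in> U" "F m \<in> cdom D q'" "x = cmap C p' m" by auto
    obtain W p q where W: "open W" "m \<in> W" "W \<subseteq> cdom C p" "F ` W \<subseteq> cdom D q"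
      "smooth_on (cmap C p ` W) (\<lambda>x. cmap D q (F (cinv C p x)))" using loc[OF m(2)] by blast
    \<comment> \<open>On N both source charts are defined, and F maps N into both target charts, so
      the transition maps can be composed on either side.\<close>
    define N where "N = W \<inter> cdom C p' \<inter> (U \<inter> F -` cdom D q')"
    have N: "open N" "m \<in> N" "N \<subseteq> cdom C p'" "N \<subseteq> W" "F ` N \<subseteq> cdom D q'"
      using W(1,2) m atlasD(2)[OF C] continuous_open_preimage[OF cont assms(3) atlasD(2)[OF D]]
      unfolding N_def by auto
    have NW: "F ` N \<subseteq> cdom D q" using N(4) W(4) by blast
    have inv: "cinv C p' (cmap C p' n) = n" "cinv C p (cmap C p n) = n" "cinv D q (cmap D q (F n)) = F n"
      if "n \<in> N" for n
      using that N(3,5) N(4) W(3,4) by (auto intro!: atlasD(6)[OF C] atlasD(6)[OF D] subsetD[OF W(4)])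
    have oN: "open (cmap C p' ` N)" "open (cmap C p ` W)" "open (cmap D q ` (cdom D q \<inter> cdom D q'))"
      using open_cmap_image[OF C N(1,3)] open_cmap_image[OF C W(1,3)]
        open_cmap_image[OF D open_Int[OF atlasD(2)[OF D] atlasD(2)[OF D]] Int_lower1] by auto
    have "smooth_on (cmap C p' ` N) (\<lambda>x. cmap C p (cinv C p' x))"
      by (rule smooth_on_subset[OF atlasD(9)[OF C]]) (use N(3,4) W(3) in \<open>auto intro!: imageI\<close>)
    then have "smooth_on (cmap C p' ` N) (\<lambda>x. cmap D q (F (cinv C p (cmap C p (cinv C p' x)))))"
      by (rule smooth_on_compose[OF W(5) oN(2) _ oN(1)]) (use N(4) in \<open>auto simp: inv intro!: imageI\<close>)
    then have "smooth_on (cmap C p' ` N) (\<lambda>x. cmap D q' (cinv D q (cmap D q (F (cinv C p (cmap C p (cinv C p' x)))))))"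
      by (rule smooth_on_compose[OF atlasD(9)[OF D] oN(3) _ oN(1)])
        (use N(5) NW in \<open>auto simp: inv intro!: imageI\<close>)
    then have "smooth_on (cmap C p' ` N) (cmap D q' \<circ> F \<circ> cinv C p')"
      by (rule smooth_on_cong[OF oN(1), rotated]) (auto simp: inv)
    then show "\<exists>V. x \<in> V \<and> open V \<and> smooth_on V (cmap D q' \<circ> F \<circ> cinv C p')"
      using m(4) N(2) oN(1) by (intro exI[of _ "cmap C p' ` N"]) auto
  qed
  with cont show ?thesis by (simp add: smooth_map_on_def)
qed

lemma smooth_map_on_compose:
  fixes C :: "('m::topological_space, 'a::finite_dim) charts"
    and D :: "('n::topological_space, 'b::finite_dim) charts"
    and E :: "('k::topological_space, 'c::finite_dim) charts"
  assumes C: "atlas C" and D: "atlas D" and E: "atlas E" and "open U" "open V"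
    and F: "smooth_map_on C D U F" and H: "smooth_map_on D E V H" and sub: "F ` U \<subseteq> V"
  shows "smooth_map_on C E U (\<lambda>m. H (F m))"
proof (rule smooth_map_onI[OF C E assms(4)])
  fix m assume m: "m \<in> U"
  \<comment> \<open>W2 and the W below keep F W in one chart of D and H W2 in one chart of E; the
    chart of D then cancels in the middle.\<close>
  define W2 where "W2 = V \<inter> H -` cdom E (H (F m)) \<inter> cdom D (F m)"
  have W2: "open W2" "F m \<in> W2" "W2 \<subseteq> V" "W2 \<subseteq> cdom D (F m)" "H ` W2 \<subseteq> cdom E (H (F m))"
    unfolding W2_def
    using continuous_open_preimage[OF smooth_map_on_imp_continuous_on[OF H] assms(5) atlasD(2)[OF E]]
      m sub atlasD(1,2)[OF D] atlasD(1)[OF E] by auto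
  define W where "W = U \<inter> F -` W2 \<inter> cdom C m"
  have W: "open W" "m \<in> W" "W \<subseteq> U" "W \<subseteq> cdom C m" "F ` W \<subseteq> W2"
    unfolding W_def
    using continuous_open_preimage[OF smooth_map_on_imp_continuous_on[OF F] assms(4) W2(1)]
      m W2 atlasD(1,2)[OF C] by auto
  have inC: "cinv C m (cmap C m w) = w" if "w \<in> W" for w
    using that W(4) by (auto intro!: atlasD(6)[OF C])
  have o: "open (cmap C m ` W)" "open (cmap D (F m) ` W2)"
    using open_cmap_image[OF C W(1,4)] open_cmap_image[OF D W2(1,4)] by auto
  have "smooth_on (cmap C m ` W) (\<lambda>x. cmap D (F m) (F (cinv C m x)))"
    by (rule smooth_map_onD[OF F]) (use W W2 in auto)
  then have "smooth_on (cmap C m ` W) (\<lambda>x. cmap E (H (F m)) (H (cinv D (F m) (cmap D (F m) (F (cinv C m x))))))"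
    by (rule smooth_on_compose[OF smooth_map_onD[OF H W2(3,4,5)] o(2) _ o(1)])
      (auto simp: inC intro!: imageI subsetD[OF W(5)])
  moreover have "cmap E (H (F m)) (H (cinv D (F m) (cmap D (F m) (F (cinv C m x))))) = cmap E (H (F m)) (H (F (cinv C m x)))"
    if x: "x \<in> cmap C m ` W" for x
  proof -
    have "F (cinv C m x) \<in> W2" using x W(5) by (auto simp: inC)
    then show ?thesis using W2(4) atlasD(6)[OF D] by auto
  qed
  ultimately have "smooth_on (cmap C m ` W) (\<lambda>x. cmap E (H (F m)) (H (F (cinv C m x))))"
    using smooth_on_cong[OF o(1)] by (metis (no_types, lifting))
  then show "\<exists>W p q. open W \<and> m \<in> W \<and> W \<subseteq> cdom C p \<and> (\<lambda>m. H (F m)) ` W \<subseteq> cdom E q \<and>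
      smooth_on (cmap C p ` W) (\<lambda>x. cmap E q (H (F (cinv C p x))))"
    using W(1,2,4) subset_trans[OF image_mono[OF W(5)] W2(5)]
    by (intro exI[of _ W] exI[of _ m] exI[of _ "H (F m)"]) (simp add: image_image)
qed

section \<open>Vector spaces and products as manifolds\<close>

lemma vec_charts_simps [simp]:
  "cdom vec_charts p = UNIV" "cmap vec_charts p = (\<lambda>x. x)" "cinv vec_charts p = (\<lambda>x. x)"
proof -
  show "cdom vec_charts p = UNIV" "cmap vec_charts p = (\<lambda>x. x)"
    by (simp_all add: vec_charts_def cdom_def cmap_def)
  then have "cinv vec_charts p = inv_into UNIV (\<lambda>x. x)" by (simp add: cinv_def)
  then show "cinv vec_charts p = (\<lambda>x. x)"
    using inv_into_f_f[of "\<lambda>x. x" UNIV] by (simp add: fun_eq_iff)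
qed

lemma atlas_vec_charts: "atlas (vec_charts :: ('a::real_normed_vector, 'a) charts)"
  using smooth_on_bounded_linear[OF open_UNIV bounded_linear_ident]
  by (simp add: atlas_def homeomorphism_def comp_def)

lemma smooth_map_on_vec_iff:
  fixes f :: "'a::finite_dim \<Rightarrow> 'b::finite_dim"
  shows "open S \<Longrightarrow> smooth_map_on vec_charts vec_charts S f \<longleftrightarrow> smooth_on S f"
  using smooth_on_imp_continuous_on by (auto simp: smooth_map_on_def comp_def)

lemma cdom_prod [simp]: "cdom (prod_charts C D) (p, q) = cdom C p \<times> cdom D q"
  and cmap_prod [simp]: "cmap (prod_charts C D) (p, q) (m, n) = (cmap C p m, cmap D q n)"
  by (simp_all add: prod_charts_def cdom_def cmap_def)

text \<open>Since \<open>cinv\<close> is an \<open>inv_into\<close>, it is known only on the image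
  of the chart; hence the membership hypotheses.\<close>

lemma cinv_prod:
  assumes "atlas C" "atlas D" "x \<in> cmap C p ` cdom C p" "y \<in> cmap D q ` cdom D q"
  shows "cinv (prod_charts C D) (p, q) (x, y) = (cinv C p x, cinv D q y)"
proof -
  have "inj_on (cmap (prod_charts C D) (p, q)) (cdom C p \<times> cdom D q)"
  proof (rule inj_onI, clarify)
    fix a b a' b'
    assume *: "a \<in> cdom C p" "b \<in> cdom D q" "a' \<in> cdom C p" "b' \<in> cdom D q"
      "cmap (prod_charts C D) (p, q) (a, b) = cmap (prod_charts C D) (p, q) (a', b')"
    then have "cmap C p a = cmap C p a'" "cmap D q b = cmap D q b'" by simp_all
    then show "a = a' \<and> b = b'"
      using atlasD(6)[OF assms(1) *(1)] atlasD(6)[OF assms(1) *(3)]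
        atlasD(6)[OF assms(2) *(2)] atlasD(6)[OF assms(2) *(4)] by metis
  qed
  then have "inv_into (cdom C p \<times> cdom D q) (cmap (prod_charts C D) (p, q))
      (cmap (prod_charts C D) (p, q) (cinv C p x, cinv D q y)) = (cinv C p x, cinv D q y)"
    by (rule inv_into_f_f) (simp add: atlasD(8)[OF assms(1,3)] atlasD(8)[OF assms(2,4)])
  then show ?thesis
    by (simp add: cinv_def[of "prod_charts C D"] atlasD(7)[OF assms(1,3)] atlasD(7)[OF assms(2,4)])
qed

lemma cmap_prod_image: "cmap (prod_charts C D) (p, q) ` (A \<times> B) = (cmap C p ` A) \<times> (cmap D q ` B)"
  by (force simp: image_iff)

lemma atlas_prod_charts:
  fixes C :: "('m::topological_space, 'a::finite_dim) charts"
    and D :: "('n::topological_space, 'b::finite_dim) charts"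
  assumes C: "atlas C" and D: "atlas D"
  shows "atlas (prod_charts C D)"
proof -
  let ?P = "prod_charts C D"
  have "homeomorphism (cdom ?P (p, q)) (cmap ?P (p, q) ` cdom ?P (p, q)) (cmap ?P (p, q)) (cinv ?P (p, q))" for p q
  proof (rule homeomorphismI)
    have "continuous_on (cdom ?P (p, q)) (\<lambda>z. (cmap C p (fst z), cmap D q (snd z)))"
      by (intro continuous_on_Pair continuous_on_compose2[OF atlasD(4)[OF C]] continuous_on_compose2[OF atlasD(4)[OF D]]
          continuous_intros) auto
    then show "continuous_on (cdom ?P (p, q)) (cmap ?P (p, q))"
      by (rule continuous_on_eq) auto
    have "continuous_on (cmap ?P (p, q) ` cdom ?P (p, q)) (\<lambda>z. (cinv C p (fst z), cinv D q (snd z)))"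
      by (intro continuous_on_Pair continuous_on_compose2[OF atlasD(5)[OF C]] continuous_on_compose2[OF atlasD(5)[OF D]]
          continuous_intros) auto
    then show "continuous_on (cmap ?P (p, q) ` cdom ?P (p, q)) (cinv ?P (p, q))"
      by (rule continuous_on_eq) (auto simp: cinv_prod[OF C D])
  qed (auto simp: cinv_prod[OF C D] atlasD[OF C] atlasD[OF D])
  moreover have "smooth_on (cmap ?P (p, q) ` (cdom ?P (p, q) \<inter> cdom ?P (p', q'))) (cmap ?P (p', q') \<circ> cinv ?P (p, q))"
    for p q p' q'
  proof -
    let ?A = "cmap C p ` (cdom C p \<inter> cdom C p')" and ?B = "cmap D q ` (cdom D q \<inter> cdom D q')"
    have eq: "cmap ?P (p, q) ` (cdom ?P (p, q) \<inter> cdom ?P (p', q')) = ?A \<times> ?B"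
      by (simp add: Times_Int_Times cmap_prod_image)
    have o: "open ?A" "open ?B"
      by (intro open_cmap_image[OF C] open_cmap_image[OF D] open_Int atlasD(2)[OF C] atlasD(2)[OF D]; simp)+
    then have o': "open (?A \<times> ?B)" by (rule open_Times)
    have "smooth_on (?A \<times> ?B) (\<lambda>z. (cmap C p' (cinv C p (fst z)), cmap D q' (cinv D q (snd z))))"
      by (intro smooth_on_Pair o' smooth_on_compose[OF atlasD(9)[OF C] o(1)] smooth_on_compose[OF atlasD(9)[OF D] o(2)]
        smooth_on_bounded_linear bounded_linear_fst bounded_linear_snd) auto
    then show ?thesis unfolding eq
      by (rule smooth_on_cong[OF o', rotated]) (auto simp: cinv_prod[OF C D])
  qed
  moreover have "open (cmap ?P (p, q) ` cdom ?P (p, q))" for p q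
    by (simp add: cmap_prod_image open_Times atlasD(3)[OF C] atlasD(3)[OF D])
  ultimately show ?thesis
    unfolding atlas_def by (auto simp: open_Times atlasD(1,2)[OF C] atlasD(1,2)[OF D])
qed

lemma prod_vec_charts: "prod_charts vec_charts vec_charts = vec_charts"
  by (auto simp: prod_charts_def vec_charts_def cdom_def cmap_def fun_eq_iff)

lemma smooth_map_on_Pair:
  fixes C :: "('m::topological_space, 'a::finite_dim) charts"
    and D :: "('n::topological_space, 'b::finite_dim) charts"
    and E :: "('k::topological_space, 'c::finite_dim) charts"
  assumes C: "atlas C" and D: "atlas D" and E: "atlas E" and "open U"
    and F: "smooth_map_on C D U F" and H: "smooth_map_on C E U H"
  shows "smooth_map_on C (prod_charts D E) U (\<lambda>m. (F m, H m))"
proof (rule smooth_map_onI[OF C atlas_prod_charts[OF D E] assms(4)])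
  fix m assume m: "m \<in> U"
  define W where "W = (U \<inter> F -` cdom D (F m)) \<inter> (U \<inter> H -` cdom E (H m)) \<inter> cdom C m"
  have W: "open W" "m \<in> W" "W \<subseteq> U" "W \<subseteq> cdom C m" "F ` W \<subseteq> cdom D (F m)" "H ` W \<subseteq> cdom E (H m)"
    unfolding W_def
    by (intro open_Int continuous_open_preimage[OF smooth_map_on_imp_continuous_on[OF F]]
      continuous_open_preimage[OF smooth_map_on_imp_continuous_on[OF H]] assms(4) atlasD(2)[OF C] atlasD(2)[OF D] atlasD(2)[OF E])
      (use m atlasD(1)[OF C] atlasD(1)[OF D] atlasD(1)[OF E] in auto)
  have "smooth_on (cmap C m ` W) (\<lambda>x. (cmap D (F m) (F (cinv C m x)), cmap E (H m) (H (cinv C m x))))"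
    by (intro smooth_on_Pair open_cmap_image[OF C] smooth_map_onD[OF F] smooth_map_onD[OF H] W)
  then show "\<exists>W p q. open W \<and> m \<in> W \<and> W \<subseteq> cdom C p \<and> (\<lambda>m. (F m, H m)) ` W \<subseteq> cdom (prod_charts D E) q \<and>
      smooth_on (cmap C p ` W) (\<lambda>x. cmap (prod_charts D E) q (F (cinv C p x), H (cinv C p x)))"
    using W by (intro exI[of _ W] exI[of _ m] exI[of _ "(F m, H m)"]) auto
qed

lemma smooth_map_on_cinv:
  fixes C :: "('m::topological_space, 'a::finite_dim) charts"
  assumes C: "atlas C"
  shows "smooth_map_on vec_charts C (cmap C p ` cdom C p) (cinv C p)"
proof (rule smooth_map_onI[OF atlas_vec_charts C atlasD(3)[OF C]])
  fix m assume "m \<in> cmap C p ` cdom C p"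
  moreover have "smooth_on (cmap C p ` cdom C p) (\<lambda>x. cmap C p (cinv C p x))"
    by (rule smooth_on_cong[OF atlasD(3)[OF C] _ smooth_on_bounded_linear[OF atlasD(3)[OF C] bounded_linear_ident]])
      (simp add: atlasD(7)[OF C])
  ultimately show "\<exists>W x q. open W \<and> m \<in> W \<and> W \<subseteq> cdom vec_charts x \<and> cinv C p ` W \<subseteq> cdom C q \<and>
      smooth_on (cmap vec_charts x ` W) (\<lambda>z. cmap C q (cinv C p (cinv vec_charts x z)))"
    using atlasD(3,8)[OF C] by (intro exI[of _ "cmap C p ` cdom C p"] exI[of _ p] exI[of _ m]) auto
qed

lemma smooth_map_on_cmap:
  fixes C :: "('m::topological_space, 'a::finite_dim) charts"
  assumes C: "atlas C"
  shows "smooth_map_on C vec_charts (cdom C p) (cmap C p)"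
proof (rule smooth_map_onI[OF C atlas_vec_charts atlasD(2)[OF C]])
  fix m assume "m \<in> cdom C p"
  moreover have "smooth_on (cmap C p ` cdom C p) (\<lambda>x. cmap C p (cinv C p x))"
    by (rule smooth_on_cong[OF atlasD(3)[OF C] _ smooth_on_bounded_linear[OF atlasD(3)[OF C] bounded_linear_ident]])
      (simp add: atlasD(7)[OF C])
  ultimately show "\<exists>W x q. open W \<and> m \<in> W \<and> W \<subseteq> cdom C x \<and> cmap C p ` W \<subseteq> cdom vec_charts q \<and>
      smooth_on (cmap C x ` W) (\<lambda>z. cmap vec_charts q (cmap C p (cinv C x z)))"
    using atlasD(2)[OF C] by (intro exI[of _ "cdom C p"] exI[of _ p]) auto
qed

text \<open>Precomposition with the parametrisations \<open>cinv C p\<close> moves the question to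
  open subsets of the model space, where the calculus of \<open>smooth_on\<close> is
  available.\<close>

lemma smooth_mapI:
  fixes C :: "('m::topological_space, 'a::finite_dim) charts"
    and D :: "('n::topological_space, 'b::finite_dim) charts"
  assumes C: "atlas C" and D: "atlas D"
    and F: "\<And>p. smooth_map_on vec_charts D (cmap C p ` cdom C p) (\<lambda>x. F (cinv C p x))"
  shows "smooth_map C D F"
proof -
  have loc: "smooth_map_on C D (cdom C p) F" for p
  proof -
    have "smooth_map_on C D (cdom C p) (\<lambda>m. F (cinv C p (cmap C p m)))"
      by (rule smooth_map_on_compose[OF C atlas_vec_charts D atlasD(2)[OF C] atlasD(3)[OF C] smooth_map_on_cmap[OF C] F]) simp
    then show ?thesis by (rule smooth_map_on_cong[OF C D atlasD(2)[OF C]]) (simp add: atlasD(6)[OF C])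
  qed
  show ?thesis
  proof (rule smooth_map_onI[OF C D open_UNIV])
    fix m
    have cont: "continuous_on (cdom C m) F" by (rule smooth_map_on_imp_continuous_on[OF loc])
    let ?W = "cdom C m \<inter> F -` cdom D (F m)"
    have W: "open ?W" by (rule continuous_open_preimage[OF cont atlasD(2)[OF C] atlasD(2)[OF D]])
    have "smooth_on (cmap C m ` ?W) (\<lambda>x. cmap D (F m) (F (cinv C m x)))"
      by (rule smooth_map_onD[OF loc]) auto
    then show "\<exists>W p q. open W \<and> m \<in> W \<and> W \<subseteq> cdom C p \<and> F ` W \<subseteq> cdom D q \<and>
      smooth_on (cmap C p ` W) (\<lambda>x. cmap D q (F (cinv C p x)))"
      using W atlasD(1)[OF C] atlasD(1)[OF D] by (intro exI[of _ ?W] exI[of _ m] exI[of _ "F m"]) auto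
  qed
qed

section \<open>Tangent maps and the chain rule\<close>

lemma smooth_map_on_has_tangent:
  assumes C: "atlas C" and D: "atlas D" and F: "smooth_map_on C D U F" and "open U" "p \<in> U"
  shows "((\<lambda>x. cmap D (F p) (F (cinv C p x))) has_derivative tangent_map C D F p) (at (cmap C p p))"
proof -
  let ?W = "(U \<inter> F -` cdom D (F p)) \<inter> cdom C p"
  have "smooth_on (cmap C p ` ?W) (\<lambda>x. cmap D (F p) (F (cinv C p x)))"
    by (rule smooth_map_onD[OF F]) auto
  from smooth_on_has_derivative[OF this] show ?thesis
    using assms(5) atlasD(1)[OF C] atlasD(1)[OF D] by (simp add: tangent_map_def comp_def)
qed

lemma linear_tangent_map:
  "atlas C \<Longrightarrow> atlas D \<Longrightarrow> smooth_map_on C D U F \<Longrightarrow> open U \<Longrightarrow> p \<in> U \<Longrightarrow> linear (tangent_map C D F p)"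
  using has_derivative_linear[OF smooth_map_on_has_tangent] by blast

text \<open>Both factors read the tangent space at F p in the chart assigned to F p, so this chart
  cancels near p and the ordinary chain rule remains.\<close>

lemma tangent_map_compose:
  assumes C: "atlas C" and D: "atlas D" and E: "atlas E" and F: "smooth_map_on C D U F" and "open U" "p \<in> U"
    and H: "smooth_map_on D E V H" and "open V" "F p \<in> V"
  shows "tangent_map C E (\<lambda>m. H (F m)) p v = tangent_map D E H (F p) (tangent_map C D F p v)"
proof -
  let ?W = "(U \<inter> F -` cdom D (F p)) \<inter> cdom C p"
  have W: "open (cmap C p ` ?W)"
    by (intro open_cmap_image[OF C] open_Int continuous_open_preimage[OF smooth_map_on_imp_continuous_on[OF F]]
      assms(5) atlasD(2)[OF C] atlasD(2)[OF D]) auto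
  have p: "cinv C p (cmap C p p) = p" by (rule atlasD(6)[OF C atlasD(1)[OF C]])
  have "((\<lambda>x. cmap E (H (F p)) (H (cinv D (F p) (cmap D (F p) (F (cinv C p x)))))) has_derivative
    (\<lambda>v. tangent_map D E H (F p) (tangent_map C D F p v))) (at (cmap C p p))"
    using has_derivative_compose[where f="\<lambda>x. cmap D (F p) (F (cinv C p x))" and g="\<lambda>x. cmap E (H (F p)) (H (cinv D (F p) x))",
        OF smooth_map_on_has_tangent[OF C D F assms(5,6)], unfolded p, OF smooth_map_on_has_tangent[OF D E H assms(8,9)]] .
  then have "((\<lambda>x. cmap E (H (F p)) (H (F (cinv C p x)))) has_derivative
    (\<lambda>v. tangent_map D E H (F p) (tangent_map C D F p v))) (at (cmap C p p))"
  proof (rule has_derivative_transform_within_open[OF _ W])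
    show "cmap C p p \<in> cmap C p ` ?W" using assms(6) atlasD(1)[OF C] atlasD(1)[OF D] by (intro imageI) auto
  qed (auto simp: atlasD(6)[OF C] atlasD(6)[OF D])
  from frechet_derivative_eqI[OF this] show ?thesis
    by (simp add: tangent_map_def[of C E] comp_def)
qed

lemma tangent_map_id: "atlas C \<Longrightarrow> tangent_map C C (\<lambda>m. m) p v = v"
proof -
  assume C: "atlas C"
  have "((\<lambda>x. cmap C p (cinv C p x)) has_derivative (\<lambda>v. v)) (at (cmap C p p))"
    by (rule has_derivative_transform_within_open[OF has_derivative_ident atlasD(3)[OF C] imageI[OF atlasD(1)[OF C]]])
      (rule atlasD(7)[OF C, symmetric])
  from frechet_derivative_eqI[OF this] show ?thesis by (simp add: tangent_map_def comp_def)
qed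

lemma smooth_map_const:
  fixes C :: "('m::topological_space, 'a::finite_dim) charts"
    and D :: "('n::topological_space, 'b::finite_dim) charts"
  assumes C: "atlas C" and D: "atlas D" and "open U"
  shows "smooth_map_on C D U (\<lambda>m. k)"
proof (rule smooth_map_onI[OF C D assms(3)])
  fix m :: 'm
  show "\<exists>W p q. open W \<and> m \<in> W \<and> W \<subseteq> cdom C p \<and> (\<lambda>m. k) ` W \<subseteq> cdom D q \<and>
      smooth_on (cmap C p ` W) (\<lambda>x. cmap D q k)"
    using atlasD(1-3)[OF C] atlasD(1)[OF D]
    by (intro exI[of _ "cdom C m"] exI[of _ m] exI[of _ k]) (auto intro: smooth_on_const)
qed

section \<open>The Maurer--Cartan form of a Lie group\<close>

text \<open>The passage from smooth maps into the group to \<open>smooth_on\<close> for their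
  coordinates, on the open set where the chosen chart is defined.\<close>

lemma smooth_map_on_coordinate:
  fixes C :: "('m::topological_space, 'b::finite_dim) charts" and f :: "'a::finite_dim \<Rightarrow> 'm"
  assumes C: "atlas C" and f: "smooth_map_on vec_charts C U f" and "open U"
  shows "open (U \<inter> f -` cdom C q)" "smooth_on (U \<inter> f -` cdom C q) (\<lambda>x. cmap C q (f x))"
proof -
  show "open (U \<inter> f -` cdom C q)"
    by (rule continuous_open_preimage[OF smooth_map_on_imp_continuous_on[OF f] assms(3) atlasD(2)[OF C]])
  have "smooth_on (cmap vec_charts undefined ` (U \<inter> f -` cdom C q)) (\<lambda>x. cmap C q (f (cinv vec_charts undefined x)))"
    by (rule smooth_map_onD[OF f]) auto
  then show "smooth_on (U \<inter> f -` cdom C q) (\<lambda>x. cmap C q (f x))" by simp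
qed

locale lie =
  fixes G :: "('g::{t2_space,second_countable_topology}, 'e::euclidean_space) lie_struct"
  assumes lie_group: "lie_group G"
begin

abbreviation mul (infixl \<open>\<odot>\<close> 70) where "g \<odot> h \<equiv> g \<otimes>\<^bsub>G\<^esub> h"
abbreviation ginv where "ginv g \<equiv> inv\<^bsub>G\<^esub> g"
abbreviation one where "one \<equiv> \<one>\<^bsub>G\<^esub>"
abbreviation C where "C \<equiv> chart G"
abbreviation phi where "phi \<equiv> cmap C"
abbreviation psi where "psi \<equiv> cinv C"
abbreviation V where "V p \<equiv> cmap C p ` cdom C p"
abbreviation origin where "origin \<equiv> phi one one"
abbreviation bracket (\<open>[_, _]\<^sub>G\<close>) where "[a, b]\<^sub>G \<equiv> lie_bracket G a b"

section \<open>Group operations and right translation\<close>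

lemma atlas_G: "atlas C"
  using lie_group smooth_manifold_imp_atlas by (auto simp: lie_group_def)

lemma group_G: "group G" and carrier_G: "carrier G = UNIV"
  using lie_group by (auto simp: lie_group_def)

lemma group_laws [simp]:
  "one \<odot> g = g" "g \<odot> one = g" "ginv g \<odot> g = one" "g \<odot> ginv g = one" "ginv one = one" "ginv (ginv g) = g"
  "g \<odot> (ginv g \<odot> h) = h" "ginv g \<odot> (g \<odot> h) = h" "ginv (g \<odot> h) = ginv h \<odot> ginv g"
  and assoc: "g \<odot> h \<odot> k = g \<odot> (h \<odot> k)"
proof -
  interpret group G by (rule group_G)
  note [simp] = carrier_G
  show "one \<odot> g = g" "g \<odot> one = g" "ginv g \<odot> g = one" "g \<odot> ginv g = one" "ginv one = one" "ginv (ginv g) = g"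
    "g \<odot> h \<odot> k = g \<odot> (h \<odot> k)" "ginv (g \<odot> h) = ginv h \<odot> ginv g" for g h k
    by (simp_all add: m_assoc inv_mult_group)
  show "g \<odot> (ginv g \<odot> h) = h" "ginv g \<odot> (g \<odot> h) = h"
    by (simp_all add: m_assoc[symmetric])
qed

text \<open>The source is an arbitrary atlas, so that smoothness of any word in group elements, in
  one or several variables, follows by combining this rule with \<open>smooth_ginv\<close>.\<close>

lemma smooth_mul:
  fixes D :: "('m::topological_space, 'a::finite_dim) charts"
  assumes "atlas D" "open U" "smooth_map_on D C U f" "smooth_map_on D C U h"
  shows "smooth_map_on D C U (\<lambda>x. f x \<odot> h x)"
proof -
  have "smooth_map (prod_charts C C) C (\<lambda>(g, h). g \<odot> h)" using lie_group by (simp add: lie_group_def)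
  from smooth_map_on_compose[OF assms(1) atlas_prod_charts[OF atlas_G atlas_G] atlas_G assms(2) open_UNIV
      smooth_map_on_Pair[OF assms(1) atlas_G atlas_G assms(2,3,4)] this]
  show ?thesis by simp
qed

lemma smooth_ginv:
  fixes D :: "('m::topological_space, 'a::finite_dim) charts"
  assumes "atlas D" "open U" "smooth_map_on D C U f"
  shows "smooth_map_on D C U (\<lambda>x. ginv (f x))"
proof -
  have "smooth_map C C ginv" using lie_group by (simp add: lie_group_def)
  from smooth_map_on_compose[OF assms(1) atlas_G atlas_G assms(2) open_UNIV assms(3) this]
  show ?thesis by simp
qed

lemma smooth_ident: "smooth_map C C (\<lambda>x. x)"
  by (rule smooth_mapI[OF atlas_G atlas_G smooth_map_on_cinv[OF atlas_G]])

lemma smooth_const_G: "smooth_map C C (\<lambda>x. k)"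
  by (rule smooth_map_const[OF atlas_G atlas_G open_UNIV])

lemmas smooth_G = smooth_mul[OF atlas_G open_UNIV] smooth_ginv[OF atlas_G open_UNIV] smooth_ident smooth_const_G

lemma smooth_psi_compose:
  assumes "open U" "smooth_on U k" "k ` U \<subseteq> V p"
  shows "smooth_map_on vec_charts C U (\<lambda>x::'a::finite_dim. psi p (k x))"
  using smooth_map_on_compose[OF atlas_vec_charts atlas_vec_charts atlas_G assms(1) atlasD(3)[OF atlas_G]
    _ smooth_map_on_cinv[OF atlas_G] assms(3)] assms(1,2) by (simp add: smooth_map_on_vec_iff)

lemmas psi_phi [simp] = atlasD(6)[OF atlas_G]
lemmas phi_psi [simp] = atlasD(7)[OF atlas_G]
lemmas psi_in [simp] = atlasD(8)[OF atlas_G]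
lemmas cdom_self [simp] = atlasD(1)[OF atlas_G]
lemmas open_V = atlasD(3)[OF atlas_G]

lemma psi_phi_self [simp]: "psi p (phi p p) = p" and phi_self_in [simp]: "phi p p \<in> V p"
  by simp_all

text \<open>The inverse of \<open>TR G g\<close>, that is, the right Maurer-Cartan form at g in the
  chart assigned to g.\<close>

definition TRi :: "'g \<Rightarrow> 'e \<Rightarrow> 'e" where
  "TRi g = tangent_map C C (\<lambda>h. h \<odot> ginv g) g"

lemma TRi_TR [simp]: "TRi g (TR G g a) = a"
proof -
  have "tangent_map C C (\<lambda>h. (h \<odot> g) \<odot> ginv g) one a
      = tangent_map C C (\<lambda>h. h \<odot> ginv g) (one \<odot> g) (tangent_map C C (\<lambda>h. h \<odot> g) one a)"
    by (rule tangent_map_compose[OF atlas_G atlas_G atlas_G _ open_UNIV _ _ open_UNIV]) (auto intro!: smooth_G)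
  then show ?thesis by (simp add: TRi_def TR_def assoc tangent_map_id[OF atlas_G])
qed

lemma TR_TRi [simp]: "TR G g (TRi g a) = a"
proof -
  have "tangent_map C C (\<lambda>h. (h \<odot> ginv g) \<odot> g) g a
      = tangent_map C C (\<lambda>h. h \<odot> g) (g \<odot> ginv g) (tangent_map C C (\<lambda>h. h \<odot> ginv g) g a)"
    by (rule tangent_map_compose[OF atlas_G atlas_G atlas_G _ open_UNIV _ _ open_UNIV]) (auto intro!: smooth_G)
  then show ?thesis by (simp add: TRi_def TR_def assoc tangent_map_id[OF atlas_G])
qed

lemma linear_TR: "linear (TR G g)"
  unfolding TR_def by (rule linear_tangent_map[OF atlas_G atlas_G _ open_UNIV]) (auto intro!: smooth_G)

lemma linear_TRi: "linear (TRi g)"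
  unfolding TRi_def by (rule linear_tangent_map[OF atlas_G atlas_G _ open_UNIV]) (auto intro!: smooth_G)

text \<open>The right invariant Maurer--Cartan form in the coordinates of the chart around \<open>p\<close>.\<close>

definition rho :: "'g \<Rightarrow> 'e \<Rightarrow> 'e \<Rightarrow> 'e" where
  "rho p x = tangent_map vec_charts C (\<lambda>y. psi p y \<odot> ginv (psi p x)) x"

lemma smooth_psi_mul_const: "smooth_map_on vec_charts C (V p) (\<lambda>y. psi p y \<odot> k)"
  by (intro smooth_mul[OF atlas_vec_charts open_V] smooth_map_on_cinv[OF atlas_G]
    smooth_map_const[OF atlas_vec_charts atlas_G open_V])

text \<open>Tangent vectors at \<open>psi p x\<close> are read in the chart assigned to that point,
  which need not be the chart around p. The chain rule through \<open>psi p\<close> accounts for the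
  change and exhibits \<open>rho p\<close> as the pullback of \<open>TRi\<close>.\<close>

lemma rho_eq_TRi:
  assumes "x \<in> V p"
  shows "rho p x a = TRi (psi p x) (tangent_map vec_charts C (psi p) x a)"
  unfolding rho_def TRi_def
  by (rule tangent_map_compose[OF atlas_vec_charts atlas_G atlas_G smooth_map_on_cinv[OF atlas_G] open_V assms _ open_UNIV])
    (auto intro!: smooth_G)

lemma rho_eq_frechet: "x \<in> V p \<Longrightarrow> rho p x = frechet_derivative (\<lambda>y. phi one (psi p y \<odot> ginv (psi p x))) (at x)"
  by (simp add: rho_def tangent_map_def comp_def)

lemma rho_self: "rho p (phi p p) = TRi p"
proof
  fix a
  have "((\<lambda>x. phi p (psi p x)) has_derivative (\<lambda>v. v)) (at (phi p p))"
    by (rule has_derivative_transform_within_open[OF has_derivative_ident open_V phi_self_in])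
      (rule atlasD(7)[OF atlas_G, symmetric])
  from frechet_derivative_eqI[OF this]
  have "tangent_map vec_charts C (psi p) (phi p p) a = a" by (simp add: tangent_map_def comp_def)
  then show "rho p (phi p p) a = TRi p a" by (simp add: rho_eq_TRi)
qed

lemma rho_one: "rho one origin = (\<lambda>a. a)"
  by (auto simp: rho_self TRi_def tangent_map_id[OF atlas_G])

lemma partial_fst:
  fixes F :: "'a::real_normed_vector \<times> 'b::real_normed_vector \<Rightarrow> 'c::real_normed_vector"
  assumes "smooth_on W F" "(x, y) \<in> W"
  shows "((\<lambda>x. F (x, y)) has_derivative (\<lambda>v. frechet_derivative F (at (x, y)) (v, 0))) (at x)"
  by (rule has_derivative_compose[where f="\<lambda>x. (x, y)" and g=F, OF _ smooth_on_has_derivative[OF assms]])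
    (auto intro!: derivative_eq_intros)

lemma partial_snd:
  fixes F :: "'a::real_normed_vector \<times> 'b::real_normed_vector \<Rightarrow> 'c::real_normed_vector"
  assumes "smooth_on W F" "(x, y) \<in> W"
  shows "((\<lambda>y. F (x, y)) has_derivative (\<lambda>v. frechet_derivative F (at (x, y)) (0, v))) (at y)"
  by (rule has_derivative_compose[where f="\<lambda>y. (x, y)" and g=F, OF _ smooth_on_has_derivative[OF assms]])
    (auto intro!: derivative_eq_intros)

text \<open>The point x enters \<open>rho p x\<close> both as base point and as parameter.
  Separating the two roles makes it a partial derivative, evaluated on the diagonal, of a smooth
  function of two variables.\<close>

lemma smooth_rho: "smooth_on (V p) (\<lambda>x. rho p x a)"
proof -
  let ?f = "\<lambda>z. psi p (fst z) \<odot> ginv (psi p (snd z))"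
  let ?W = "(V p \<times> V p) \<inter> ?f -` cdom C one"
  have VV: "open (V p \<times> V p)" by (intro open_Times open_V)
  have f: "smooth_map_on vec_charts C (V p \<times> V p) ?f"
    by (intro smooth_mul[OF atlas_vec_charts VV] smooth_ginv[OF atlas_vec_charts VV] smooth_psi_compose VV
      smooth_on_bounded_linear bounded_linear_fst bounded_linear_snd) auto
  note F = smooth_map_on_coordinate[OF atlas_G f VV, of one]
  have "smooth_on (V p) (\<lambda>x. frechet_derivative (\<lambda>z. phi one (?f z)) (at (x, x)) (a, 0))"
    by (intro smooth_on_derivative_along[OF F(2,1)] smooth_on_Pair open_V smooth_on_bounded_linear[OF open_V bounded_linear_ident]
      smooth_on_const) auto
  then show ?thesis
  proof (rule smooth_on_cong[OF open_V, rotated])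
    fix x assume x: "x \<in> V p"
    then have "(x, x) \<in> ?W" by auto
    from frechet_derivative_eqI[OF partial_fst[OF F(2) this]]
    show "frechet_derivative (\<lambda>z. phi one (?f z)) (at (x, x)) (a, 0) = rho p x a"
      by (simp add: rho_eq_frechet[OF x])
  qed
qed

subsection \<open>Multiplication in the chart around the identity\<close>

definition lmul :: "'e \<times> 'e \<Rightarrow> 'e" where
  "lmul z = phi one (psi one (fst z) \<odot> psi one (snd z))"

definition lmul_dom :: "('e \<times> 'e) set" where
  "lmul_dom = (V one \<times> V one) \<inter> (\<lambda>z. psi one (fst z) \<odot> psi one (snd z)) -` cdom C one"

definition linv :: "'e \<Rightarrow> 'e" where
  "linv x = phi one (ginv (psi one x))"

definition linv_dom :: "'e set" where
  "linv_dom = V one \<inter> (\<lambda>x. ginv (psi one x)) -` cdom C one"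

lemma lmul_smooth: "open lmul_dom" "smooth_on lmul_dom lmul"
proof -
  have VV: "open (V one \<times> V one)" by (intro open_Times open_V)
  have f: "smooth_map_on vec_charts C (V one \<times> V one) (\<lambda>z. psi one (fst z) \<odot> psi one (snd z))"
    by (intro smooth_mul[OF atlas_vec_charts VV] smooth_psi_compose VV
      smooth_on_bounded_linear bounded_linear_fst bounded_linear_snd) auto
  show "open lmul_dom" "smooth_on lmul_dom lmul"
    using smooth_map_on_coordinate[OF atlas_G f VV, of one] by (simp_all add: lmul_dom_def lmul_def[abs_def])
qed

lemma linv_smooth: "open linv_dom" "smooth_on linv_dom linv"
proof -
  have f: "smooth_map_on vec_charts C (V one) (\<lambda>z. ginv (psi one z))"
    by (intro smooth_ginv[OF atlas_vec_charts open_V] smooth_map_on_cinv[OF atlas_G])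
  show "open linv_dom" "smooth_on linv_dom linv"
    using smooth_map_on_coordinate[OF atlas_G f open_V, of one] by (simp_all add: linv_dom_def linv_def[abs_def])
qed

lemma origin_in [simp]: "(origin, origin) \<in> lmul_dom" "origin \<in> linv_dom"
  by (simp_all add: lmul_dom_def linv_dom_def)

lemma linv_origin [simp]: "linv origin = origin" by (simp add: linv_def)

lemma linv_facts:
  assumes "x \<in> linv_dom"
  shows "x \<in> V one" "linv x \<in> V one" "psi one (linv x) = ginv (psi one x)" "(x, linv x) \<in> lmul_dom" "(linv x, x) \<in> lmul_dom"
    "(origin, x) \<in> lmul_dom" "lmul (x, linv x) = origin"
  using assms by (auto simp: linv_dom_def linv_def lmul_dom_def lmul_def)

lemma lmul_facts:
  assumes "z \<in> lmul_dom"
  shows "lmul z \<in> V one" "psi one (lmul z) = psi one (fst z) \<odot> psi one (snd z)"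
  using assms by (auto simp: lmul_dom_def lmul_def)

abbreviation Dm where "Dm z \<equiv> frechet_derivative lmul (at z)"

text \<open>The second derivative of the multiplication at (e, e). Its mixed value
  \<open>D2m (u, 0) (0, v)\<close> is the bilinear term b(u, v) in the expansion u + v + b(u, v) +
  ... of the product in coordinates centred at the origin.\<close>

definition D2m :: "'e \<times> 'e \<Rightarrow> 'e \<times> 'e \<Rightarrow> 'e" where
  "D2m u v = frechet_derivative (\<lambda>z. Dm z u) (at (origin, origin)) v"

lemma Dm_fst: "x \<in> V one \<Longrightarrow> Dm (x, origin) (u, 0) = u"
  and Dm_snd: "x \<in> V one \<Longrightarrow> Dm (origin, x) (0, u) = u"
proof -
  assume x: "x \<in> V one"
  then have in_dom: "(x, origin) \<in> lmul_dom" "(origin, x) \<in> lmul_dom" by (auto simp: lmul_dom_def)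
  have "((\<lambda>x. lmul (x, origin)) has_derivative (\<lambda>v. v)) (at x)"
    by (rule has_derivative_transform_within_open[OF has_derivative_ident open_V x]) (auto simp: lmul_def)
  then show "Dm (x, origin) (u, 0) = u"
    using has_derivative_unique[OF partial_fst[OF lmul_smooth(2) in_dom(1)]] by metis
  have "((\<lambda>x. lmul (origin, x)) has_derivative (\<lambda>v. v)) (at x)"
    by (rule has_derivative_transform_within_open[OF has_derivative_ident open_V x]) (auto simp: lmul_def)
  then show "Dm (origin, x) (0, u) = u"
    using has_derivative_unique[OF partial_snd[OF lmul_smooth(2) in_dom(2)]] by metis
qed

lemma D2m_has_derivative: "((\<lambda>z. Dm z u) has_derivative D2m u) (at (origin, origin))"
  unfolding D2m_def[abs_def]
  by (rule smooth_on_has_derivative[OF smooth_on_frechet_derivative[OF lmul_smooth(2)]]) simp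

lemma D2m_sym: "D2m u v = D2m v u"
  unfolding D2m_def by (rule second_derivative_symmetric[OF lmul_smooth(2,1)]) simp

lemma linear_D2m: "linear (D2m u)"
  by (rule has_derivative_linear[OF D2m_has_derivative])

lemma linear_D2m': "linear (\<lambda>u. D2m u v)"
proof -
  have "(\<lambda>u. D2m u v) = D2m v" by (rule ext) (rule D2m_sym)
  then show ?thesis by (simp only: linear_D2m)
qed

text \<open>Multiplication by the identity is the identity map, whose derivative is constant; hence
  the pure second derivatives vanish, here and in \<open>D2m_snd\<close>.\<close>

lemma D2m_fst: "D2m (u, 0) (v, 0) = 0"
proof -
  have "((\<lambda>x. Dm (x, origin) (u, 0)) has_derivative (\<lambda>v. D2m (u, 0) (v, 0))) (at origin)"
    by (rule has_derivative_compose[where f="\<lambda>x. (x, origin)" and g="\<lambda>z. Dm z (u, 0)", OF _ D2m_has_derivative])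
      (auto intro!: derivative_eq_intros)
  moreover have "((\<lambda>x. Dm (x, origin) (u, 0)) has_derivative (\<lambda>v. 0)) (at origin)"
    by (rule has_derivative_transform_within_open[OF has_derivative_const open_V phi_self_in]) (simp add: Dm_fst)
  ultimately show ?thesis using has_derivative_unique by metis
qed

lemma D2m_snd: "D2m (0, u) (0, v) = 0"
proof -
  have "((\<lambda>x. Dm (origin, x) (0, u)) has_derivative (\<lambda>v. D2m (0, u) (0, v))) (at origin)"
    by (rule has_derivative_compose[where f="\<lambda>x. (origin, x)" and g="\<lambda>z. Dm z (0, u)", OF _ D2m_has_derivative])
      (auto intro!: derivative_eq_intros)
  moreover have "((\<lambda>x. Dm (origin, x) (0, u)) has_derivative (\<lambda>v. 0)) (at origin)"
    by (rule has_derivative_transform_within_open[OF has_derivative_const open_V phi_self_in]) (simp add: Dm_snd)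
  ultimately show ?thesis using has_derivative_unique by metis
qed

lemma linear_Dm: "z \<in> lmul_dom \<Longrightarrow> linear (Dm z)"
  by (rule linear_frechet_derivative[OF smooth_on_imp_differentiable[OF lmul_smooth(2)]])

text \<open>Differentiate x x^-1 = e at the identity, where the derivative of the multiplication is
  addition.\<close>

lemma linv_has_derivative: "(linv has_derivative (\<lambda>v. - v)) (at origin)"
proof -
  note D = smooth_on_has_derivative[OF linv_smooth(2) origin_in(2)]
  let ?D = "frechet_derivative linv (at origin)"
  have 1: "((\<lambda>x. lmul (x, linv x)) has_derivative (\<lambda>v. Dm (origin, origin) (v, ?D v))) (at origin)"
    by (rule has_derivative_compose[where f="\<lambda>x. (x, linv x)" and g=lmul])
      (auto intro!: has_derivative_Pair has_derivative_ident D smooth_on_has_derivative[OF lmul_smooth(2)])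
  have 2: "((\<lambda>x. lmul (x, linv x)) has_derivative (\<lambda>v. 0)) (at origin)"
    by (rule has_derivative_transform_within_open[OF has_derivative_const linv_smooth(1) origin_in(2)]) (simp add: linv_facts)
  have 3: "Dm (origin, origin) (v, w) = v + w" for v w
    using linear_add[OF linear_Dm[OF origin_in(1)], of "(v, 0)" "(0, w)"] by (simp add: Dm_fst Dm_snd)
  have "v + ?D v = 0" for v using fun_cong[OF has_derivative_unique[OF 1 2], of v] by (simp only: 3)
  then have "?D = (\<lambda>v. - v)" by (intro ext minus_unique[symmetric])
  then show ?thesis using D by simp
qed

text \<open>Conjugation is read as x^-1 (y x): two local multiplications with only one moving factor
  each, which explains the zeros in the increments.\<close>

lemma Ad_eq_Dm:
  assumes x: "x \<in> linv_dom"
  shows "Ad G (psi one x) b = Dm (linv x, x) (0, Dm (origin, x) (b, 0))"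
proof -
  note x' = linv_facts[OF x]
  let ?k = "\<lambda>y. (linv x, lmul (y, x))"
  let ?U = "(\<lambda>y. (y, x)) -` lmul_dom"
  have U: "open ?U" by (intro open_vimage lmul_smooth continuous_intros)
  have "((\<lambda>y. lmul (y, x)) has_derivative (\<lambda>b. Dm (origin, x) (b, 0))) (at origin)"
    by (rule partial_fst[OF lmul_smooth(2) x'(6)])
  then have k: "(?k has_derivative (\<lambda>b. (0, Dm (origin, x) (b, 0)))) (at origin)"
    by (auto intro!: derivative_eq_intros)
  have ko: "?k origin = (linv x, x)" using x'(1) by (simp add: lmul_def)
  have kD: "((\<lambda>y. lmul (?k y)) has_derivative (\<lambda>b. Dm (linv x, x) (0, Dm (origin, x) (b, 0)))) (at origin)"
    by (rule has_derivative_compose[where f="?k" and g=lmul, OF k])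
      (unfold ko, rule smooth_on_has_derivative[OF lmul_smooth(2) x'(5)])
  have "((\<lambda>y. phi one (ginv (psi one x) \<odot> psi one y \<odot> psi one x)) has_derivative
      (\<lambda>b. Dm (linv x, x) (0, Dm (origin, x) (b, 0)))) (at origin)"
  proof (rule has_derivative_transform_within_open[OF kD U])
    show "origin \<in> ?U" using x'(6) by simp
    fix y assume "y \<in> ?U"
    then have "(y, x) \<in> lmul_dom" by simp
    from lmul_facts[OF this] show "lmul (?k y) = phi one (ginv (psi one x) \<odot> psi one y \<odot> psi one x)"
      using x'(3) by (simp add: lmul_def[of "?k y"] assoc)
  qed
  from frechet_derivative_eqI[OF this] show ?thesis
    by (simp add: Ad_def tangent_map_def comp_def)
qed

text \<open>The inner derivative varies by \<open>D2m (b, 0) (0, a)\<close>. The base point (x^-1,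
  x) moves by (-a, a), which contributes \<open>D2m (0, b) (- a, a)\<close>; only the mixed part of
  this survives, by \<open>D2m_snd\<close>.\<close>

lemma Ad_has_derivative:
  "((\<lambda>x. Ad G (psi one x) b) has_derivative (\<lambda>a. D2m (b, 0) (0, a) - D2m (a, 0) (0, b))) (at origin)"
proof -
  have w: "((\<lambda>x. Dm (origin, x) (b, 0)) has_derivative (\<lambda>a. D2m (b, 0) (0, a))) (at origin)"
    by (rule has_derivative_compose[where f="\<lambda>x. (origin, x)" and g="\<lambda>z. Dm z (b, 0)", OF _ D2m_has_derivative])
      (auto intro!: derivative_eq_intros)
  have "((\<lambda>x. Dm (linv x, x) (0, Dm (origin, x) (b, 0))) has_derivative
    (\<lambda>a. frechet_derivative (\<lambda>z. Dm z (0, Dm (origin, origin) (b, 0))) (at (linv origin, origin)) (- a, a)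
       + Dm (linv origin, origin) (0, D2m (b, 0) (0, a)))) (at origin)"
    by (rule has_derivative_derivative_along[OF lmul_smooth(2,1)])
      (auto intro!: has_derivative_Pair linv_has_derivative has_derivative_ident w has_derivative_const)
  then have D: "((\<lambda>x. Dm (linv x, x) (0, Dm (origin, x) (b, 0))) has_derivative
    (\<lambda>a. D2m (0, b) (- a, a) + D2m (b, 0) (0, a))) (at origin)"
    by (simp add: Dm_fst Dm_snd D2m_def[symmetric])
  have "D2m (0, b) (- a, a) = - D2m (a, 0) (0, b)" for a
    using linear_add[OF linear_D2m, of "(0, b)" "(- a, 0)" "(0, a)"] linear_neg[OF linear_D2m, of "(0, b)" "(a, 0)"]
    by (simp add: D2m_snd D2m_sym[of "(a, 0)"])
  with D have "((\<lambda>x. Dm (linv x, x) (0, Dm (origin, x) (b, 0))) has_derivative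
    (\<lambda>a. D2m (b, 0) (0, a) - D2m (a, 0) (0, b))) (at origin)" by simp
  then show ?thesis
    by (rule has_derivative_transform_within_open[OF _ linv_smooth(1) origin_in(2)]) (simp add: Ad_eq_Dm)
qed

text \<open>With b(u, v) the mixed term of the multiplication, this is b(b, a) - b(a, b). The order
  is opposite to that for left invariant fields because \<open>Ad\<close> conjugates by the
  inverse.\<close>

lemma bracket_eq: "[a, b]\<^sub>G = D2m (b, 0) (0, a) - D2m (a, 0) (0, b)"
  using frechet_derivative_eqI[OF Ad_has_derivative[of b]]
  by (simp add: lie_bracket_def tangent_map_def comp_def)

lemma bracket_bounded_bilinear: "bounded_bilinear (lie_bracket G)"
proof -
  have "linear (\<lambda>u. D2m (u, 0) z)" for z
    using linear_compose[OF _ linear_D2m'[of z], of "\<lambda>u. (u, 0)"] by (simp add: comp_def linear_iff)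
  moreover have "linear (\<lambda>u. D2m z (0, u))" for z
    using linear_compose[OF _ linear_D2m[of z], of "\<lambda>u. (0, u)"] by (simp add: comp_def linear_iff)
  ultimately have "bilinear (lie_bracket G)"
    unfolding bilinear_def bracket_eq[abs_def] by (auto intro!: linear_compose_sub)
  then show ?thesis by (simp add: bilinear_conv_bounded_bilinear)
qed

lemma bracket_antisym: "[a, b]\<^sub>G = - [b, a]\<^sub>G"
  by (simp add: bracket_eq)

sublocale br: bounded_bilinear "lie_bracket G" by (rule bracket_bounded_bilinear)

text \<open>Near \<open>x0\<close> the group elements are compared with \<open>psi p x0\<close> by right translation to the identity, where
  the Taylor expansion of the multiplication is available.\<close>

definition rtrans :: "'g \<Rightarrow> 'e \<Rightarrow> 'e \<Rightarrow> 'e" where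
  "rtrans p x0 y = phi one (psi p y \<odot> ginv (psi p x0))"

definition rtrans_dom :: "'g \<Rightarrow> 'e \<Rightarrow> 'e set" where
  "rtrans_dom p x0 = V p \<inter> (\<lambda>y. psi p y \<odot> ginv (psi p x0)) -` cdom C one"

lemma rtrans_smooth: "open (rtrans_dom p x0)" "smooth_on (rtrans_dom p x0) (rtrans p x0)"
  using smooth_map_on_coordinate[OF atlas_G smooth_psi_mul_const open_V, of p _ one]
  by (simp_all add: rtrans_dom_def rtrans_def[abs_def])

lemma rtrans_facts:
  assumes "y \<in> rtrans_dom p x0"
  shows "y \<in> V p" "psi one (rtrans p x0 y) = psi p y \<odot> ginv (psi p x0)" "rtrans p x0 y \<in> V one"
  using assms by (auto simp: rtrans_dom_def rtrans_def)

lemma rtrans_base: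
  assumes "x0 \<in> V p"
  shows "x0 \<in> rtrans_dom p x0" "rtrans p x0 x0 = origin" "frechet_derivative (rtrans p x0) (at x0) = rho p x0"
  using assms by (auto simp: rtrans_dom_def rtrans_def[abs_def] rho_eq_frechet)

text \<open>Shrunk so that the translated point can also be inverted within the chart around the
  identity.\<close>

definition rtrans_dom' :: "'g \<Rightarrow> 'e \<Rightarrow> 'e set" where
  "rtrans_dom' p x0 = rtrans_dom p x0 \<inter> rtrans p x0 -` linv_dom"

lemma open_rtrans_dom': "open (rtrans_dom' p x0)"
  unfolding rtrans_dom'_def
  by (rule continuous_open_preimage[OF smooth_on_imp_continuous_on rtrans_smooth(1) linv_smooth(1)]) (rule rtrans_smooth(2))

lemma base_in_rtrans_dom': "x0 \<in> V p \<Longrightarrow> x0 \<in> rtrans_dom' p x0"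
  by (simp add: rtrans_dom'_def rtrans_base)

text \<open>From y x^-1 = (y x0^-1) (x x0^-1)^-1, the translation that defines
  \<open>rho p x\<close> becomes a local multiplication near the identity with a fixed second
  factor.\<close>

lemma rho_eq_Dm:
  assumes x: "x \<in> rtrans_dom' p x0"
  shows "rho p x b = Dm (rtrans p x0 x, linv (rtrans p x0 x)) (frechet_derivative (rtrans p x0) (at x) b, 0)"
proof -
  let ?R = "rtrans p x0" and ?i = "linv (rtrans p x0 x)"
  have xd: "x \<in> rtrans_dom p x0" and xi: "?R x \<in> linv_dom" using x by (auto simp: rtrans_dom'_def)
  note x' = rtrans_facts[OF xd] and i' = linv_facts[OF xi]
  have "((\<lambda>y. lmul (?R y, ?i)) has_derivative (\<lambda>b. Dm (?R x, ?i) (frechet_derivative ?R (at x) b, 0))) (at x)"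
    by (rule has_derivative_compose[OF smooth_on_has_derivative[OF rtrans_smooth(2) xd] partial_fst[OF lmul_smooth(2) i'(4)]])
  then have "((\<lambda>y. phi one (psi p y \<odot> ginv (psi p x))) has_derivative
      (\<lambda>b. Dm (?R x, ?i) (frechet_derivative ?R (at x) b, 0))) (at x)"
    by (rule has_derivative_transform_within_open[OF _ rtrans_smooth(1) xd])
      (simp add: lmul_def rtrans_facts i'(3) x'(2) assoc)
  from frechet_derivative_eqI[OF this] show ?thesis by (simp add: rho_eq_frechet[OF x'(1)])
qed

text \<open>The first term is a second derivative of \<open>rtrans\<close>, symmetric in a and b,
  and will cancel under antisymmetrisation. The second comes from the factor (x x0^-1)^-1, which
  moves by - \<rho> a, through the mixed part of the multiplication.\<close>

lemma rho_has_derivative: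
  assumes x0: "x0 \<in> V p"
  shows "((\<lambda>x. rho p x b) has_derivative (\<lambda>a. frechet_derivative (\<lambda>x. frechet_derivative (rtrans p x0) (at x) b) (at x0) a
    - D2m (rho p x0 b, 0) (0, rho p x0 a))) (at x0)"
proof -
  let ?R = "rtrans p x0"
  let ?R2 = "frechet_derivative (\<lambda>x. frechet_derivative ?R (at x) b) (at x0)"
  note base = rtrans_base[OF x0]
  have R: "(?R has_derivative rho p x0) (at x0)"
    using smooth_on_has_derivative[OF rtrans_smooth(2) base(1)] by (simp add: base(3))
  have i: "((\<lambda>x. linv (?R x)) has_derivative (\<lambda>a. - rho p x0 a)) (at x0)"
    by (rule has_derivative_compose[OF R]) (simp add: base(2) linv_has_derivative)
  have R2: "((\<lambda>x. frechet_derivative ?R (at x) b) has_derivative ?R2) (at x0)"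
    by (rule smooth_on_has_derivative[OF smooth_on_frechet_derivative[OF rtrans_smooth(2)] base(1)])
  have "((\<lambda>x. Dm (?R x, linv (?R x)) (frechet_derivative ?R (at x) b, 0)) has_derivative
    (\<lambda>a. frechet_derivative (\<lambda>z. Dm z (frechet_derivative ?R (at x0) b, 0)) (at (?R x0, linv (?R x0))) (rho p x0 a, - rho p x0 a)
       + Dm (?R x0, linv (?R x0)) (?R2 a, 0))) (at x0)"
    by (rule has_derivative_derivative_along[OF lmul_smooth(2,1)])
      (auto intro!: has_derivative_Pair R i R2 has_derivative_const simp: base(2))
  then have D: "((\<lambda>x. Dm (?R x, linv (?R x)) (frechet_derivative ?R (at x) b, 0)) has_derivative
    (\<lambda>a. D2m (rho p x0 b, 0) (rho p x0 a, - rho p x0 a) + ?R2 a)) (at x0)"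
    by (simp add: base Dm_fst D2m_def[symmetric])
  have "D2m (u, 0) (v, - v) = - D2m (u, 0) (0, v)" for u v
    using linear_add[OF linear_D2m, of "(u, 0)" "(v, 0)" "(0, - v)"] linear_neg[OF linear_D2m, of "(u, 0)" "(0, v)"]
    by (simp add: D2m_fst)
  with D have "((\<lambda>x. Dm (?R x, linv (?R x)) (frechet_derivative ?R (at x) b, 0)) has_derivative
    (\<lambda>a. ?R2 a - D2m (rho p x0 b, 0) (0, rho p x0 a))) (at x0)" by simp
  then show ?thesis
    by (rule has_derivative_transform_within_open[OF _ open_rtrans_dom' base_in_rtrans_dom'[OF x0]]) (simp add: rho_eq_Dm)
qed

section \<open>The Maurer-Cartan equation and the Jacobi identity\<close>

lemma maurer_cartan:
  assumes x: "x \<in> V p"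
  shows "frechet_derivative (\<lambda>x. rho p x b) (at x) a - frechet_derivative (\<lambda>x. rho p x a) (at x) b
    = - [rho p x a, rho p x b]\<^sub>G"
  unfolding frechet_derivative_eqI[OF rho_has_derivative[OF x]] bracket_eq
  using second_derivative_symmetric[OF rtrans_smooth(2,1) rtrans_base(1)[OF x], of b a] by simp

text \<open>This is d(d\<rho>) = 0 at the identity, where \<open>rho_one\<close> makes \<rho> the
  identity map. P and S hold the first and second derivatives of \<rho> there; S is symmetric in its
  two directions of differentiation.\<close>

lemma jacobi: "[[a, b]\<^sub>G, c]\<^sub>G + [[b, c]\<^sub>G, a]\<^sub>G + [[c, a]\<^sub>G, b]\<^sub>G = 0"
proof -
  let ?V = "V one" and ?o = origin
  define P where "P = (\<lambda>a b. frechet_derivative (\<lambda>x. rho one x b) (at ?o) a)"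
  define S where "S = (\<lambda>c a b. frechet_derivative (\<lambda>x. frechet_derivative (\<lambda>x. rho one x b) (at x) a) (at ?o) c)"
  have o: "?o \<in> ?V" by simp
  have S_sym: "S c a b = S a c b" for a b c
    unfolding S_def by (rule second_derivative_symmetric[OF smooth_rho open_V o])
  have S: "S c a b - S c b a = - ([P c a, b]\<^sub>G + [a, P c b]\<^sub>G)" for a b c
  proof -
    have 1: "((\<lambda>x. frechet_derivative (\<lambda>x. rho one x b) (at x) a - frechet_derivative (\<lambda>x. rho one x a) (at x) b)
      has_derivative (\<lambda>c. S c a b - S c b a)) (at ?o)"
      unfolding S_def
      by (intro has_derivative_diff smooth_on_has_derivative[OF smooth_on_frechet_derivative[OF smooth_rho] o])
    have P: "((\<lambda>x. rho one x b) has_derivative (\<lambda>c. P c b)) (at ?o)" for b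
      unfolding P_def by (rule smooth_on_has_derivative[OF smooth_rho o])
    have 2: "((\<lambda>x. - [rho one x a, rho one x b]\<^sub>G) has_derivative (\<lambda>c. - ([a, P c b]\<^sub>G + [P c a, b]\<^sub>G))) (at ?o)"
      using has_derivative_minus[OF br.FDERIV[OF P P]] by (simp add: rho_one)
    have "((\<lambda>x. frechet_derivative (\<lambda>x. rho one x b) (at x) a - frechet_derivative (\<lambda>x. rho one x a) (at x) b)
      has_derivative (\<lambda>c. - ([a, P c b]\<^sub>G + [P c a, b]\<^sub>G))) (at ?o)"
      by (rule has_derivative_transform_within_open[OF 2 open_V o]) (rule maurer_cartan[symmetric])
    from has_derivative_unique[OF 1 this] show ?thesis by (metis add.commute)
  qed
  have MC: "P a b = P b a - [a, b]\<^sub>G" for a b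
    using maurer_cartan[OF o, of b a] by (simp add: P_def rho_one algebra_simps)
  \<comment> \<open>By symmetry the cyclic sum of the differentiated left-hand sides vanishes. What
    remains are brackets with P, which occur only in differences such as P c a - P a c, and by MC
    each of these is a bracket.\<close>
  have "(S c a b - S c b a) + (S a b c - S a c b) + (S b c a - S b a c) = 0"
    using S_sym[of c a b] S_sym[of c b a] S_sym[of a b c] by simp
  moreover have "A + B + C' = 0" if "- A + - B + - C' = 0" for A B C' :: 'e
  proof -
    have "A + B + C' = - (- A + - B + - C')" by simp
    then show ?thesis by (simp only: that minus_zero)
  qed
  ultimately have "[P c a, b]\<^sub>G + [a, P c b]\<^sub>G + ([P a b, c]\<^sub>G + [b, P a c]\<^sub>G) + ([P b c, a]\<^sub>G + [c, P b a]\<^sub>G) = 0"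
    unfolding S by blast
  moreover have "[a, P c b]\<^sub>G = - [P c b, a]\<^sub>G" "[b, P a c]\<^sub>G = - [P a c, b]\<^sub>G" "[c, P b a]\<^sub>G = - [P b a, c]\<^sub>G"
    by (rule bracket_antisym)+
  ultimately show ?thesis
    unfolding MC[of c a] MC[of a b] MC[of b c] by (simp add: br.diff_left algebra_simps) (metis add.right_inverse)
qed

subsection \<open>The adjoint action\<close>

text \<open>The factors are reversed because conjugation by the inverse is a right action.\<close>

lemma Ad_Ad: "Ad G g (Ad G h a) = Ad G (h \<odot> g) a"
proof -
  have "tangent_map C C (\<lambda>k. ginv g \<odot> (ginv h \<odot> k \<odot> h) \<odot> g) one a
    = tangent_map C C (\<lambda>k. ginv g \<odot> k \<odot> g) (ginv h \<odot> one \<odot> h) (tangent_map C C (\<lambda>k. ginv h \<odot> k \<odot> h) one a)"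
    by (rule tangent_map_compose[OF atlas_G atlas_G atlas_G _ open_UNIV _ _ open_UNIV]) (auto intro!: smooth_G)
  then show ?thesis by (simp add: Ad_def assoc)
qed

lemma Ad_one: "Ad G one a = a"
  by (simp add: Ad_def tangent_map_id[OF atlas_G])

lemma Ad_ginv [simp]: "Ad G g (Ad G (ginv g) a) = a" "Ad G (ginv g) (Ad G g a) = a"
  by (simp_all add: Ad_Ad Ad_one)

lemma linear_Ad: "linear (Ad G g)"
  unfolding Ad_def by (rule linear_tangent_map[OF atlas_G atlas_G _ open_UNIV]) (auto intro!: smooth_G)

lemma smooth_Ad: "smooth_on (V p) (\<lambda>x. Ad G (ginv (psi p x)) a)"
proof -
  let ?f = "\<lambda>z. psi p (fst z) \<odot> psi one (snd z) \<odot> ginv (psi p (fst z))"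
  let ?W = "(V p \<times> V one) \<inter> ?f -` cdom C one"
  have VV: "open (V p \<times> V one)" by (intro open_Times open_V)
  have f: "smooth_map_on vec_charts C (V p \<times> V one) ?f"
    by (intro smooth_mul[OF atlas_vec_charts VV] smooth_ginv[OF atlas_vec_charts VV] smooth_psi_compose VV
      smooth_on_bounded_linear bounded_linear_fst bounded_linear_snd) auto
  note F = smooth_map_on_coordinate[OF atlas_G f VV, of one]
  have "smooth_on (V p) (\<lambda>x. frechet_derivative (\<lambda>z. phi one (?f z)) (at (x, origin)) (0, a))"
    by (intro smooth_on_derivative_along[OF F(2,1)] smooth_on_Pair open_V smooth_on_bounded_linear[OF open_V bounded_linear_ident]
      smooth_on_const) auto
  then show ?thesis
  proof (rule smooth_on_cong[OF open_V, rotated])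
    fix x assume x: "x \<in> V p"
    then have "(x, origin) \<in> ?W" by auto
    from frechet_derivative_eqI[OF partial_snd[OF F(2) this]]
    show "frechet_derivative (\<lambda>z. phi one (?f z)) (at (x, origin)) (0, a) = Ad G (ginv (psi p x)) a"
      by (simp add: Ad_def tangent_map_def comp_def)
  qed
qed

text \<open>Writing x = (x x0^-1) x0 moves the question to the identity: c carries the fixed factor
  x0, and (x x0^-1)^-1 leaves the identity with velocity - \<rho> a. The bracket then follows from
  \<open>Ad_has_derivative\<close>.\<close>

lemma Ad_ginv_has_derivative:
  assumes x0: "x0 \<in> V p"
  shows "((\<lambda>x. Ad G (ginv (psi p x)) b) has_derivative (\<lambda>a. [Ad G (ginv (psi p x0)) b, rho p x0 a]\<^sub>G)) (at x0)"
proof -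
  let ?R = "rtrans p x0"
  define c where "c = Ad G (ginv (psi p x0)) b"
  note base = rtrans_base[OF x0]
  have R: "(?R has_derivative rho p x0) (at x0)"
    using smooth_on_has_derivative[OF rtrans_smooth(2) base(1)] by (simp add: base(3))
  have i: "((\<lambda>x. linv (?R x)) has_derivative (\<lambda>a. - rho p x0 a)) (at x0)"
    by (rule has_derivative_compose[OF R]) (simp add: base(2) linv_has_derivative)
  have "((\<lambda>z. Ad G (psi one z) c) has_derivative (\<lambda>a. [a, c]\<^sub>G)) (at (linv (?R x0)))"
    using Ad_has_derivative[of c] by (simp add: base(2) bracket_eq)
  from has_derivative_compose[OF i this]
  have "((\<lambda>x. Ad G (psi one (linv (?R x))) c) has_derivative (\<lambda>a. [c, rho p x0 a]\<^sub>G)) (at x0)"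
    by (simp add: br.minus_left bracket_antisym[of c])
  then have "((\<lambda>x. Ad G (ginv (psi p x)) b) has_derivative (\<lambda>a. [c, rho p x0 a]\<^sub>G)) (at x0)"
  proof (rule has_derivative_transform_within_open[OF _ open_rtrans_dom' base_in_rtrans_dom'[OF x0]])
    fix x assume "x \<in> rtrans_dom' p x0"
    then have "x \<in> rtrans_dom p x0" "?R x \<in> linv_dom" by (auto simp: rtrans_dom'_def)
    then show "Ad G (psi one (linv (?R x))) c = Ad G (ginv (psi p x)) b"
      by (simp add: linv_facts rtrans_facts c_def Ad_Ad)
  qed
  then show ?thesis by (simp add: c_def)
qed

end

section \<open>Forms and maps on trivial bundles over the group\<close>

lemma smooth_on_fst: "open S \<Longrightarrow> smooth_on S f \<Longrightarrow> smooth_on S (\<lambda>x. fst (f x))"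
  by (rule smooth_on_bounded_linear_compose[OF bounded_linear_fst])

lemma smooth_on_snd: "open S \<Longrightarrow> smooth_on S f \<Longrightarrow> smooth_on S (\<lambda>x. snd (f x))"
  by (rule smooth_on_bounded_linear_compose[OF bounded_linear_snd])

lemma smooth_on_ident: "open S \<Longrightarrow> smooth_on S (\<lambda>x. x)"
  by (rule smooth_on_bounded_linear[OF _ bounded_linear_ident])

context lie
begin

abbreviation gv :: "('g \<times> 'w, 'e \<times> 'w) charts" where
  "gv \<equiv> prod_charts C vec_charts"

abbreviation VW :: "'g \<Rightarrow> ('e \<times> 'w) set" where
  "VW p \<equiv> V p \<times> UNIV"

lemma atlas_gv: "atlas (gv :: ('g \<times> 'w::finite_dim, _) charts)"
  by (rule atlas_prod_charts[OF atlas_G atlas_vec_charts])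

lemma cinv_gv: "x \<in> V p \<Longrightarrow> cinv gv (p, w0) (x, w::'w::finite_dim) = (psi p x, w)"
  using cinv_prod[OF atlas_G atlas_vec_charts, of x p w w0] by simp

lemma image_gv: "cmap gv (p, w0) ` cdom gv (p, w0) = (VW p :: ('e \<times> 'w::finite_dim) set)"
  by (simp add: cmap_prod_image)

lemma open_VW: "open (VW p :: ('e \<times> 'w::finite_dim) set)"
  by (intro open_Times open_V open_UNIV)

lemma self_in_VW: "(phi p p, w) \<in> VW p"
  by simp

lemma has_derivative_gv_transform:
  fixes w :: "'w::finite_dim" and f :: "'g \<times> 'w \<Rightarrow> 'b::real_normed_vector"
  assumes "((\<lambda>z. f (psi p (fst z), snd z)) has_derivative f') (at (x, w))" "x \<in> V p"
  shows "((\<lambda>z. f (cinv gv (p, w0) z)) has_derivative f') (at (x, w))"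
  by (rule has_derivative_transform_within_open[OF assms(1) open_VW[of p]]) (use assms(2) in \<open>auto simp: cinv_gv\<close>)

text \<open>For a form that depends on g only through \<open>TRi\<close>, passing to the chart
  around p replaces \<open>TRi\<close> by \<open>rho p\<close>.\<close>

lemma local_form_gv:
  fixes w :: "'w::finite_dim"
  assumes x: "x \<in> V p" and \<omega>: "\<And>g w a u b v. \<omega> (g, w) (a, u) (b, v) = B w (TRi g a, u) (TRi g b, v)"
  shows "local_form gv \<omega> (p, w0) (x, w) (a, u) (b, v) = B w (rho p x a, u) (rho p x b, v)"
proof -
  let ?q = "psi p x" and ?T = "tangent_map vec_charts C (psi p) x"
  have "((\<lambda>y. phi ?q (psi p y)) has_derivative ?T) (at x)"
    using smooth_map_on_has_tangent[OF atlas_vec_charts atlas_G smooth_map_on_cinv[OF atlas_G] open_V x] by simp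
  then have "((\<lambda>z. (phi ?q (psi p (fst z)), snd z)) has_derivative (\<lambda>v. (?T (fst v), snd v))) (at (x, w))"
    by (intro has_derivative_Pair has_derivative_snd has_derivative_ident
      has_derivative_compose[where f=fst and g="\<lambda>y. phi ?q (psi p y)"] has_derivative_fst[OF has_derivative_ident, simplified]) auto
  then have "((\<lambda>z. cmap gv (?q, w) (psi p (fst z), snd z)) has_derivative (\<lambda>v. (?T (fst v), snd v))) (at (x, w))"
    by simp
  from frechet_derivative_eqI[OF has_derivative_gv_transform[OF this x, of w0]]
  show ?thesis
    by (simp add: local_form_def cinv_gv[OF x] comp_def \<omega> rho_eq_TRi[OF x])
qed

text \<open>The one-form \<theta> is evaluated on constant vectors of the chart, so its exterior
  derivative has no bracket term. Closedness then consists of six second derivatives of \<theta>,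
  which cancel in pairs by symmetry. Nondegeneracy passes from B to \<omega> because
  \<open>TRi\<close> is bijective.\<close>

lemma symplectic_gvI:
  fixes B :: "'w::finite_dim \<Rightarrow> 'e \<times> 'w \<Rightarrow> 'e \<times> 'w \<Rightarrow> real" and \<theta> :: "'g \<Rightarrow> 'e \<times> 'w \<Rightarrow> 'e \<times> 'w \<Rightarrow> real"
  assumes \<omega>: "\<And>g w a u b v. \<omega> (g, w) (a, u) (b, v) = B w (TRi g a, u) (TRi g b, v)"
    and bil: "\<And>w. bilinear (B w)" and alt: "\<And>w z. B w z z = 0"
    and nondeg: "\<And>w u. (\<And>v. B w u v = 0) \<Longrightarrow> u = 0"
    and smooth: "\<And>p v. smooth_on (VW p) (\<lambda>z. \<theta> p z v)"
    and exact: "\<And>p x w a u b v. x \<in> V p \<Longrightarrow> B w (rho p x a, u) (rho p x b, v)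
      = frechet_derivative (\<lambda>z. \<theta> p z (b, v)) (at (x, w)) (a, u) - frechet_derivative (\<lambda>z. \<theta> p z (a, u)) (at (x, w)) (b, v)"
  shows "symplectic_form gv \<omega>"
proof -
  let ?D = "\<lambda>p v z. frechet_derivative (\<lambda>z. \<theta> p z v) (at z)"
  have loc: "local_form gv \<omega> (p, w0) z u v = ?D p v z u - ?D p u z v" if "z \<in> VW p" for p w0 z u v
  proof -
    obtain x w a u' b v' where z: "z = (x, w)" "u = (a, u')" "v = (b, v')" by (metis surj_pair)
    have x: "x \<in> V p" using that z by auto
    show ?thesis unfolding z using local_form_gv[where B=B, OF x \<omega>] exact[OF x] by simp
  qed
  have sm: "smooth_on (VW p) (\<lambda>z. ?D p v z u - ?D p u z v)" for p u v
    by (intro smooth_on_diff open_VW smooth_on_frechet_derivative smooth)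
  have loc_sm: "smooth_on (VW p) (\<lambda>z. local_form gv \<omega> (p, w0) z u v)" for p w0 u v
    by (rule smooth_on_cong[OF open_VW _ sm]) (rule loc[symmetric])
  have D: "frechet_derivative (\<lambda>z. local_form gv \<omega> (p, w0) z u v) (at z) t
      = frechet_derivative (\<lambda>z. ?D p v z u) (at z) t - frechet_derivative (\<lambda>z. ?D p u z v) (at z) t"
    if z: "z \<in> VW p" for p w0 u v t z
  proof -
    have "((\<lambda>z. ?D p v z u - ?D p u z v) has_derivative
      (\<lambda>t. frechet_derivative (\<lambda>z. ?D p v z u) (at z) t - frechet_derivative (\<lambda>z. ?D p u z v) (at z) t)) (at z)"
      by (intro has_derivative_diff smooth_on_has_derivative[OF smooth_on_frechet_derivative[OF smooth] z])
    then have "((\<lambda>z. local_form gv \<omega> (p, w0) z u v) has_derivative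
      (\<lambda>t. frechet_derivative (\<lambda>z. ?D p v z u) (at z) t - frechet_derivative (\<lambda>z. ?D p u z v) (at z) t)) (at z)"
      by (rule has_derivative_transform_within_open[OF _ open_VW z]) (rule loc[symmetric])
    from frechet_derivative_eqI[OF this] show ?thesis by simp
  qed
  have sym: "frechet_derivative (\<lambda>z. ?D p v z u) (at z) t = frechet_derivative (\<lambda>z. ?D p v z t) (at z) u"
    if "z \<in> VW p" for p u v t z
    by (rule second_derivative_symmetric[OF smooth open_VW that])
  have lin_T: "linear (\<lambda>z. (TRi g (fst z), snd z))" for g
    using linear_TRi[of g] by (auto simp: linear_iff)
  have om: "\<omega> p u v = B (snd p) (TRi (fst p) (fst u), snd u) (TRi (fst p) (fst v), snd v)" for p u v
    using \<omega>[of "fst p" "snd p" "fst u" "snd u" "fst v" "snd v"] by simp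
  show ?thesis
    unfolding symplectic_form_def
  proof (intro conjI allI ballI impI)
    fix p :: "'g \<times> 'w"
    show "bilinear (\<omega> p)"
      unfolding bilinear_def om
      using linear_compose[OF lin_T, of "\<lambda>u. B (snd p) u _" "fst p"] linear_compose[OF lin_T, of "B (snd p) _" "fst p"]
        bil[of "snd p"] by (simp add: bilinear_def comp_def)
  next
    fix p and u :: "'e \<times> 'w" show "\<omega> p u u = 0" by (simp add: om alt)
  next
    fix p and u :: "'e \<times> 'w" assume "\<forall>v. \<omega> p u v = 0"
    \<comment> \<open>The test vector is moved by \<open>TR G\<close>, so that \<open>TRi\<close>
      gives back an arbitrary v.\<close>
    then have "B (snd p) (TRi (fst p) (fst u), snd u) v = 0" for v
      using spec[of "\<lambda>v. \<omega> p u v = 0" "(TR G (fst p) (fst v), snd v)"] by (simp add: om)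
    then have "(TRi (fst p) (fst u), snd u) = 0" by (rule nondeg)
    then have "TRi (fst p) (fst u) = 0" and s: "snd u = 0" by (auto simp: zero_prod_def)
    then have "TR G (fst p) (TRi (fst p) (fst u)) = 0" using linear_0[OF linear_TR] by simp
    with s show "u = 0" by (simp add: prod_eq_iff)
  next
    fix p :: "'g \<times> 'w" and u v show "smooth_on (cmap gv p ` cdom gv p) (\<lambda>x. local_form gv \<omega> p x u v)"
      using loc_sm[of "fst p" "snd p"] image_gv[of "fst p" "snd p"] by simp
  next
    fix p :: "'g \<times> 'w" and z u v t assume "z \<in> cmap gv p ` cdom gv p"
    then have z: "z \<in> VW (fst p)" using image_gv[of "fst p" "snd p"] by simp
    show "frechet_derivative (\<lambda>x. local_form gv \<omega> p x v t) (at z) u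
      + frechet_derivative (\<lambda>x. local_form gv \<omega> p x t u) (at z) v
      + frechet_derivative (\<lambda>x. local_form gv \<omega> p x u v) (at z) t = 0"
      using D[OF z, of "snd p"] sym[OF z, of v u t] sym[OF z, of u v t] sym[OF z, of t u v] by simp
  qed
qed

section \<open>Tangent maps and smoothness on trivial bundles\<close>

lemma tangent_gv_vec:
  fixes w :: "'w::finite_dim" and f :: "'g \<times> 'w \<Rightarrow> 'b::real_normed_vector"
  assumes "((\<lambda>z. f (psi g (fst z), snd z)) has_derivative f') (at (phi g g, w))"
  shows "tangent_map gv vec_charts f (g, w) = f'"
  using frechet_derivative_eqI[OF has_derivative_gv_transform[OF assms phi_self_in]]
  by (simp add: tangent_map_def comp_def)

text \<open>Such a map covers the identity of G, so source and target use the same chart of the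
  group, and the group component of the tangent map is the identity.\<close>

lemma tangent_gv_gv:
  fixes w :: "'w::finite_dim" and k :: "'g \<Rightarrow> 'w \<Rightarrow> 'v::finite_dim"
  assumes "((\<lambda>z. k (psi g (fst z)) (snd z)) has_derivative k') (at (phi g g, w))"
  shows "tangent_map gv gv (\<lambda>(g, w). (g, k g w)) (g, w) v = (fst v, k' v)"
proof -
  have "((\<lambda>z. (fst z, k (psi g (fst z)) (snd z))) has_derivative (\<lambda>v. (fst v, k' v))) (at (phi g g, w))"
    by (intro has_derivative_Pair assms has_derivative_fst has_derivative_ident)
  then have "((\<lambda>z. cmap gv (g, k g w) (psi g (fst z), k (psi g (fst z)) (snd z))) has_derivative (\<lambda>v. (fst v, k' v))) (at (phi g g, w))"
    by (rule has_derivative_transform_within_open[OF _ open_VW self_in_VW]) auto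
  then have "((\<lambda>z. (\<lambda>q. cmap gv (g, k g w) (fst q, k (fst q) (snd q))) (psi g (fst z), snd z)) has_derivative
      (\<lambda>v. (fst v, k' v))) (at (phi g g, w))" by simp
  from frechet_derivative_eqI[OF has_derivative_gv_transform[OF this phi_self_in, of w]]
  show ?thesis by (simp add: tangent_map_def comp_def case_prod_unfold)
qed

lemma smooth_gv_vec:
  fixes f :: "'g \<times> 'w::finite_dim \<Rightarrow> 'b::finite_dim"
  assumes "\<And>p. smooth_on (VW p) (\<lambda>z. f (psi p (fst z), snd z))"
  shows "smooth_map gv vec_charts f"
proof (rule smooth_mapI[OF atlas_gv atlas_vec_charts])
  fix p :: "'g \<times> 'w"
  obtain g w where p: "p = (g, w)" by fastforce
  show "smooth_map_on vec_charts vec_charts (cmap gv p ` cdom gv p) (\<lambda>x. f (cinv gv p x))"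
    unfolding p image_gv smooth_map_on_vec_iff[OF open_VW]
    by (rule smooth_on_cong[OF open_VW _ assms[of g]]) (auto simp: cinv_gv)
qed

lemma smooth_gv_vecD:
  fixes f :: "'g \<times> 'w::finite_dim \<Rightarrow> 'b::finite_dim"
  assumes "smooth_map gv vec_charts f"
  shows "smooth_on (VW p) (\<lambda>z. f (psi p (fst z), snd z))"
proof -
  have "smooth_on (cmap gv (p, undefined) ` cdom gv (p, undefined)) (\<lambda>x. cmap vec_charts undefined (f (cinv gv (p, undefined) x)))"
    by (rule smooth_map_onD[OF assms]) auto
  then have "smooth_on (VW p) (\<lambda>x. f (cinv gv (p, undefined) x))" unfolding image_gv by simp
  then show ?thesis by (rule smooth_on_cong[OF open_VW, rotated]) (auto simp: cinv_gv)
qed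

lemma smooth_gv_gv:
  fixes k :: "'g \<Rightarrow> 'w::finite_dim \<Rightarrow> 'v::finite_dim"
  assumes "\<And>p. smooth_on (VW p) (\<lambda>z. k (psi p (fst z)) (snd z))"
  shows "smooth_map gv gv (\<lambda>(g, w). (g, k g w))"
proof (rule smooth_mapI[OF atlas_gv atlas_gv])
  fix p :: "'g \<times> 'w"
  obtain g w where p: "p = (g, w)" by fastforce
  have "smooth_map_on vec_charts gv (VW g) (\<lambda>z. (psi g (fst z), k (psi g (fst z)) (snd z)))"
    using assms[of g]
    by (intro smooth_map_on_Pair[OF atlas_vec_charts atlas_G atlas_vec_charts open_VW] smooth_psi_compose open_VW
        smooth_on_fst smooth_on_ident) (auto simp: smooth_map_on_vec_iff[OF open_VW])
  then show "smooth_map_on vec_charts gv (cmap gv p ` cdom gv p) (\<lambda>x. case cinv gv p x of (g, w) \<Rightarrow> (g, k g w))"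
    unfolding p image_gv
    by (rule smooth_map_on_cong[OF atlas_vec_charts atlas_gv open_VW]) (auto simp: cinv_gv)
qed

lemma smooth_vec_gv_gv:
  fixes k :: "'a::finite_dim \<Rightarrow> 'g \<Rightarrow> 'w::finite_dim \<Rightarrow> 'v::finite_dim"
  assumes "\<And>p. smooth_on (UNIV \<times> VW p) (\<lambda>z. k (fst z) (psi p (fst (snd z))) (snd (snd z)))"
  shows "smooth_map (prod_charts vec_charts gv) gv (\<lambda>(a, g, w). (g, k a g w))"
proof (rule smooth_mapI[OF atlas_prod_charts[OF atlas_vec_charts atlas_gv] atlas_gv])
  fix p :: "'a \<times> 'g \<times> 'w"
  obtain a g w where p: "p = (a, g, w)" by (metis prod_cases3)
  let ?W = "UNIV \<times> VW g :: ('a \<times> 'e \<times> 'w) set"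
  have o: "open ?W" by (intro open_Times open_V open_UNIV)
  have "smooth_map_on vec_charts gv ?W (\<lambda>z. (psi g (fst (snd z)), k (fst z) (psi g (fst (snd z))) (snd (snd z))))"
    using assms[of g]
    by (intro smooth_map_on_Pair[OF atlas_vec_charts atlas_G atlas_vec_charts o] smooth_psi_compose o
        smooth_on_fst smooth_on_snd smooth_on_ident) (auto simp: smooth_map_on_vec_iff[OF o])
  moreover have "cinv (prod_charts vec_charts gv) (a, g, w) (a', x, w') = (a', psi g x, w')" if "x \<in> V g" for a' x w'
  proof -
    have "(x, w') \<in> cmap gv (g, w) ` cdom gv (g, w)" unfolding image_gv using that by simp
    from cinv_prod[OF atlas_vec_charts atlas_gv _ this, of a' a] show ?thesis using that by (simp add: cinv_gv)
  qed
  moreover have "cmap (prod_charts vec_charts gv) (a, g, w) ` cdom (prod_charts vec_charts gv) (a, g, w) = ?W"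
    by (simp add: cmap_prod_image)
  ultimately show "smooth_map_on vec_charts gv (cmap (prod_charts vec_charts gv) p ` cdom (prod_charts vec_charts gv) p)
      (\<lambda>x. case cinv (prod_charts vec_charts gv) p x of (a, g, w) \<Rightarrow> (g, k a g w))"
    unfolding p by (auto intro: smooth_map_on_cong[OF atlas_vec_charts atlas_gv o])
qed

subsection \<open>The coadjoint action\<close>

lemma coad_apply [simp]: "\<langle>coad G \<xi> \<mu>, \<eta>\<rangle> = \<langle>\<mu>, [\<xi>, \<eta>]\<^sub>G\<rangle>"
proof -
  have "bounded_linear (\<lambda>\<eta>. \<langle>\<mu>, [\<xi>, \<eta>]\<^sub>G\<rangle>)"
    by (rule bounded_linear_compose[OF blinfun.bounded_linear_right br.bounded_linear_right])
  then show ?thesis by (simp add: coad_def bounded_linear_Blinfun_apply)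
qed

lemma coad_bounded_bilinear: "bounded_bilinear (coad G)"
proof
  obtain K where K: "0 \<le> K" "\<And>a b. norm [a, b]\<^sub>G \<le> norm a * norm b * K" using br.nonneg_bounded by blast
  have "norm (coad G \<xi> \<mu>) \<le> norm \<xi> * norm \<mu> * K" for \<xi> \<mu>
  proof (rule norm_blinfun_bound)
    fix \<eta>
    have "norm \<langle>coad G \<xi> \<mu>, \<eta>\<rangle> \<le> norm \<mu> * norm [\<xi>, \<eta>]\<^sub>G" by (simp add: norm_blinfun del: real_norm_def)
    also have "\<dots> \<le> norm \<mu> * (norm \<xi> * norm \<eta> * K)" by (intro mult_left_mono K) auto
    finally show "norm \<langle>coad G \<xi> \<mu>, \<eta>\<rangle> \<le> norm \<xi> * norm \<mu> * K * norm \<eta>" by (simp add: mult_ac)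
  qed (use K in auto)
  then show "\<exists>K. \<forall>\<xi> \<mu>. norm (coad G \<xi> \<mu>) \<le> norm \<xi> * norm \<mu> * K" by blast
qed (rule blinfun_eqI, simp add: br.add_left br.scaleR_left blinfun.bilinear_simps)+

sublocale co: bounded_bilinear "coad G" by (rule coad_bounded_bilinear)

declare br.zero_left [simp] br.zero_right [simp] co.zero_left [simp] co.zero_right [simp]

lemma bracket_self [simp]: "[a, a]\<^sub>G = 0"
  using bracket_antisym[of a a] by (simp add: eq_neg_iff_add_eq_0 flip: scaleR_2)

lemma jacobi_derivation: "[a, [b, c]\<^sub>G]\<^sub>G = [[a, b]\<^sub>G, c]\<^sub>G + [b, [a, c]\<^sub>G]\<^sub>G"
proof -
  have "[[b, c]\<^sub>G, a]\<^sub>G + ([[a, b]\<^sub>G, c]\<^sub>G + [[c, a]\<^sub>G, b]\<^sub>G) = 0"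
    using jacobi[of a b c] by (simp only: add_ac)
  then have "[[b, c]\<^sub>G, a]\<^sub>G = - ([[a, b]\<^sub>G, c]\<^sub>G + [[c, a]\<^sub>G, b]\<^sub>G)" by (simp only: eq_neg_iff_add_eq_0)
  moreover have "[a, [b, c]\<^sub>G]\<^sub>G = - [[b, c]\<^sub>G, a]\<^sub>G" by (rule bracket_antisym)
  moreover have "[[c, a]\<^sub>G, b]\<^sub>G = [b, [a, c]\<^sub>G]\<^sub>G"
    using bracket_antisym[of "[c, a]\<^sub>G" b] bracket_antisym[of a c] by (simp add: br.minus_right)
  ultimately show ?thesis by simp
qed

subsection \<open>The symplectic forms\<close>

text \<open>The form in terms of \<eta> = \<rho> of the group component and the plain derivatives
  \<alpha>, \<beta>, z of \<mu>, \<nu>, \<xi>, instead of frame coefficients. The \<nu>-term changes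
  sign against the frame formula, since l2 and l2' each contribute one more copy of it.\<close>

definition tt_B :: "'e dual \<times> 'e dual \<times> 'e \<Rightarrow> 'e \<times> 'e dual \<times> 'e dual \<times> 'e \<Rightarrow> 'e \<times> 'e dual \<times> 'e dual \<times> 'e \<Rightarrow> real" where
  "tt_B = (\<lambda>(\<mu>, \<nu>, \<xi>) (\<eta>, \<alpha>, \<beta>, z) (\<eta>', \<alpha>', \<beta>', z').
     \<langle>\<beta>, \<eta>'\<rangle> - \<langle>\<beta>', \<eta>\<rangle> - \<langle>\<nu>, [\<eta>, \<eta>']\<^sub>G\<rangle> + \<langle>\<alpha>, [\<xi>, \<eta>']\<^sub>G - z'\<rangle> - \<langle>\<alpha>', [\<xi>, \<eta>]\<^sub>G - z\<rangle>
     + \<langle>\<mu>, [z, \<eta>']\<^sub>G - [z', \<eta>]\<^sub>G - [\<xi>, [\<eta>, \<eta>']\<^sub>G]\<^sub>G\<rangle>)"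

text \<open>The frame is triangular: \<eta> is read off the group component, then l1 and \<zeta>
  follow, and l2 last because it involves l1.\<close>

lemma tt_frame_the:
  "(THE c. tt_frame G c (g, \<mu>, \<nu>, \<xi>) = (a, \<alpha>, \<beta>, z)) =
    (let \<eta> = TRi g a; l1 = \<alpha> - coad G \<eta> \<mu> in (\<eta>, l1, \<beta> - coad G \<eta> \<nu> + coad G \<xi> l1, z - [\<xi>, \<eta>]\<^sub>G))"
proof (rule the_equality)
  fix c assume c: "tt_frame G c (g, \<mu>, \<nu>, \<xi>) = (a, \<alpha>, \<beta>, z)"
  obtain \<eta> l1 l2 \<zeta> where c': "c = (\<eta>, l1, l2, \<zeta>)" by (metis prod_cases4)
  have "a = TR G g \<eta>" "\<alpha> = l1 + coad G \<eta> \<mu>" "\<beta> = l2 + coad G \<eta> \<nu> - coad G \<xi> l1" "z = \<zeta> + [\<xi>, \<eta>]\<^sub>G"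
    using c unfolding c' tt_frame_def by auto
  then show "c = (let \<eta> = TRi g a; l1 = \<alpha> - coad G \<eta> \<mu> in (\<eta>, l1, \<beta> - coad G \<eta> \<nu> + coad G \<xi> l1, z - [\<xi>, \<eta>]\<^sub>G))"
    unfolding c' Let_def by simp
qed (simp add: tt_frame_def Let_def)

lemma tt_form_eq: "tt_form G (g, w) (a, u) (b, v) = tt_B w (TRi g a, u) (TRi g b, v)"
proof -
  obtain \<mu> \<nu> \<xi> \<alpha> \<beta> z \<alpha>' \<beta>' z' where w: "w = (\<mu>, \<nu>, \<xi>)" "u = (\<alpha>, \<beta>, z)" "v = (\<alpha>', \<beta>', z')"
    by (metis prod_cases3)
  define \<eta> where "\<eta> = TRi g a"
  define \<eta>' where "\<eta>' = TRi g b"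
  \<comment> \<open>The only double brackets come from substituting l1 and l1' into
    \<open>coad G \<xi> l1\<close> and its counterpart. The Jacobi identity merges these two into
    the single one of \<open>tt_B\<close>.\<close>
  have J: "[\<eta>, [\<xi>, \<eta>']\<^sub>G]\<^sub>G = [\<eta>', [\<xi>, \<eta>]\<^sub>G]\<^sub>G + [\<xi>, [\<eta>, \<eta>']\<^sub>G]\<^sub>G"
    using jacobi_derivation[of \<xi> \<eta> \<eta>'] bracket_antisym[of "[\<xi>, \<eta>]\<^sub>G" \<eta>'] by simp
  have *: "[\<eta>, \<xi>]\<^sub>G = - [\<xi>, \<eta>]\<^sub>G" "[\<eta>', \<xi>]\<^sub>G = - [\<xi>, \<eta>']\<^sub>G" "[\<eta>', \<eta>]\<^sub>G = - [\<eta>, \<eta>']\<^sub>G"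
    "[z, \<eta>']\<^sub>G = - [\<eta>', z]\<^sub>G" "[z', \<eta>]\<^sub>G = - [\<eta>, z']\<^sub>G"
    by (rule bracket_antisym)+
  show ?thesis
    unfolding w tt_form_def form_of_frame_def tt_frame_the tt_B_def Let_def \<eta>_def[symmetric] \<eta>'_def[symmetric]
    by (simp add: blinfun.bilinear_simps br.diff_right br.minus_right J *)
qed

lemma tt_B_bilinear: "bilinear (tt_B w)"
  unfolding bilinear_def linear_iff tt_B_def
  by (auto simp: blinfun.bilinear_simps br.add_left br.add_right br.scaleR_left br.scaleR_right
      case_prod_unfold algebra_simps)

text \<open>A triangular system: testing with the components \<beta>', \<alpha>', z', \<eta>' of v
  in this order eliminates \<eta>, z, \<alpha>, \<beta> in turn.\<close>

lemma tt_B_nondegenerate: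
  assumes "\<And>v. tt_B w u v = 0"
  shows "u = 0"
proof -
  obtain \<mu> \<nu> \<xi> \<eta> \<alpha> \<beta> z where w: "w = (\<mu>, \<nu>, \<xi>)" "u = (\<eta>, \<alpha>, \<beta>, z)" by (metis prod_cases3 prod_cases4)
  have sep: "x = 0" if "\<And>l::'e dual. \<langle>l, x\<rangle> = 0" for x :: 'e
    using that[of "blinfun_inner_left x"] by simp
  note B = assms[unfolded w]
  have "\<langle>l, \<eta>\<rangle> = 0" for l using B[of "(0, 0, l, 0)"] by (simp add: tt_B_def)
  then have \<eta>: "\<eta> = 0" by (rule sep)
  have "\<langle>l, z\<rangle> = 0" for l using B[of "(0, l, 0, 0)"] by (simp add: tt_B_def \<eta> blinfun.bilinear_simps)
  then have z: "z = 0" by (rule sep)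
  have \<alpha>: "\<alpha> = 0" using B[of "(0, 0, 0, _)"] by (intro blinfun_eqI) (simp add: tt_B_def \<eta> z blinfun.bilinear_simps)
  have \<beta>: "\<beta> = 0" using B[of "(_, 0, 0, 0)"] by (intro blinfun_eqI) (simp add: tt_B_def \<eta> z \<alpha> blinfun.bilinear_simps)
  show ?thesis by (simp add: w \<eta> \<alpha> \<beta> z zero_prod_def)
qed

lemma tt_charts_eq: "tt_charts G = gv"
  by (simp add: tt_charts_def prod_vec_charts)

lemma cot_charts_eq: "cot_charts G = gv"
  by (simp add: cot_charts_def)

lemma red_charts_eq: "red_charts G = gv"
  by (simp add: red_charts_def prod_vec_charts)

lemma smooth_rho_fst: "smooth_on (VW p :: ('e \<times> 'w::finite_dim) set) (\<lambda>z. rho p (fst z) a)"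
  by (rule smooth_on_compose[OF smooth_rho open_V smooth_on_fst[OF open_VW smooth_on_ident[OF open_VW]] open_VW]) auto

lemma rho_fst_has_derivative:
  assumes "x \<in> V p"
  shows "((\<lambda>z. rho p (fst z) a) has_derivative (\<lambda>v. frechet_derivative (\<lambda>x. rho p x a) (at x) (fst v))) (at (x, w))"
  by (rule has_derivative_compose[where f=fst and g="\<lambda>x. rho p x a"])
    (use smooth_on_has_derivative[OF smooth_rho assms] in \<open>auto intro: has_derivative_fst[OF has_derivative_ident]\<close>)

lemma symplectic_tt: "symplectic_form (tt_charts G) (tt_form G)"
  unfolding tt_charts_eq
proof (rule symplectic_gvI[where B=tt_B and \<theta>="\<lambda>p z v. \<langle>fst (snd (snd z)), rho p (fst z) (fst v)\<rangle>
    + \<langle>fst (snd z), [snd (snd (snd z)), rho p (fst z) (fst v)]\<^sub>G - snd (snd (snd v))\<rangle>", OF tt_form_eq tt_B_bilinear])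
  show "tt_B w z z = 0" for w z
    by (auto simp: tt_B_def case_prod_unfold)
  show "(\<And>v. tt_B w u v = 0) \<Longrightarrow> u = 0" for w u by (rule tt_B_nondegenerate)
next
  fix p and v :: "'e \<times> 'e dual \<times> 'e dual \<times> 'e"
  show "smooth_on (VW p) (\<lambda>z. \<langle>fst (snd (snd z)), rho p (fst z) (fst v)\<rangle>
    + \<langle>fst (snd z), [snd (snd (snd z)), rho p (fst z) (fst v)]\<^sub>G - snd (snd (snd v))\<rangle>)"
    by (intro smooth_on_add smooth_on_diff smooth_on_const smooth_on_bounded_bilinear[OF bounded_bilinear_blinfun_apply]
      smooth_on_bounded_bilinear[OF br.bounded_bilinear_axioms] smooth_on_fst smooth_on_snd smooth_on_ident smooth_rho_fst open_VW)
next
  fix p x a b and w :: "'e dual \<times> 'e dual \<times> 'e" and u v :: "'e dual \<times> 'e dual \<times> 'e"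
  assume x: "x \<in> V p"
  obtain \<mu> \<nu> \<xi> \<alpha> \<beta> z \<alpha>' \<beta>' z' where w: "w = (\<mu>, \<nu>, \<xi>)" "u = (\<alpha>, \<beta>, z)" "v = (\<alpha>', \<beta>', z')"
    by (metis prod_cases3)
  let ?\<theta> = "\<lambda>v z. \<langle>fst (snd (snd z)), rho p (fst z) (fst v)\<rangle>
    + \<langle>fst (snd z), [snd (snd (snd z)), rho p (fst z) (fst v)]\<^sub>G - snd (snd (snd v))\<rangle>"
  let ?D = "\<lambda>b a. frechet_derivative (\<lambda>x. rho p x b) (at x) a"
  have D: "frechet_derivative (?\<theta> (b, \<alpha>', \<beta>', z')) (at (x, w)) (a, \<alpha>, \<beta>, z)
    = \<langle>\<beta>, rho p x b\<rangle> + \<langle>\<nu>, ?D b a\<rangle> + \<langle>\<alpha>, [\<xi>, rho p x b]\<^sub>G - z'\<rangle> + \<langle>\<mu>, [z, rho p x b]\<^sub>G + [\<xi>, ?D b a]\<^sub>G\<rangle>"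
    for a b \<alpha> \<beta> z \<alpha>' \<beta>' z'
  proof -
    have "(?\<theta> (b, \<alpha>', \<beta>', z') has_derivative (\<lambda>t. \<langle>fst (snd (snd t)), rho p x b\<rangle> + \<langle>\<nu>, ?D b (fst t)\<rangle>
        + \<langle>fst (snd t), [\<xi>, rho p x b]\<^sub>G - z'\<rangle> + \<langle>\<mu>, [snd (snd (snd t)), rho p x b]\<^sub>G + [\<xi>, ?D b (fst t)]\<^sub>G\<rangle>)) (at (x, w))"
      by (rule has_derivative_eq_rhs, (rule has_derivative_add has_derivative_diff has_derivative_const
          bounded_bilinear.FDERIV[OF bounded_bilinear_blinfun_apply] br.FDERIV has_derivative_fst has_derivative_snd
          has_derivative_ident rho_fst_has_derivative[OF x])+) (auto simp: w blinfun.bilinear_simps algebra_simps)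
    from frechet_derivative_eqI[OF this] show ?thesis by simp
  qed
  have MC: "?D b a = ?D a b - [rho p x a, rho p x b]\<^sub>G"
    using maurer_cartan[OF x, of b a] by (simp add: algebra_simps)
  show "tt_B w (rho p x a, u) (rho p x b, v) = frechet_derivative (?\<theta> (b, v)) (at (x, w)) (a, u) - frechet_derivative (?\<theta> (a, u)) (at (x, w)) (b, v)"
    unfolding w(2,3) D MC by (simp add: w tt_B_def blinfun.bilinear_simps br.diff_right)
qed

text \<open>Equal to \<open>tt_B (0, \<mu>, 0)\<close> on vectors of the form
  \<open>(\<eta>, 0, \<alpha>, 0)\<close>. As there, \<alpha> is the plain derivative of the fibre
  coordinate, which reverses the sign of the bracket term of the frame formula.\<close>

definition cot_B :: "'e dual \<Rightarrow> 'e \<times> 'e dual \<Rightarrow> 'e \<times> 'e dual \<Rightarrow> real" where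
  "cot_B = (\<lambda>\<mu> (\<eta>, \<alpha>) (\<eta>', \<alpha>'). \<langle>\<alpha>, \<eta>'\<rangle> - \<langle>\<alpha>', \<eta>\<rangle> - \<langle>\<mu>, [\<eta>, \<eta>']\<^sub>G\<rangle>)"

lemma cot_frame_the:
  "(THE c. cot_frame G c (g, \<mu>) = (a, \<alpha>)) = (TRi g a, \<alpha> - coad G (TRi g a) \<mu>)"
proof (rule the_equality)
  fix c assume c: "cot_frame G c (g, \<mu>) = (a, \<alpha>)"
  then show "c = (TRi g a, \<alpha> - coad G (TRi g a) \<mu>)"
    by (cases c) (auto simp: cot_frame_def)
qed (simp add: cot_frame_def)

lemma cot_form_eq: "cot_form G (g, w) (a, u) (b, v) = cot_B w (TRi g a, u) (TRi g b, v)"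
  unfolding cot_form_def form_of_frame_def cot_frame_the cot_B_def
  using bracket_antisym[of "TRi g b" "TRi g a"] by (simp add: blinfun.bilinear_simps)

lemma cot_B_bilinear: "bilinear (cot_B w)"
  unfolding bilinear_def linear_iff cot_B_def
  by (auto simp: blinfun.bilinear_simps br.add_left br.add_right br.scaleR_left br.scaleR_right
      case_prod_unfold algebra_simps)

lemma symplectic_cot: "symplectic_form (cot_charts G) (cot_form G)"
  unfolding cot_charts_eq
proof (rule symplectic_gvI[where B=cot_B and \<theta>="\<lambda>p z v. \<langle>snd z, rho p (fst z) (fst v)\<rangle>", OF cot_form_eq cot_B_bilinear])
  show "cot_B w z z = 0" for w z
    by (auto simp: cot_B_def case_prod_unfold)
next
  fix w u assume B: "\<And>v. cot_B w u v = 0"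
  obtain \<eta> \<alpha> where u: "u = (\<eta>, \<alpha>)" by fastforce
  have "\<langle>l, \<eta>\<rangle> = 0" for l using B[of "(0, l)"] by (simp add: cot_B_def u)
  from this[of "blinfun_inner_left \<eta>"] have \<eta>: "\<eta> = 0" by simp
  have "\<alpha> = 0" using B[of "(_, 0)"] by (intro blinfun_eqI) (simp add: cot_B_def u \<eta>)
  with \<eta> show "u = 0" by (simp add: u zero_prod_def)
next
  fix p and v :: "'e \<times> 'e dual"
  show "smooth_on (VW p) (\<lambda>z. \<langle>snd z, rho p (fst z) (fst v)\<rangle>)"
    by (intro smooth_on_bounded_bilinear[OF bounded_bilinear_blinfun_apply] smooth_on_snd smooth_on_ident smooth_rho_fst open_VW)
next
  fix p x a b and w u v :: "'e dual"
  assume x: "x \<in> V p"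
  let ?D = "\<lambda>b a. frechet_derivative (\<lambda>x. rho p x b) (at x) a"
  have D: "frechet_derivative (\<lambda>z. \<langle>snd z, rho p (fst z) (fst (b, v))\<rangle>) (at (x, w)) (a, u) = \<langle>u, rho p x b\<rangle> + \<langle>w, ?D b a\<rangle>"
    for a b u v
  proof -
    have "((\<lambda>z. \<langle>snd z, rho p (fst z) (fst (b, v))\<rangle>) has_derivative (\<lambda>t. \<langle>snd t, rho p x b\<rangle> + \<langle>w, ?D b (fst t)\<rangle>)) (at (x, w))"
      by (rule has_derivative_eq_rhs, (rule bounded_bilinear.FDERIV[OF bounded_bilinear_blinfun_apply] has_derivative_snd
          has_derivative_ident rho_fst_has_derivative[OF x])+) auto
    from frechet_derivative_eqI[OF this] show ?thesis by simp
  qed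
  have MC: "?D b a = ?D a b - [rho p x a, rho p x b]\<^sub>G"
    using maurer_cartan[OF x, of b a] by (simp add: algebra_simps)
  show "cot_B w (rho p x a, u) (rho p x b, v)
    = frechet_derivative (\<lambda>z. \<langle>snd z, rho p (fst z) (fst (b, v))\<rangle>) (at (x, w)) (a, u)
    - frechet_derivative (\<lambda>z. \<langle>snd z, rho p (fst z) (fst (a, u))\<rangle>) (at (x, w)) (b, v)"
    unfolding D MC by (simp add: cot_B_def blinfun.bilinear_simps)
qed

end

section \<open>Orbit spaces\<close>

text \<open>A map that is constant on orbits and separates them induces an injection of the orbit
  space. The set S allows for the level sets of the momentum map.\<close>

lemma orbit_space_bij:
  fixes act :: "'a::ab_group_add \<Rightarrow> 'm \<Rightarrow> 'm"
  assumes act: "\<And>p. act 0 p = p" "\<And>a b p. act (a + b) p = act a (act b p)"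
    and inv: "\<And>a p. p \<in> S \<Longrightarrow> \<pi> (act a p) = \<pi> p"
    and sep: "\<And>p q. p \<in> S \<Longrightarrow> q \<in> S \<Longrightarrow> \<pi> p = \<pi> q \<Longrightarrow> \<exists>a. q = act a p"
    and surj: "\<pi> ` S = UNIV"
  shows "\<exists>\<Phi>. bij_betw \<Phi> (orbit act ` S) UNIV \<and> (\<forall>p\<in>S. \<Phi> (orbit act p) = \<pi> p)"
proof -
  \<comment> \<open>The choice of representative is harmless: points of S with the same orbit have
    the same value under \<pi>.\<close>
  define \<Phi> where "\<Phi> = (\<lambda>X. \<pi> (SOME p. p \<in> S \<and> orbit act p = X))"
  have same: "\<pi> p = \<pi> q" if pq: "p \<in> S" "q \<in> S" "orbit act p = orbit act q" for p q
  proof -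
    have "act 0 q \<in> orbit act p" unfolding pq(3) unfolding orbit_def by (rule rangeI)
    then obtain a where "q = act a p" unfolding act(1) orbit_def by (elim rangeE)
    then show ?thesis by (simp only: inv[OF pq(1)])
  qed
  have \<Phi>: "\<Phi> (orbit act p) = \<pi> p" if p: "p \<in> S" for p
  proof -
    have "(SOME q. q \<in> S \<and> orbit act q = orbit act p) \<in> S \<and> orbit act (SOME q. q \<in> S \<and> orbit act q = orbit act p) = orbit act p"
      by (rule someI[of _ p]) (use p in simp)
    then show ?thesis unfolding \<Phi>_def by (intro same p) simp_all
  qed
  have orb: "orbit act (act a p) = orbit act p" for a p
  proof -
    have "act b p \<in> range (\<lambda>b. act (b + a) p)" for b
      by (rule range_eqI[of _ _ "b - a"]) simp
    then have "range (\<lambda>b. act (b + a) p) = range (\<lambda>b. act b p)" by blast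
    then show ?thesis by (simp add: orbit_def act(2))
  qed
  have "inj_on \<Phi> (orbit act ` S)"
  proof (rule inj_onI, elim imageE)
    fix X Y p q assume *: "\<Phi> X = \<Phi> Y" "X = orbit act p" "p \<in> S" "Y = orbit act q" "q \<in> S"
    then have "\<pi> p = \<pi> q" by (simp add: \<Phi>)
    from sep[OF *(3,5) this] obtain a where "q = act a p" by (elim exE)
    then show "X = Y" by (simp only: *(2,4) orb)
  qed
  moreover have "\<Phi> ` orbit act ` S = UNIV" unfolding surj[symmetric] image_image by (rule image_cong[OF refl \<Phi>])
  ultimately show ?thesis using \<Phi> unfolding bij_betw_def by blast
qed

text \<open>Nondegeneracy of \<omega> gives the uniqueness that the \<open>THE\<close> in
  \<open>hamiltonian_vf\<close> asks for.\<close>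

lemma hamiltonian_vf_eqI:
  assumes sf: "symplectic_form C \<omega>" and X: "\<And>v. \<omega> p X v = - differential C H p v"
  shows "hamiltonian_vf C \<omega> H p = X"
  unfolding hamiltonian_vf_def
proof (rule the_equality)
  fix Y assume Y: "\<forall>v. \<omega> p Y v = - differential C H p v"
  have "bilinear (\<omega> p)" and nondeg: "\<And>u. (\<forall>v. \<omega> p u v = 0) \<Longrightarrow> u = 0"
    using sf unfolding symplectic_form_def by auto
  then have lin: "linear (\<lambda>u. \<omega> p u v)" for v by (simp add: bilinear_def)
  have "\<omega> p (Y - X) v = 0" for v
    using linear_diff[OF lin, of Y X v] X[of v] Y by simp
  then have "Y - X = 0" using nondeg by blast
  then show "Y = X" by simp
qed (use X in blast)

context lie
begin

section \<open>The action and its momentum map\<close>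

lemma tt_action_simp [simp]: "tt_action G l (g, \<mu>, \<nu>, \<xi>) = (g, l + \<mu>, \<nu> - coad G \<xi> l, \<xi>)"
  by (simp add: tt_action_def)

lemma tt_action_0: "tt_action G 0 p = p"
  by (cases p) simp

lemma tt_action_add: "tt_action G (a + b) p = tt_action G a (tt_action G b p)"
  by (cases p) (simp add: co.add_right)

lemma tt_action_eq: "tt_action G l = (\<lambda>(g, w). (g, (\<lambda>(\<mu>, \<nu>, \<xi>). (l + \<mu>, \<nu> - coad G \<xi> l, \<xi>)) w))"
  by (auto simp: fun_eq_iff)

lemma tangent_tt_action:
  "tangent_map gv gv (tt_action G l) (g, \<mu>, \<nu>, \<xi>) (a, \<alpha>, \<beta>, z) = (a, \<alpha>, \<beta> - coad G z l, z)"
proof -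
  have "((\<lambda>q. (\<lambda>(\<mu>, \<nu>, \<xi>). (l + \<mu>, \<nu> - coad G \<xi> l, \<xi>)) (snd q)) has_derivative
    (\<lambda>v. (fst (snd v), fst (snd (snd v)) - coad G (snd (snd (snd v))) l, snd (snd (snd v))))) (at (phi g g, \<mu>, \<nu>, \<xi>))"
    unfolding case_prod_unfold
    by (rule has_derivative_eq_rhs, (rule has_derivative_Pair has_derivative_add has_derivative_diff has_derivative_fst
      has_derivative_snd has_derivative_ident has_derivative_const co.FDERIV)+) auto
  from tangent_gv_gv[where k="\<lambda>g. \<lambda>(\<mu>, \<nu>, \<xi>). (l + \<mu>, \<nu> - coad G \<xi> l, \<xi>)", OF this, of "(a, \<alpha>, \<beta>, z)"]
  show ?thesis by (simp add: tt_action_eq)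
qed

lemma symplectic_tt_action: "symplectic_action (tt_charts G) (tt_form G) (tt_action G)"
  unfolding tt_charts_eq symplectic_action_def
proof (intro conjI allI)
  show "smooth_map (prod_charts vec_charts gv) gv (\<lambda>(a, p). tt_action G a p)"
  proof -
    have "smooth_on (UNIV \<times> VW p) (\<lambda>z. (fst z + fst (snd (snd z)), fst (snd (snd (snd z))) - coad G (snd (snd (snd (snd z)))) (fst z),
        snd (snd (snd (snd z)))) :: 'e dual \<times> 'e dual \<times> 'e)" for p
      by (intro smooth_on_Pair smooth_on_add smooth_on_diff smooth_on_bounded_bilinear[OF coad_bounded_bilinear]
        smooth_on_fst smooth_on_snd smooth_on_ident open_Times open_V open_UNIV)
    from smooth_vec_gv_gv[where k="\<lambda>l g (\<mu>, \<nu>, \<xi>). (l + \<mu>, \<nu> - coad G \<xi> l, \<xi>)", unfolded case_prod_unfold, OF this]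
    show ?thesis by (simp add: case_prod_unfold tt_action_def)
  qed
next
  fix l and p :: "('g, 'e) tt" and u v :: "'e \<times> 'e dual \<times> 'e dual \<times> 'e"
  obtain g \<mu> \<nu> \<xi> where p: "p = (g, \<mu>, \<nu>, \<xi>)" by (metis prod_cases4)
  obtain a \<alpha> \<beta> z where u: "u = (a, \<alpha>, \<beta>, z)" by (metis prod_cases4)
  obtain b \<alpha>' \<beta>' z' where v: "v = (b, \<alpha>', \<beta>', z')" by (metis prod_cases4)
  \<comment> \<open>The shift of \<mu> by l produces three new terms in \<open>tt_B\<close>. Those
    with z and z' cancel against the shifts of \<beta> and \<beta>' by \<open>coad G z l\<close> and
    \<open>coad G z' l\<close>, the double bracket against the shift of \<nu> by
    \<open>coad G \<xi> l\<close>.\<close>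
  show "tt_form G (tt_action G l p) (tangent_map gv gv (tt_action G l) p u) (tangent_map gv gv (tt_action G l) p v) = tt_form G p u v"
    by (simp add: p u v tangent_tt_action tt_form_eq tt_B_def blinfun.bilinear_simps)
qed (simp_all add: tt_action_0 tt_action_add)

lemma tangent_momentum: "tangent_map gv vec_charts (tt_momentum :: ('g, 'e) tt \<Rightarrow> 'e) (g, \<mu>, \<nu>, \<xi>) (a, \<alpha>, \<beta>, z) = z"
proof -
  have "((\<lambda>q. (tt_momentum :: ('g, 'e) tt \<Rightarrow> 'e) (psi g (fst q), snd q)) has_derivative (\<lambda>v. snd (snd (snd v)))) (at (phi g g, \<mu>, \<nu>, \<xi>))"
    unfolding tt_momentum_def case_prod_unfold snd_conv fst_conv
    by (intro has_derivative_snd has_derivative_ident)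
  from tangent_gv_vec[OF this] show ?thesis by simp
qed

lemma momentum_tt: "momentum_map (tt_charts G) (tt_form G) (tt_action G) tt_momentum"
  unfolding tt_charts_eq momentum_map_def
proof (intro conjI allI)
  show "smooth_map gv vec_charts (tt_momentum :: ('g, 'e) tt \<Rightarrow> 'e)"
    by (rule smooth_gv_vec) (unfold tt_momentum_def case_prod_unfold snd_conv fst_conv, intro smooth_on_snd smooth_on_ident open_VW)
next
  fix l and p :: "('g, 'e) tt" show "tt_momentum (tt_action G l p) = tt_momentum p"
    by (cases p) (simp add: tt_momentum_def)
next
  fix l and p :: "('g, 'e) tt" and v :: "'e \<times> 'e dual \<times> 'e dual \<times> 'e"
  obtain g \<mu> \<nu> \<xi> where p: "p = (g, \<mu>, \<nu>, \<xi>)" by (metis prod_cases4)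
  obtain b \<alpha>' \<beta>' z' where v: "v = (b, \<alpha>', \<beta>', z')" by (metis prod_cases4)
  have "((\<lambda>k. cmap gv (tt_action G 0 p) (tt_action G k p)) has_derivative (\<lambda>l. (0, l, - coad G \<xi> l, 0))) (at 0)"
    unfolding p tt_action_simp cmap_prod vec_charts_simps
    by (rule has_derivative_eq_rhs, (rule has_derivative_Pair has_derivative_add has_derivative_diff
      has_derivative_ident has_derivative_const co.FDERIV)+) auto
  from frechet_derivative_eqI[OF this]
  have gen: "tangent_map vec_charts gv (\<lambda>k. tt_action G k p) 0 l = (0, l, - coad G \<xi> l, 0)"
    by (simp add: tangent_map_def comp_def)
  have "((\<lambda>q. \<langle>l, tt_momentum (psi g (fst q), snd q)\<rangle>) has_derivative (\<lambda>v. \<langle>l, snd (snd (snd v))\<rangle>)) (at (phi g g, \<mu>, \<nu>, \<xi>))"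
    unfolding tt_momentum_def case_prod_unfold snd_conv fst_conv
    by (rule has_derivative_eq_rhs, (rule bounded_bilinear.FDERIV[OF bounded_bilinear_blinfun_apply]
      has_derivative_const has_derivative_snd has_derivative_ident)+) (simp add: blinfun.bilinear_simps)
  from tangent_gv_vec[where f="\<lambda>q. \<langle>l, tt_momentum q\<rangle>", OF this]
  have D: "differential gv (\<lambda>q. \<langle>l, tt_momentum q\<rangle>) p v = \<langle>l, z'\<rangle>" by (simp add: p v)
  \<comment> \<open>The \<nu>-component of the generator cancels the bracket paired with its
    \<mu>-component; only - \<langle>l, z'\<rangle> is left.\<close>
  show "tt_form G p (tangent_map vec_charts gv (\<lambda>k. tt_action G k p) 0 l) v = - differential gv (\<lambda>q. \<langle>l, tt_momentum q\<rangle>) p v"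
    unfolding gen D
    by (simp add: p v tt_form_eq linear_0[OF linear_TRi] tt_B_def blinfun.bilinear_simps)
qed

section \<open>Symplectic reduction\<close>

text \<open>The new fibre coordinate is the value of \<nu> where the orbit meets \<mu> = 0. Since
  \<xi> is a parameter and not the last coordinate of the point, the map is defined off the level
  set too and serves as a global extension F.\<close>

definition mw_map :: "'e \<Rightarrow> ('g, 'e) tt \<Rightarrow> 'g \<times> 'e dual" where
  "mw_map \<xi> = (\<lambda>(g, \<mu>, \<nu>, _). (g, \<nu> + coad G \<xi> \<mu>))"

lemma mw_map_eq: "mw_map \<xi> = (\<lambda>(g, w). (g, (\<lambda>(\<mu>, \<nu>, _). \<nu> + coad G \<xi> \<mu>) w))"
  by (auto simp: mw_map_def fun_eq_iff)

lemma tangent_mw_map: "tangent_map gv gv (mw_map \<xi>) (g, w) (a, \<alpha>, \<beta>, z) = (a, \<beta> + coad G \<xi> \<alpha>)"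
proof -
  have "((\<lambda>q. (\<lambda>(\<mu>, \<nu>, _). \<nu> + coad G \<xi> \<mu>) (snd q)) has_derivative
    (\<lambda>v. fst (snd (snd v)) + coad G \<xi> (fst (snd v)))) (at (phi g g, w))"
    unfolding case_prod_unfold
    by (rule has_derivative_eq_rhs, (rule has_derivative_add has_derivative_fst
      has_derivative_snd has_derivative_ident has_derivative_const co.FDERIV)+) auto
  from tangent_gv_gv[where k="\<lambda>g. \<lambda>(\<mu>, \<nu>, _). \<nu> + coad G \<xi> \<mu>", OF this, of "(a, \<alpha>, \<beta>, z)"]
  show ?thesis by (simp add: mw_map_eq)
qed

lemma smooth_mw_map: "smooth_map gv gv (mw_map \<xi>)"
  unfolding mw_map_eq
  by (rule smooth_gv_gv) (unfold case_prod_unfold, intro smooth_on_add smooth_on_bounded_bilinear[OF coad_bounded_bilinear]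
    smooth_on_fst smooth_on_snd smooth_on_ident smooth_on_const open_VW)

lemma symplectic_reduction:
  "\<exists>\<Phi>. symplectic_reduction_iso (tt_charts G) (tt_form G) (tt_action G) tt_momentum \<xi> (cot_charts G) (cot_form G) \<Phi>"
proof -
  let ?S = "tt_momentum -` {\<xi>} :: ('g, 'e) tt set"
  have S: "p \<in> ?S \<longleftrightarrow> (\<exists>g \<mu> \<nu>. p = (g, \<mu>, \<nu>, \<xi>))" for p
    by (cases p) (auto simp: tt_momentum_def)
  have "\<exists>\<Phi>. bij_betw \<Phi> (orbit (tt_action G) ` ?S) UNIV \<and> (\<forall>p\<in>?S. \<Phi> (orbit (tt_action G) p) = mw_map \<xi> p)"
  proof (rule orbit_space_bij[OF tt_action_0 tt_action_add])
    show "mw_map \<xi> (tt_action G l p) = mw_map \<xi> p" if "p \<in> ?S" for l p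
      using that unfolding S by (auto simp: mw_map_def co.add_right)
    show "\<exists>l. q = tt_action G l p" if pq: "p \<in> ?S" "q \<in> ?S" "mw_map \<xi> p = mw_map \<xi> q" for p q
    proof -
      obtain g \<mu> \<nu> g' \<mu>' \<nu>' where *: "p = (g, \<mu>, \<nu>, \<xi>)" "q = (g', \<mu>', \<nu>', \<xi>)" using pq(1,2) S by metis
      \<comment> \<open>The action translates \<mu>, which fixes the group element; equality under
        \<open>mw_map\<close> then says that \<nu> agrees as well.\<close>
      have "q = tt_action G (\<mu>' - \<mu>) p"
        using pq(3) unfolding * by (auto simp: mw_map_def co.diff_right algebra_simps)
      then show ?thesis ..
    qed
    have "mw_map \<xi> (g, 0, \<nu>, \<xi>) = (g, \<nu>)" for g \<nu> by (simp add: mw_map_def)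
    moreover have "(g, 0, \<nu>, \<xi>) \<in> ?S" for g \<nu> by (simp add: tt_momentum_def)
    ultimately show "mw_map \<xi> ` ?S = UNIV" by (metis UNIV_eq_I imageI surj_pair)
  qed
  then obtain \<Phi> where \<Phi>: "bij_betw \<Phi> (orbit (tt_action G) ` ?S) UNIV"
    "\<And>p. p \<in> ?S \<Longrightarrow> \<Phi> (orbit (tt_action G) p) = mw_map \<xi> p" by blast
  have "symplectic_reduction_iso gv (tt_form G) (tt_action G) tt_momentum \<xi> gv (cot_form G) \<Phi>"
    unfolding symplectic_reduction_iso_def
  proof (intro conjI ballI)
    fix p :: "('g, 'e) tt"
    obtain g \<mu> \<nu> \<xi>' where p: "p = (g, \<mu>, \<nu>, \<xi>')" by (metis prod_cases4)
    show "surj (tangent_map gv vec_charts tt_momentum p)"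
      unfolding p by (rule surjI[of _ "\<lambda>z. (0, 0, 0, z)"]) (simp add: tangent_momentum)
  next
    show "bij_betw \<Phi> (orbit (tt_action G) ` ?S) UNIV" by (rule \<Phi>(1))
  next
    fix p :: "('g, 'e) tt" assume "p \<in> ?S"
    have fibre: "tangent_map gv gv (mw_map \<xi>) q ` {u. tangent_map gv vec_charts tt_momentum q u = 0} = UNIV" for q
    proof (rule UNIV_eq_I[symmetric])
      fix y :: "'e \<times> 'e dual"
      obtain g \<mu> \<nu> \<xi>' where q: "q = (g, \<mu>, \<nu>, \<xi>')" by (metis prod_cases4)
      show "y \<in> tangent_map gv gv (mw_map \<xi>) q ` {u. tangent_map gv vec_charts tt_momentum q u = 0}"
        unfolding q by (rule image_eqI[of _ _ "(fst y, 0, snd y, 0)"]) (simp_all add: tangent_mw_map tangent_momentum)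
    qed
    have form: "cot_form G (mw_map \<xi> q) (tangent_map gv gv (mw_map \<xi>) q u) (tangent_map gv gv (mw_map \<xi>) q v) = tt_form G q u v"
      if "q \<in> ?S" "tangent_map gv vec_charts tt_momentum q u = 0" "tangent_map gv vec_charts tt_momentum q v = 0" for q u v
    proof -
      obtain g \<mu> \<nu> where q: "q = (g, \<mu>, \<nu>, \<xi>)" using \<open>q \<in> ?S\<close> S by metis
      obtain a \<alpha> \<beta> z where u: "u = (a, \<alpha>, \<beta>, z)" by (metis prod_cases4)
      obtain b \<alpha>' \<beta>' z' where v: "v = (b, \<alpha>', \<beta>', z')" by (metis prod_cases4)
      have z: "z = 0" "z' = 0" using that by (simp_all add: q u v tangent_momentum)
      \<comment> \<open>With z = z' = 0, the \<alpha>- and \<mu>-terms of \<open>tt_B\<close> are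
        exactly those that arise in \<open>cot_B\<close> from \<beta> +
        \<open>coad G \<xi> \<alpha>\<close> and \<nu> + \<open>coad G \<xi> \<mu>\<close>.\<close>
      show ?thesis
        unfolding q u v tangent_mw_map
        by (simp add: mw_map_def z cot_form_eq tt_form_eq cot_B_def tt_B_def blinfun.bilinear_simps)
    qed
    show "\<exists>U F. open U \<and> p \<in> U \<and> smooth_map_on gv gv U F \<and>
        (\<forall>q\<in>U \<inter> ?S. F q = \<Phi> (orbit (tt_action G) q) \<and>
           tangent_map gv gv F q ` {u. tangent_map gv vec_charts tt_momentum q u = 0} = UNIV \<and>
           (\<forall>u v. tangent_map gv vec_charts tt_momentum q u = 0 \<longrightarrow> tangent_map gv vec_charts tt_momentum q v = 0 \<longrightarrow>
              cot_form G (F q) (tangent_map gv gv F q u) (tangent_map gv gv F q v) = tt_form G q u v))"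
      by (intro exI[of _ UNIV] exI[of _ "mw_map \<xi>"]) (auto simp: smooth_mw_map \<Phi>(2) fibre form)
  qed
  then show ?thesis unfolding tt_charts_eq cot_charts_eq by blast
qed

section \<open>Poisson reduction\<close>

definition poisson_map :: "('g, 'e) tt \<Rightarrow> 'g \<times> 'e dual \<times> 'e" where
  "poisson_map = (\<lambda>(g, \<mu>, \<nu>, \<xi>). (g, \<nu> + coad G \<xi> \<mu>, Ad G (ginv g) \<xi>))"

lemma poisson_map_eq:
  "poisson_map = (\<lambda>(g, w). (g, (\<lambda>g (\<mu>, \<nu>, \<xi>). (\<nu> + coad G \<xi> \<mu>, Ad G (ginv g) \<xi>)) g w))"
  by (auto simp: poisson_map_def fun_eq_iff)

text \<open>Lets results on \<open>Ad\<close> at a fixed vector extend to vectors that move with the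
  point.\<close>

lemma Ad_expand: "Ad G g \<xi> = (\<Sum>b\<in>Basis. (\<xi> \<bullet> b) *\<^sub>R Ad G g b)"
proof -
  have "Ad G g (\<Sum>b\<in>Basis. (\<xi> \<bullet> b) *\<^sub>R b) = (\<Sum>b\<in>Basis. (\<xi> \<bullet> b) *\<^sub>R Ad G g b)"
    by (simp only: linear_sum[OF linear_Ad] linear_scale[OF linear_Ad])
  then show ?thesis by (simp only: euclidean_representation)
qed

lemma smooth_Ad_along:
  assumes "open S" "smooth_on S f" "f ` S \<subseteq> V p" "smooth_on S h"
  shows "smooth_on S (\<lambda>z. Ad G (ginv (psi p (f z))) (h z))"
proof -
  have "smooth_on S (\<lambda>z. \<Sum>b\<in>Basis. (h z \<bullet> b) *\<^sub>R Ad G (ginv (psi p (f z))) b)"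
    by (intro smooth_on_sum assms(1) smooth_on_bounded_bilinear[OF bounded_bilinear_scaleR]
      smooth_on_bounded_linear_compose[OF bounded_linear_inner_left] assms(4) smooth_on_compose[OF smooth_Ad open_V assms(2,1,3)])
  then show ?thesis by (simp only: Ad_expand[symmetric])
qed

lemma Ad_along_has_derivative:
  assumes f: "(f has_derivative f') (at z)" and h: "(h has_derivative h') (at z)" and z: "f z \<in> V p"
  shows "((\<lambda>z. Ad G (ginv (psi p (f z))) (h z)) has_derivative
    (\<lambda>v. Ad G (ginv (psi p (f z))) (h' v) + [Ad G (ginv (psi p (f z))) (h z), rho p (f z) (f' v)]\<^sub>G)) (at z)"
proof -
  let ?A = "\<lambda>z. Ad G (ginv (psi p (f z)))"
  have A: "((\<lambda>z. ?A z b) has_derivative (\<lambda>v. [?A z b, rho p (f z) (f' v)]\<^sub>G)) (at z)" for b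
    by (rule has_derivative_compose[OF f Ad_ginv_has_derivative[OF z]])
  have "((\<lambda>z. \<Sum>b\<in>Basis. (h z \<bullet> b) *\<^sub>R ?A z b) has_derivative
    (\<lambda>v. \<Sum>b\<in>Basis. (h z \<bullet> b) *\<^sub>R [?A z b, rho p (f z) (f' v)]\<^sub>G + (h' v \<bullet> b) *\<^sub>R ?A z b)) (at z)"
    by (intro has_derivative_sum has_derivative_scaleR has_derivative_inner_left h A)
  moreover have "(\<Sum>b\<in>Basis. (h z \<bullet> b) *\<^sub>R [?A z b, rho p (f z) (f' v)]\<^sub>G + (h' v \<bullet> b) *\<^sub>R ?A z b)
    = ?A z (h' v) + [?A z (h z), rho p (f z) (f' v)]\<^sub>G" for v
    unfolding sum.distrib Ad_expand[of _ "h' v"] Ad_expand[of _ "h z"] br.sum_left br.scaleR_left by (rule add.commute)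
  ultimately show ?thesis by (simp only: Ad_expand[symmetric])
qed

lemma smooth_poisson_map: "smooth_map gv gv poisson_map"
  unfolding poisson_map_eq
  by (rule smooth_gv_gv) (unfold case_prod_unfold, intro smooth_on_Pair smooth_on_add smooth_on_bounded_bilinear[OF coad_bounded_bilinear]
    smooth_Ad_along smooth_on_fst smooth_on_snd smooth_on_ident open_VW, auto)

text \<open>Moving g in \<open>Ad G (ginv g) \<xi>\<close> adds the bracket with
  \<open>TRi g a\<close>, the source of the terms with \<open>delta_xi\<close> in the reduced
  bracket.\<close>

lemma tangent_poisson_map:
  "tangent_map gv gv poisson_map (g, \<mu>, \<nu>, \<xi>) (a, \<alpha>, \<beta>, z) =
    (a, \<beta> + coad G z \<mu> + coad G \<xi> \<alpha>, Ad G (ginv g) z + [Ad G (ginv g) \<xi>, TRi g a]\<^sub>G)"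
proof -
  have "((\<lambda>q. (\<lambda>g (\<mu>, \<nu>, \<xi>). (\<nu> + coad G \<xi> \<mu>, Ad G (ginv g) \<xi>)) (psi g (fst q)) (snd q)) has_derivative
    (\<lambda>v. (fst (snd (snd v)) + (coad G \<xi> (fst (snd v)) + coad G (snd (snd (snd v))) \<mu>),
      Ad G (ginv g) (snd (snd (snd v))) + [Ad G (ginv g) \<xi>, TRi g (fst v)]\<^sub>G))) (at (phi g g, \<mu>, \<nu>, \<xi>))"
    unfolding case_prod_unfold
    by (rule has_derivative_eq_rhs, (rule has_derivative_Pair has_derivative_add has_derivative_fst
      has_derivative_snd has_derivative_ident co.FDERIV Ad_along_has_derivative)+) (auto simp: rho_self)
  from tangent_gv_gv[where k="\<lambda>g (\<mu>, \<nu>, \<xi>). (\<nu> + coad G \<xi> \<mu>, Ad G (ginv g) \<xi>)", OF this, of "(a, \<alpha>, \<beta>, z)"]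
  show ?thesis by (simp add: poisson_map_eq add_ac)
qed

lemma bidual_representation:
  fixes f :: "'e dual \<Rightarrow> real"
  assumes "linear f"
  shows "\<exists>!\<eta>. \<forall>l. f l = \<langle>l, \<eta>\<rangle>"
proof (rule ex_ex1I)
  \<comment> \<open>The functionals \<open>blinfun_inner_left b\<close> form the dual basis of
    \<open>Basis\<close>, so the coefficients of this vector are the values of f on that
    basis.\<close>
  let ?\<eta> = "\<Sum>b\<in>Basis. f (blinfun_inner_left b) *\<^sub>R b"
  have "f l = \<langle>l, ?\<eta>\<rangle>" for l
  proof -
    have "l = (\<Sum>b\<in>Basis. \<langle>l, b\<rangle> *\<^sub>R blinfun_inner_left b)"
    proof (rule blinfun_euclidean_eqI)
      fix i :: 'e assume i: "i \<in> Basis"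
      have "(\<Sum>b\<in>Basis. \<langle>l, b\<rangle> * (i \<bullet> b)) = (\<Sum>b\<in>Basis. if b = i then \<langle>l, b\<rangle> else 0)"
        using i by (intro sum.cong) (auto simp: inner_Basis)
      then show "\<langle>l, i\<rangle> = \<langle>\<Sum>b\<in>Basis. \<langle>l, b\<rangle> *\<^sub>R blinfun_inner_left b, i\<rangle>"
        using i by (simp add: blinfun.sum_left blinfun.scaleR_left)
    qed
    then have "f l = f (\<Sum>b\<in>Basis. \<langle>l, b\<rangle> *\<^sub>R blinfun_inner_left b)" by (rule arg_cong)
    also have "\<dots> = (\<Sum>b\<in>Basis. \<langle>l, b\<rangle> * f (blinfun_inner_left b))"
      by (simp add: linear_sum[OF assms] linear_scale[OF assms])
    also have "\<dots> = \<langle>l, ?\<eta>\<rangle>" by (simp add: blinfun.sum_right blinfun.scaleR_right mult.commute)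
    finally show ?thesis .
  qed
  then show "\<exists>\<eta>. \<forall>l. f l = \<langle>l, \<eta>\<rangle>" by blast
next
  fix \<eta> \<eta>' assume "\<forall>l. f l = \<langle>l, \<eta>\<rangle>" "\<forall>l. f l = \<langle>l, \<eta>'\<rangle>"
  then have "\<langle>blinfun_inner_left (\<eta> - \<eta>'), \<eta>\<rangle> = \<langle>blinfun_inner_left (\<eta> - \<eta>'), \<eta>'\<rangle>" by metis
  then have "(\<eta> - \<eta>') \<bullet> (\<eta> - \<eta>') = 0" by (simp add: inner_diff_left)
  then show "\<eta> = \<eta>'" by simp
qed

lemma TR_dual_apply: "\<langle>TR_dual G g \<alpha>, \<eta>\<rangle> = \<langle>\<alpha>, TR G g \<eta>\<rangle>"
  unfolding TR_dual_def
  by (simp add: bounded_linear_Blinfun_apply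
    bounded_linear_compose[OF blinfun.bounded_linear_right linear_linear[THEN iffD2, OF linear_TR]])

text \<open>Restricting the total derivative to coordinate slices shows that each partial
  derivative, defined by \<open>Blinfun\<close> or \<open>THE\<close>, has its intended value;
  linearity puts them together. The group part is expressed through \<open>TRi\<close>, to match
  \<open>tt_B\<close>.\<close>

lemma differential_red:
  assumes H: "smooth_map (red_charts G) vec_charts H"
  shows "differential gv H (g, \<nu>, \<xi>) (a, \<beta>, z)
    = \<langle>TR_dual G g (delta_g G H (g, \<nu>, \<xi>)), TRi g a\<rangle> + \<langle>\<beta>, delta_nu H (g, \<nu>, \<xi>)\<rangle> + \<langle>delta_xi H (g, \<nu>, \<xi>), z\<rangle>"
proof -
  let ?H = "\<lambda>q. H (psi g (fst q), snd q)"
  let ?D = "frechet_derivative ?H (at (phi g g, \<nu>, \<xi>))"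
  have D: "(?H has_derivative ?D) (at (phi g g, \<nu>, \<xi>))"
    using smooth_on_has_derivative[OF smooth_gv_vecD[OF H[unfolded red_charts_eq], of g]] by simp
  have total: "differential gv H (g, \<nu>, \<xi>) = ?D" by (rule tangent_gv_vec[OF D])
  have g: "((\<lambda>x. H (psi g x, \<nu>, \<xi>)) has_derivative (\<lambda>a. ?D (a, 0, 0))) (at (phi g g))"
    using has_derivative_compose[where f="\<lambda>x. (x, \<nu>, \<xi>)" and g="?H" and x="phi g g" and s=UNIV and f'="\<lambda>a. (a, 0, 0)", OF _ D]
    by (simp add: has_derivative_Pair zero_prod_def[symmetric])
  have n: "((\<lambda>\<nu>. H (g, \<nu>, \<xi>)) has_derivative (\<lambda>\<beta>. ?D (0, \<beta>, 0))) (at \<nu>)"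
    using has_derivative_compose[where f="\<lambda>\<nu>. (phi g g, \<nu>, \<xi>)" and g="?H" and x=\<nu> and s=UNIV and f'="\<lambda>\<beta>. (0, \<beta>, 0)", OF _ D]
    by (simp add: has_derivative_Pair)
  have x: "((\<lambda>\<xi>. H (g, \<nu>, \<xi>)) has_derivative (\<lambda>z. ?D (0, 0, z))) (at \<xi>)"
    using has_derivative_compose[where f="\<lambda>\<xi>. (phi g g, \<nu>, \<xi>)" and g="?H" and x=\<xi> and s=UNIV and f'="\<lambda>z. (0, 0, z)", OF _ D]
    by (simp add: has_derivative_Pair)
  have dg: "\<langle>delta_g G H (g, \<nu>, \<xi>), a\<rangle> = ?D (a, 0, 0)" for a
  proof -
    have "differential C (\<lambda>h. H (h, \<nu>, \<xi>)) g = (\<lambda>a. ?D (a, 0, 0))"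
      using frechet_derivative_eqI[OF g] by (simp add: tangent_map_def comp_def)
    then show ?thesis
      by (simp add: delta_g_def bounded_linear_Blinfun_apply[OF has_derivative_bounded_linear[OF g]])
  qed
  have dn: "?D (0, l, 0) = \<langle>l, delta_nu H (g, \<nu>, \<xi>)\<rangle>" for l
    unfolding delta_nu_def prod.case frechet_derivative_eqI[OF n]
    using theI'[OF bidual_representation[OF has_derivative_linear[OF n]]] by blast
  have dx: "\<langle>delta_xi H (g, \<nu>, \<xi>), z\<rangle> = ?D (0, 0, z)" for z
    unfolding delta_xi_def prod.case frechet_derivative_eqI[OF x]
    by (simp add: bounded_linear_Blinfun_apply[OF has_derivative_bounded_linear[OF x]])
  have "?D (a, \<beta>, z) = ?D (a, 0, 0) + (?D (0, \<beta>, 0) + ?D (0, 0, z))"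
  proof -
    have "(a, \<beta>, z) = (a, 0, 0) + ((0, \<beta>, 0) + (0, 0, z))" by simp
    then show ?thesis by (simp only: linear_add[OF has_derivative_linear[OF D]])
  qed
  moreover have "?D (a, 0, 0) = \<langle>TR_dual G g (delta_g G H (g, \<nu>, \<xi>)), TRi g a\<rangle>"
    unfolding TR_dual_apply TR_TRi by (rule dg[symmetric])
  moreover note dn[of \<beta>] dx[of z, symmetric] fun_cong[OF total, of "(a, \<beta>, z)"]
  ultimately show ?thesis by linarith
qed

lemma poisson_bracket_pullback:
  assumes H: "smooth_map (red_charts G) vec_charts H" and K: "smooth_map (red_charts G) vec_charts K"
  shows "poisson_bracket gv (tt_form G) (\<lambda>p. H (poisson_map p)) (\<lambda>p. K (poisson_map p)) p = red_bracket G H K (poisson_map p)"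
proof -
  obtain g \<mu> \<nu> \<xi> where p: "p = (g, \<mu>, \<nu>, \<xi>)" by (metis prod_cases4)
  define \<nu>' where "\<nu>' = \<nu> + coad G \<xi> \<mu>"
  define \<xi>' where "\<xi>' = Ad G (ginv g) \<xi>"
  let ?q = "(g, \<nu>', \<xi>')"
  have q: "poisson_map p = ?q" by (simp add: p poisson_map_def \<nu>'_def \<xi>'_def)
  have dif: "differential gv (\<lambda>p. F (poisson_map p)) p (a, \<alpha>, \<beta>, z)
    = \<langle>TR_dual G g (delta_g G F ?q), TRi g a\<rangle> + \<langle>\<beta> + coad G z \<mu> + coad G \<xi> \<alpha>, delta_nu F ?q\<rangle>
      + \<langle>delta_xi F ?q, Ad G (ginv g) z + [\<xi>', TRi g a]\<^sub>G\<rangle>"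
    if F: "smooth_map (red_charts G) vec_charts F" for F a \<alpha> \<beta> z
  proof -
    have "differential gv (\<lambda>p. F (poisson_map p)) p (a, \<alpha>, \<beta>, z)
      = differential gv F (poisson_map p) (tangent_map gv gv poisson_map p (a, \<alpha>, \<beta>, z))"
      by (rule tangent_map_compose[OF atlas_gv atlas_gv atlas_vec_charts smooth_poisson_map open_UNIV _
        F[unfolded red_charts_eq] open_UNIV]) auto
    then show ?thesis unfolding q unfolding p tangent_poisson_map differential_red[OF F] \<xi>'_def[symmetric] .
  qed
  define kg where "kg = TR_dual G g (delta_g G K ?q)"
  define kn where "kn = delta_nu K ?q"
  define kx where "kx = delta_xi K ?q"
  \<comment> \<open>Dictated by the z'-terms of i_X \<Omega> = - dK, once the \<mu>-terms on both
    sides have cancelled.\<close>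
  define \<alpha> where "\<alpha> = Blinfun (\<lambda>z. \<langle>kx, Ad G (ginv g) z\<rangle>)"
  have \<alpha>: "\<langle>\<alpha>, z\<rangle> = \<langle>kx, Ad G (ginv g) z\<rangle>" for z
    unfolding \<alpha>_def by (simp add: bounded_linear_Blinfun_apply
      bounded_linear_compose[OF blinfun.bounded_linear_right linear_linear[THEN iffD2, OF linear_Ad]])
  \<comment> \<open>The other components of X also come from comparing coefficients: the
    \<beta>'-terms give kn, the \<alpha>'-terms force the last component to be 0, so that \<xi> is
    conserved, and the terms in the group component leave this value of \<beta>.\<close>
  define \<beta> where "\<beta> = coad G kn \<nu> - coad G \<xi> \<alpha> + coad G kn (coad G \<xi> \<mu>) - kg - coad G \<xi>' kx"
  have X: "hamiltonian_vf gv (tt_form G) (\<lambda>p. K (poisson_map p)) p = (TR G g kn, \<alpha>, \<beta>, 0)"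
  proof (rule hamiltonian_vf_eqI[OF symplectic_tt[unfolded tt_charts_eq]])
    fix v :: "'e \<times> 'e dual \<times> 'e dual \<times> 'e"
    obtain b \<alpha>' \<beta>' z' where v: "v = (b, \<alpha>', \<beta>', z')" by (metis prod_cases4)
    show "tt_form G p (TR G g kn, \<alpha>, \<beta>, 0) v = - differential gv (\<lambda>p. K (poisson_map p)) p v"
      unfolding v dif[OF K] kg_def[symmetric] kn_def[symmetric] kx_def[symmetric] unfolding p tt_form_eq
      by (simp add: tt_B_def \<beta>_def \<alpha> blinfun.bilinear_simps)
  qed
  define hn where "hn = delta_nu H ?q"
  have "poisson_bracket gv (tt_form G) (\<lambda>p. H (poisson_map p)) (\<lambda>p. K (poisson_map p)) p
    = - (\<langle>TR_dual G g (delta_g G H ?q), kn\<rangle> + \<langle>\<beta> + coad G \<xi> \<alpha>, hn\<rangle> + \<langle>delta_xi H ?q, [\<xi>', kn]\<^sub>G\<rangle>)"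
    unfolding poisson_bracket_def X dif[OF H] hn_def by (simp add: linear_0[OF linear_Ad])
  \<comment> \<open>In \<beta> + \<open>coad G \<xi> \<alpha>\<close> the \<alpha>-terms cancel and
    the terms in \<nu> and \<mu> combine to \<open>coad G kn \<nu>'\<close>. The value therefore
    depends on the image point alone.\<close>
  also have "\<dots> = red_bracket G H K ?q"
    unfolding red_bracket_def prod.case Let_def kg_def[symmetric] kn_def[symmetric] kx_def[symmetric] hn_def[symmetric]
    using bracket_antisym[of kn \<xi>'] bracket_antisym[of hn \<xi>'] bracket_antisym[of hn kn]
    by (simp add: \<beta>_def \<nu>'_def blinfun.bilinear_simps br.minus_right)
  finally show ?thesis unfolding q .
qed

lemma poisson_reduction:
  "\<exists>\<Phi>. poisson_reduction_iso (tt_charts G) (tt_form G) (tt_action G) (red_charts G) (red_bracket G) \<Phi> \<and>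
    (\<forall>g \<nu> \<xi>. \<exists>\<xi>'. \<Phi> (orbit (tt_action G) (g, 0, \<nu>, \<xi>)) = (g, \<nu>, \<xi>'))"
proof -
  have "\<exists>\<Phi>. bij_betw \<Phi> (range (orbit (tt_action G))) UNIV \<and> (\<forall>p\<in>UNIV. \<Phi> (orbit (tt_action G) p) = poisson_map p)"
  proof (rule orbit_space_bij[OF tt_action_0 tt_action_add])
    show "poisson_map (tt_action G l p) = poisson_map p" for l p
      by (cases p) (auto simp: poisson_map_def co.add_right)
    show "\<exists>l. q = tt_action G l p" if pq: "poisson_map p = poisson_map q" for p q
    proof -
      obtain g \<mu> \<nu> \<xi> g' \<mu>' \<nu>' \<xi>' where *: "p = (g, \<mu>, \<nu>, \<xi>)" "q = (g', \<mu>', \<nu>', \<xi>')" by (metis prod_cases4)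
      have g: "g = g'" and n: "\<nu> + coad G \<xi> \<mu> = \<nu>' + coad G \<xi>' \<mu>'" and A: "Ad G (ginv g) \<xi> = Ad G (ginv g) \<xi>'"
        using pq unfolding * by (auto simp: poisson_map_def)
      \<comment> \<open>Both points lie over the same g, so \<open>Ad G g\<close> undoes the
        transport.\<close>
      have "\<xi> = \<xi>'" using arg_cong[OF A, of "Ad G g"] by simp
      then have "q = tt_action G (\<mu>' - \<mu>) p"
        using g n unfolding * by (auto simp: co.diff_right algebra_simps)
      then show ?thesis ..
    qed
    have "poisson_map (g, 0, \<nu>, Ad G g \<xi>) = (g, \<nu>, \<xi>)" for g \<nu> \<xi> by (simp add: poisson_map_def)
    then show "range poisson_map = UNIV" by (metis UNIV_eq_I prod_cases3 rangeI)
  qed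
  then obtain \<Phi> where \<Phi>: "bij_betw \<Phi> (range (orbit (tt_action G))) UNIV"
    "\<And>p. \<Phi> (orbit (tt_action G) p) = poisson_map p" by blast
  have comp: "\<Phi> \<circ> orbit (tt_action G) = poisson_map" "H \<circ> \<Phi> \<circ> orbit (tt_action G) = (\<lambda>p. H (poisson_map p))"
    for H :: "'g \<times> 'e dual \<times> 'e \<Rightarrow> real"
    by (auto simp: \<Phi>(2))
  have "surj (tangent_map gv gv poisson_map p)" for p
  proof -
    obtain g \<mu> \<nu> \<xi> where p: "p = (g, \<mu>, \<nu>, \<xi>)" by (metis prod_cases4)
    show ?thesis unfolding p
    proof (rule surjI)
      fix y :: "'e \<times> 'e dual \<times> 'e"
      \<comment> \<open>A right inverse with \<mu>-component 0: z is solved from the last component,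
        and the second component is then corrected by \<open>coad G z \<mu>\<close>.\<close>
      show "tangent_map gv gv poisson_map (g, \<mu>, \<nu>, \<xi>)
        ((\<lambda>y. let z = Ad G g (snd (snd y) - [Ad G (ginv g) \<xi>, TRi g (fst y)]\<^sub>G) in (fst y, 0, fst (snd y) - coad G z \<mu>, z)) y) = y"
        by (simp add: Let_def tangent_poisson_map)
    qed
  qed
  then have "poisson_reduction_iso gv (tt_form G) (tt_action G) gv (red_bracket G) \<Phi>"
    unfolding poisson_reduction_iso_def smooth_submersion_def comp
    using \<Phi> smooth_poisson_map poisson_bracket_pullback[unfolded red_charts_eq] by auto
  moreover have "\<exists>\<xi>'. \<Phi> (orbit (tt_action G) (g, 0, \<nu>, \<xi>)) = (g, \<nu>, \<xi>')" for g \<nu> \<xi>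
    by (simp add: \<Phi>(2) poisson_map_def)
  ultimately show ?thesis unfolding tt_charts_eq red_charts_eq by blast
qed

end

theorem mainTheorem12:
  fixes G :: "('g::{t2_space,second_countable_topology}, 'e::euclidean_space) lie_struct"
  assumes "lie_group G"
  shows
    "symplectic_form (tt_charts G) (tt_form G) \<and>
     symplectic_action (tt_charts G) (tt_form G) (tt_action G) \<and>
     (\<exists>\<Phi>. poisson_reduction_iso (tt_charts G) (tt_form G) (tt_action G)
            (red_charts G) (red_bracket G) \<Phi> \<and>
          (\<forall>g \<nu> \<xi>. \<exists>\<xi>'. \<Phi> (orbit (tt_action G) (g, 0, \<nu>, \<xi>)) = (g, \<nu>, \<xi>'))) \<and>
     momentum_map (tt_charts G) (tt_form G) (tt_action G) tt_momentum \<and>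
     symplectic_form (cot_charts G) (cot_form G) \<and>
     (\<forall>\<xi>. \<exists>\<Phi>. symplectic_reduction_iso (tt_charts G) (tt_form G) (tt_action G) tt_momentum \<xi>
            (cot_charts G) (cot_form G) \<Phi>)"
proof -
  interpret lie G by unfold_locales (rule assms)
  show ?thesis
    using symplectic_tt symplectic_tt_action poisson_reduction momentum_tt symplectic_cot symplectic_reduction
    by blast
qed

end
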